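(* There exists an infinite, finitely generated torsion subgroup of $\operatorname{Rec}_3^{\bowtie}$, generated by three elements of order $2$. Consequently $\operatorname{Rec}_3$ contains an infinite finitely generated torsion subgroup.
   Context: A rectangle in $\mathbb{R}^d$ is a set $\prod_{i=1}^d[a_i,b_i)$ with $a_i<b_i$ real. $\operatorname{Rec}_d$ is the group of bijections of $[0,1)^d$ for which there is a finite partition of $[0,1)^d$ into rectangles on each of which the map is a translation. A subset of $\mathbb{R}^d$ is small if it is contained in a finite union of affine hyperplanes. Let $E$ be the set of maps $f:[0,1)^d\to[0,1]^d$, left-continuous in each variable, for which there is a finite partition of $[0,1)^d$ into rectangles such that on each piece $f$ is of the form $x\mapsto Ax+v$ with $A$ diagonal with entries in $\{\pm1\}$. $\operatorname{Rec}_d^{\bowtie}$ is the set of elements of $E$ injective outside a small subset, with product $gf$ the unique element of $\operatorname{Rec}_d^{\bowtie}$ agreeing with $g\circ f$ outside a small subset. A torsion group is a group in which every element has finite order.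
   Formalization: In the definition of E, f is required to equal Ax+v on each half-open rectangle only off its interior lower faces (x_i = a_i > 0), where left-continuity fixes f; taken literally, the definition would make Rec_3^⋈ a finite group of coordinate flips. *)

theory Defs
  imports "HOL-Analysis.Analysis" "HOL-Algebra.Multiplicative_Group" "HOL-Algebra.Generated_Groups"
begin

definition rect_co :: "real ^ 'n \<Rightarrow> real ^ 'n \<Rightarrow> (real ^ 'n) set" where
  "rect_co a b = {x. \<forall>i. a $ i \<le> x $ i \<and> x $ i < b $ i}"

definition is_rectangle :: "(real ^ 'n) set \<Rightarrow> bool" where
  "is_rectangle R \<longleftrightarrow> (\<exists>a b. (\<forall>i. a $ i < b $ i) \<and> R = rect_co a b)"

definition unit_cube :: "(real ^ 'n) set" where
  "unit_cube = {x. \<forall>i. 0 \<le> x $ i \<and> x $ i < 1}"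

definition closed_unit_cube :: "(real ^ 'n) set" where
  "closed_unit_cube = {x. \<forall>i. 0 \<le> x $ i \<and> x $ i \<le> 1}"

definition rect_partition :: "(real ^ 'n) set set \<Rightarrow> bool" where
  "rect_partition P \<longleftrightarrow> finite P \<and> (\<forall>R\<in>P. is_rectangle R) \<and>
     (\<forall>R\<in>P. \<forall>R'\<in>P. R \<noteq> R' \<longrightarrow> R \<inter> R' = {}) \<and> \<Union>P = unit_cube"

definition affine_hyperplane :: "(real ^ 'n) set \<Rightarrow> bool" where
  "affine_hyperplane H \<longleftrightarrow> (\<exists>u c. u \<noteq> 0 \<and> H = {x. u \<bullet> x = c})"

definition small :: "(real ^ 'n) set \<Rightarrow> bool" where
  "small S \<longleftrightarrow> (\<exists>\<H>. finite \<H> \<and> (\<forall>H\<in>\<H>. affine_hyperplane H) \<and> S \<subseteq> \<Union>\<H>)"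

text \<open>Maps are total functions; we normalise them to be the identity outside [0,1)^d,
  so that a map on [0,1)^d is represented by exactly one HOL function.\<close>
definition extensional_cube :: "(real ^ 'n \<Rightarrow> real ^ 'n) \<Rightarrow> bool" where
  "extensional_cube f \<longleftrightarrow> (\<forall>x. x \<notin> unit_cube \<longrightarrow> f x = x)"

definition Rec_set :: "(real ^ 'n \<Rightarrow> real ^ 'n) set" where
  "Rec_set = {f. bij_betw f unit_cube unit_cube \<and> extensional_cube f \<and>
     (\<exists>P. rect_partition P \<and> (\<forall>R\<in>P. \<exists>v. \<forall>x\<in>R. f x = x + v))}"

definition Rec :: "(real ^ 'n \<Rightarrow> real ^ 'n) monoid" where
  "Rec = \<lparr>carrier = Rec_set, mult = (\<lambda>g f. g \<circ> f), one = id\<rparr>"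

text \<open>Left-continuity in each variable (at points of [0,1)^d; vacuous when the
  coordinate is 0, where there is no left neighbourhood in [0,1)).\<close>
definition left_cont_each_var :: "(real ^ 'n \<Rightarrow> real ^ 'n) \<Rightarrow> bool" where
  "left_cont_each_var f \<longleftrightarrow> (\<forall>x\<in>unit_cube. \<forall>i. 0 < x $ i \<longrightarrow>
     ((\<lambda>t. f (\<chi> j. if j = i then t else x $ j)) \<longlongrightarrow> f x) (at_left (x $ i)))"

text \<open>The set E.  On a piece rect_co a b the map is x \<mapsto> diag(s) x + v, where this is
  required at all points of the piece except those lying on an interior lower face
  (x_i = a_i > 0); there the value is forced by left-continuity instead.\<close>
definition E_set :: "(real ^ 'n \<Rightarrow> real ^ 'n) set" where
  "E_set = {f. (\<forall>x\<in>unit_cube. f x \<in> closed_unit_cube) \<and> left_cont_each_var f \<and>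
     extensional_cube f \<and>
     (\<exists>P. rect_partition P \<and> (\<forall>R\<in>P. \<exists>a b s v. R = rect_co a b \<and>
        (\<forall>i. s $ i = 1 \<or> s $ i = -1) \<and>
        (\<forall>x\<in>R. (\<forall>i. a $ i < x $ i \<or> x $ i = 0) \<longrightarrow>
            f x = (\<chi> i. s $ i * x $ i) + v)))}"

definition RecB_set :: "(real ^ 'n \<Rightarrow> real ^ 'n) set" where
  "RecB_set = {f \<in> E_set. \<exists>S. small S \<and> inj_on f (unit_cube - S)}"

definition RecB_mult :: "(real ^ 'n \<Rightarrow> real ^ 'n) \<Rightarrow> (real ^ 'n \<Rightarrow> real ^ 'n) \<Rightarrow> (real ^ 'n \<Rightarrow> real ^ 'n)" where
  "RecB_mult g f = (THE h. h \<in> RecB_set \<and>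
      (\<exists>S. small S \<and> (\<forall>x\<in>unit_cube - S. h x = g (f x))))"

definition RecB :: "(real ^ 'n \<Rightarrow> real ^ 'n) monoid" where
  "RecB = \<lparr>carrier = RecB_set, mult = RecB_mult, one = id\<rparr>"

definition torsion_set :: "('a, 'b) monoid_scheme \<Rightarrow> 'a set \<Rightarrow> bool" where
  "torsion_set G H \<longleftrightarrow> (\<forall>h\<in>H. \<exists>n::nat. 0 < n \<and> h [^]\<^bsub>G\<^esub> n = \<one>\<^bsub>G\<^esub>)"

end

(* The group acts on the torus R^3/Z^3. The involution a is x |-> alpha - x for a rotation vector
   alpha whose multiples are dense, and b, c act as x |-> -x on some pairs of opposite octants and
   trivially on the others, in such a way that each of b, c, bc is trivial on some pair (this needs
   three kinds of pairs, hence dimension 3). The orbit of x under x |-> alpha - x and x |-> -x is a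
   line, on which the group acts by local rules that depend on the octants of the points x + n alpha.
   Near a return of x + n alpha to the fixed point 0 the line looks like two copies of the orbit of 0
   glued by one edge, whose label is the octant of the return.

   Let g be a word and m the least number of exits of g from finite sets containing arbitrarily long
   initial segments of the half-line that is the orbit of 0. If m > 0, take an optimal such set and
   follow one of its exits back to where its path entered the set. The letters b, c applied at 0 along
   the path have a product that is trivial on some kind of octants, so in the double cover with this
   label the path stays on its side, and one gets a cut of the double cover with fewer than m exits.
   By density, copies of this double cover occur far out on the half-line, which contradicts the choice
   of m. So m = 0, the line of every x contains invariant blocks with bounded gaps, and all g-orbits
   are bounded. In Rec_3 the same line carries the orientation double cover of this action. *)

theory Submission
  imports Defs
begin

section \<open>Dihedral walks on labelled lines\<close>

text \<open>Torsion needs one exponent for all points at once, so mere recurrence of the pattern is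
  not enough: the gaps between its occurrences must be bounded uniformly in x, and the exponent is a
  factorial that absorbs all periods. The double covers are compared with the half-line through a
  folding. The folded path does not depend on the label of the glued edge, which is why the label
  can be chosen after the path is known. Each letter sees only nearby labels, so a cut with finitely
  many exits can be moved to any place where a long enough piece of the labelling recurs. Much of
  the remaining work is caused by the product of \<open>RecB\<close>, which is given only off small
  sets. Composites and inverses must be shown to exist; for inverses this is a comparison of
  volumes. The points whose orbit is a proper line avoid countably many hyperplanes, so elements of
  \<open>E_set\<close> have to be determined by their values off a Lebesgue null set, not only off a
  small one. The double cover in Rec_3 has no exceptional points.\<close>

datatype letter = GA | GB | GC

text \<open>The letter trivial at type 1 is \<open>GB\<close>, at type 2 it is \<open>GC\<close>; at
  type 0 both cross, so that their product is trivial. Every larger value blocks both letters; 3 is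
  used for the fixed point of the reflection.\<close>

definition moves :: "letter \<Rightarrow> nat \<Rightarrow> bool" where
  "moves x t = (case x of GA \<Rightarrow> False | GB \<Rightarrow> t = 0 \<or> t = 2 | GC \<Rightarrow> t = 0 \<or> t = 1)"

text \<open>Position \<open>2 * n\<close> stands for \<open>x + n \<alpha>\<close> and
  \<open>2 * n + 1\<close> for its negative. Hence \<open>GA\<close>, being
  \<open>x \<mapsto> \<alpha> - x\<close>, joins \<open>2 * n\<close> to \<open>2 * n - 1\<close>,
  and the edge from \<open>2 * n\<close> to \<open>2 * n + 1\<close> is the one governed by the
  label \<open>u n\<close>.\<close>

definition step :: "(int \<Rightarrow> nat) \<Rightarrow> letter \<Rightarrow> int \<Rightarrow> int" where
  "step u x k = (if x = GA then (if even k then k - 1 else k + 1)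
     else if moves x (u (k div 2)) then (if even k then k + 1 else k - 1) else k)"

definition walk :: "(int \<Rightarrow> nat) \<Rightarrow> letter list \<Rightarrow> int \<Rightarrow> int" where
  "walk u w k = foldr (step u) w k"

lemma walk_Nil [simp]: "walk u [] k = k"
  and walk_Cons [simp]: "walk u (x # w) k = step u x (walk u w k)"
  and walk_append: "walk u (w @ w') k = walk u w (walk u w' k)"
  by (simp_all add: walk_def)

lemma step_step [simp]: "step u x (step u x k) = k"
proof (cases "even k")
  case True
  then obtain n where "k = 2 * n" by blast
  then show ?thesis by (auto simp: step_def)
next
  case False
  then obtain n where "k = 2 * n + 1" by (rule oddE)
  then show ?thesis by (auto simp: step_def)
qed

lemma walk_rev_walk [simp]: "walk u (rev w) (walk u w k) = k"
  by (induction w) (auto simp: walk_append)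

lemma walk_walk_rev [simp]: "walk u w (walk u (rev w) k) = k"
  using walk_rev_walk[of u "rev w" k] by simp

lemma walk_inject: "walk u w k = walk u w l \<longleftrightarrow> k = l"
  by (metis walk_rev_walk)

lemma step_dist: "\<bar>step u x k - k\<bar> \<le> 1"
  by (auto simp: step_def)

lemma walk_dist: "\<bar>walk u w k - k\<bar> \<le> int (length w)"
proof (induction w)
  case (Cons x w)
  then show ?case using step_dist[of u x "walk u w k"] by auto
qed simp

text \<open>Locality, the reason why cuts and blocks can be carried from one labelling to another.
  The extra 1 is the largest distance from a position to the even number
  \<open>2 * (k div 2)\<close> under which its label is stored.\<close>

lemma walk_cong:
  assumes "\<And>n. \<bar>2 * n - k\<bar> \<le> int (length w) + 1 \<Longrightarrow> u n = u' n"
  shows "walk u w k = walk u' w k"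
  using assms
proof (induction w)
  case (Cons x w)
  have eq: "walk u w k = walk u' w k" using Cons by simp
  let ?k = "walk u w k"
  have "\<bar>?k - k\<bar> \<le> int (length w)" by (rule walk_dist)
  then have "\<bar>2 * (?k div 2) - k\<bar> \<le> int (length (x # w)) + 1" by simp
  then have "u (?k div 2) = u' (?k div 2)" using Cons.prems by blast
  then show ?case by (simp add: step_def flip: eq)
qed simp

lemma step_shift: "step (\<lambda>n. u (n + c)) x k + 2 * c = step u x (k + 2 * c)"
  by (auto simp: step_def add.commute)

lemma walk_shift: "walk (\<lambda>n. u (n + c)) w k + 2 * c = walk u w (k + 2 * c)"
  by (induction w) (auto simp: step_shift)

lemma walk_funpow: "(walk u w ^^ n) k = walk u (concat (replicate n w)) k"
  by (induction n) (auto simp: walk_append)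

text \<open>The quotient by the reflection \<open>k \<mapsto> 1 - k\<close>, which exchanges the
  ends 0 and 1 of the edge over the origin; each fibre has one point on either side.\<close>

definition fold_pos :: "int \<Rightarrow> int" where
  "fold_pos k = max k (1 - k)"

lemma fold_pos_ge1 [simp]: "fold_pos k \<ge> 1" and fold_pos_id: "k \<ge> 1 \<Longrightarrow> fold_pos k = k"
  by (auto simp: fold_pos_def)

lemma step_side: "step (p(0 := t)) x k \<ge> 1 \<longleftrightarrow> (k \<ge> 1 \<longleftrightarrow> \<not> (fold_pos k = 1 \<and> moves x t))"
proof (cases "even k")
  case True
  then obtain n where k: "k = 2 * n" by blast
  show ?thesis 
    by (cases "n = 0"; cases "n > 0"; cases x)
       (auto simp: k step_def fold_pos_def moves_def max_def split: letter.splits)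
next
  case False
  then obtain n where k: "k = 2 * n + 1" by (rule oddE)
  show ?thesis 
    by (cases "n = 0"; cases "n > 0"; cases x)
       (auto simp: k step_def fold_pos_def moves_def max_def split: letter.splits)
qed

lemma finite_fold_pos_vimage: "finite A \<Longrightarrow> finite {k. fold_pos k \<in> A}"
proof -
  assume "finite A"
  then have "finite (A \<union> (\<lambda>k. 1 - k) -` A)" by (auto intro!: finite_vimageI injI)
  moreover have "{k. fold_pos k \<in> A} \<subseteq> A \<union> (\<lambda>k. 1 - k) -` A"
    by (auto simp: fold_pos_def max_def split: if_splits)
  ultimately show ?thesis by (rule rev_finite_subset)
qed

section \<open>Cuts of the double covers and the descent on the number of their exits\<close>

definition exits :: "('a \<Rightarrow> 'a) \<Rightarrow> 'a set \<Rightarrow> 'a set" where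
  "exits f A = {x \<in> A. f x \<notin> A}"

context
  fixes p :: "int \<Rightarrow> nat"
  assumes p_sym: "\<And>n. p (- n) = p n"
begin

text \<open>With the label 3 at the origin neither \<^const>\<open>GB\<close> nor \<^const>\<open>GC\<close> crosses it, so this
  is the orbit of the fixed point, and the graphs with labels 0, 1, 2 are its double covers.\<close>

lemma fold_pos_step: "fold_pos (step (p(0 := t)) x k) = step (p(0 := 3)) x (fold_pos k)"
proof (cases "even k")
  case True
  then obtain n where k: "k = 2 * n" by blast
  have [simp]: "(1 - 2 * n) div 2 = - n" by presburger
  show ?thesis 
    by (cases "n = 0"; cases "n > 0"; cases x)
       (auto simp: k step_def fold_pos_def moves_def p_sym max_def split: letter.splits)
next
  case False
  then obtain n where k: "k = 2 * n + 1" by (rule oddE)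
  have [simp]: "(- (2 * n)) div 2 = - n" by presburger
  show ?thesis 
    by (cases "n = 0"; cases "n > 0"; cases x)
       (auto simp: k step_def fold_pos_def moves_def p_sym max_def split: letter.splits)
qed

lemma fold_pos_walk: "fold_pos (walk (p(0 := t)) w k) = walk (p(0 := 3)) w (fold_pos k)"
  by (induction w) (simp_all only: walk_Nil walk_Cons fold_pos_step)

text \<open>\<open>\<beta>\<close> and \<open>\<gamma>\<close> are the parities of the numbers of
  letters \<open>GB\<close> and \<open>GC\<close> applied while the folded walk stands at 1, the
  only place where a side can change. The folded walk runs in the graph with label 3 whatever
  \<open>t\<close> is, so both depend on \<open>j\<close> and \<open>w\<close> alone; hence the
  order of the quantifiers.\<close>

lemma walk_side_parity:
  "\<exists>\<beta> \<gamma>. \<forall>t k. fold_pos k = j \<longrightarrow>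
    (walk (p(0 := t)) w k \<ge> 1 \<longleftrightarrow> (k \<ge> 1 \<longleftrightarrow> ((\<beta> \<and> moves GB t) \<longleftrightarrow> (\<gamma> \<and> moves GC t))))"
proof (induction w)
  case Nil
  show ?case by (rule exI[of _ False], rule exI[of _ False]) simp
next
  case (Cons x w)
  then obtain \<beta> \<gamma> where IH: "\<And>t k. fold_pos k = j \<Longrightarrow>
    (walk (p(0 := t)) w k \<ge> 1 \<longleftrightarrow> (k \<ge> 1 \<longleftrightarrow> ((\<beta> \<and> moves GB t) \<longleftrightarrow> (\<gamma> \<and> moves GC t))))"
    by blast
  define c where "c \<longleftrightarrow> walk (p(0 := 3)) w j = 1"
  have "walk (p(0 := t)) (x # w) k \<ge> 1 \<longleftrightarrow> (k \<ge> 1 \<longleftrightarrow>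
    (((\<beta> \<noteq> (x = GB \<and> c)) \<and> moves GB t) \<longleftrightarrow> ((\<gamma> \<noteq> (x = GC \<and> c)) \<and> moves GC t)))"
    if "fold_pos k = j" for t k
  proof -
    have "fold_pos (walk (p(0 := t)) w k) = 1 \<longleftrightarrow> c"
      unfolding fold_pos_walk c_def that ..
    moreover have "\<not> moves GA t" by (simp add: moves_def)
    ultimately show ?thesis
      unfolding walk_Cons step_side IH[OF that] by (cases x) auto
  qed
  then show ?case by (intro exI allI impI)
qed

text \<open>Every element of the four-group generated by \<^const>\<open>GB\<close> and \<^const>\<open>GC\<close> acts trivially
  at one of the three types.\<close>

lemma walk_keeps_side:
  obtains t where "t < 3" "\<And>k. fold_pos k = j \<Longrightarrow> walk (p(0 := t)) w k \<ge> 1 \<longleftrightarrow> k \<ge> 1"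
proof -
  obtain \<beta> \<gamma> where *: "\<And>t k. fold_pos k = j \<Longrightarrow>
    (walk (p(0 := t)) w k \<ge> 1 \<longleftrightarrow> (k \<ge> 1 \<longleftrightarrow> ((\<beta> \<and> moves GB t) \<longleftrightarrow> (\<gamma> \<and> moves GC t))))"
    using walk_side_parity[of j w] by blast
  \<comment> \<open>For equal parities type 0 works, since there \<open>GB\<close> and
    \<open>GC\<close> cross alike and the crossings cancel in pairs; otherwise the type is the one
    at which the letter of odd parity does not cross.\<close>
  define t :: nat where "t = (if \<beta> = \<gamma> then 0 else if \<beta> then 1 else 2)"
  show thesis
  proof
    show "t < 3" by (simp add: t_def)
    show "walk (p(0 := t)) w k \<ge> 1 \<longleftrightarrow> k \<ge> 1" if "fold_pos k = j" for k
      unfolding *[OF that] by (auto simp: t_def moves_def)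
  qed
qed


lemma walk_half_line: "k \<ge> 1 \<Longrightarrow> walk (p(0 := 3)) w k \<ge> 1"
  by (metis fold_pos_walk fold_pos_id fold_pos_ge1)

text \<open>The cut \<open>S\<close> of the line with label \<open>t\<close> consists of the left half outside the lift of \<open>A\<close>,
  together with the points of the lift whose backward path leaves it on the left. It is
  crossed once for each path of \<open>A\<close> that changes sides, and \<open>t\<close> is chosen so that the path ending
  in \<open>z\<close> does not.\<close>

lemma smaller_cut:
  fixes w
  defines "g \<equiv> walk (p(0 := 3)) w"
  assumes A: "finite A" "A \<subseteq> {1..}" "{1..int (length w)} \<subseteq> A" and z: "z \<in> exits g A"
  obtains t S R where "t < 3" "finite (exits (walk (p(0 := t)) w) S)"
    "card (exits (walk (p(0 := t)) w) S) < card (exits g A)"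
    "\<And>k. k < - R \<Longrightarrow> k \<in> S" "\<And>k. k > R \<Longrightarrow> k \<notin> S"
proof -
  define G where "G = walk (p(0 := 3)) (rev w)"
  have Gg: "G (g k) = k" and gG: "g (G k) = k" for k by (simp_all add: G_def g_def)
  have "inj G" by (metis gG injI)
  then have inj_Gn: "inj (G ^^ n)" for n by (rule inj_fn)
  have zA: "z \<in> A" "g z \<notin> A" using z by (auto simp: exits_def)
  \<comment> \<open>A backward orbit staying in the finite set \<open>A\<close> would repeat. By
    injectivity it would then return to \<open>z\<close>, and \<open>g z\<close> would be one of its
    points, although \<open>g z\<close> lies outside \<open>A\<close>.\<close>
  have "\<exists>n. (G ^^ n) z \<notin> A"
  proof (rule ccontr)
    assume "\<not> ?thesis"
    then have all: "(G ^^ n) z \<in> A" for n by blast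
    have "inj (\<lambda>n. (G ^^ n) z)"
    proof (rule linorder_injI)
      fix m n :: nat assume "m < n"
      show "(G ^^ m) z \<noteq> (G ^^ n) z"
      proof
        assume eq: "(G ^^ m) z = (G ^^ n) z"
        obtain d where d: "n = m + Suc d" using \<open>m < n\<close> less_imp_Suc_add by auto
        have "(G ^^ m) z = (G ^^ m) ((G ^^ Suc d) z)"
          by (metis d eq funpow_add comp_apply)
        then have "z = (G ^^ Suc d) z" using inj_Gn by (meson injD)
        then have "g z = (G ^^ d) z" using gG by (metis funpow.simps(2) comp_apply)
        then show False using all zA by metis
      qed
    qed
    then have "infinite (range (\<lambda>n. (G ^^ n) z))" by (rule range_inj_infinite)
    moreover have "range (\<lambda>n. (G ^^ n) z) \<subseteq> A" using all by blast
    ultimately show False using A(1) finite_subset by blast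
  qed
  define n where "n = (LEAST n. (G ^^ n) z \<notin> A)"
  have n: "(G ^^ n) z \<notin> A" unfolding n_def by (rule LeastI_ex) fact
  have n_min: "(G ^^ j) z \<in> A" if "j < n" for j
    using that not_less_Least unfolding n_def by blast
  have n_unique: "m = n" if "(G ^^ m) z \<notin> A" "\<And>j. j < m \<Longrightarrow> (G ^^ j) z \<in> A" for m
    using that n n_min by (metis linorder_neqE_nat)
  \<comment> \<open>The word is \<open>w\<close> repeated \<open>Suc n\<close> times because the
    path in question runs from the last point before \<open>A\<close>, namely
    \<open>(G ^^ n) z\<close>, through \<open>z\<close> to \<open>g z\<close>.\<close>
  obtain t where t: "t < 3" and side: "\<And>k. fold_pos k = (G ^^ n) z \<Longrightarrow>
      walk (p(0 := t)) (concat (replicate (Suc n) w)) k \<ge> 1 \<longleftrightarrow> k \<ge> 1"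
    by (rule walk_keeps_side[of "(G ^^ n) z" "concat (replicate (Suc n) w)"]) blast
  define gi where "gi = walk (p(0 := t)) w"
  define Gi where "Gi = walk (p(0 := t)) (rev w)"
  have Ggi: "Gi (gi k) = k" and gGi: "gi (Gi k) = k" for k by (simp_all add: gi_def Gi_def)
  have fg: "fold_pos (gi k) = g (fold_pos k)" and fG: "fold_pos (Gi k) = G (fold_pos k)" for k
    unfolding gi_def Gi_def g_def G_def by (rule fold_pos_walk)+
  have fGn: "fold_pos ((Gi ^^ m) k) = (G ^^ m) (fold_pos k)" for m k
    by (induction m) (simp_all add: fG)
  have gGn: "(gi ^^ m) ((Gi ^^ m) k) = k" for m k
  proof (induction m)
    case (Suc m)
    have "(gi ^^ Suc m) ((Gi ^^ Suc m) k) = (gi ^^ m) (gi (Gi ((Gi ^^ m) k)))"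
      by (simp add: funpow_swap1)
    then show ?case using Suc gGi by simp
  qed simp
  define E where "E = {k. fold_pos k \<in> A}"
  \<comment> \<open>Points whose backward path never leaves \<open>E\<close> lie on cycles inside
    \<open>E\<close>; they can be left out without creating an exit.\<close>
  define B where "B = {k \<in> E. \<exists>m. (\<forall>j<m. (Gi ^^ j) k \<in> E) \<and> (Gi ^^ m) k \<notin> E \<and> (Gi ^^ m) k \<le> 0}"
  define S where "S = {k. k \<le> 0 \<and> k \<notin> E} \<union> B"
  have finE: "finite E" unfolding E_def using A(1) by (rule finite_fold_pos_vimage)
  \<comment> \<open>Since \<open>A\<close> contains \<open>{1..int (length w)}\<close>, a point
    outside the lift is so far from the origin that one application of \<open>w\<close> cannot take
    it across.\<close>
  have outE: "k > int (length w) \<or> k \<le> - int (length w)" if "k \<notin> E" for k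
  proof (rule ccontr)
    assume "\<not> ?thesis"
    then have "fold_pos k \<in> {1..int (length w)}" by (auto simp: fold_pos_def)
    then show False using that A(3) unfolding E_def by blast
  qed
  have exitD: "z' \<in> B \<and> gi z' \<notin> E \<and> gi z' \<ge> 1" if "z' \<in> exits gi S" for z'
  proof -
    have zS: "z' \<in> S" "gi z' \<notin> S" using that by (auto simp: exits_def)
    show ?thesis
    proof (cases "z' \<in> B")
      case True
      have "gi z' \<notin> E"
      proof
        assume gE: "gi z' \<in> E"
        obtain m where m: "\<And>j. j < m \<Longrightarrow> (Gi ^^ j) z' \<in> E" "(Gi ^^ m) z' \<notin> E" "(Gi ^^ m) z' \<le> 0"
          using True by (auto simp: B_def)
        have *: "(Gi ^^ Suc j) (gi z') = (Gi ^^ j) z'" for j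
          using Ggi by (simp add: funpow_Suc_right del: funpow.simps)
        have "(Gi ^^ j) (gi z') \<in> E" if "j < Suc m" for j
          using that m(1) gE * by (cases j) (auto simp del: funpow.simps(2))
        moreover have "(Gi ^^ Suc m) (gi z') \<notin> E" "(Gi ^^ Suc m) (gi z') \<le> 0"
          unfolding * by (fact m(2) m(3))+
        ultimately have "gi z' \<in> B"
          unfolding B_def mem_Collect_eq by (intro conjI gE exI[of _ "Suc m"] allI impI)
        then show False using zS by (simp add: S_def)
      qed
      then show ?thesis using True zS by (auto simp: S_def)
    next
      case False
      then have z': "z' \<le> 0" "z' \<notin> E" using zS by (auto simp: S_def)
      then have "z' \<le> - int (length w)" using outE by force
      then have le0: "gi z' \<le> 0" using walk_dist[of "p(0 := t)" w z'] by (simp add: gi_def)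
      show ?thesis
      proof (cases "gi z' \<in> E")
        case True
        have "\<forall>j<1. (Gi ^^ j) (gi z') \<in> E" "(Gi ^^ 1) (gi z') \<notin> E" "(Gi ^^ 1) (gi z') \<le> 0"
          using True z' Ggi by auto
        then have "gi z' \<in> B" using True unfolding B_def by blast
        then show ?thesis using zS by (simp add: S_def)
      next
        case False
        then show ?thesis using zS le0 by (simp add: S_def)
      qed
    qed
  qed
  \<comment> \<open>An exit ends on the right half, where folding is the identity; so the fold of
    \<open>z'\<close> determines \<open>gi z'\<close> and with it \<open>z'\<close>.\<close>
  have fold_exit: "g (fold_pos z') = gi z'" if "z' \<in> exits gi S" for z'
    using exitD[OF that] fold_pos_id fg by metis
  have inj: "inj_on fold_pos (exits gi S)"
    by (rule inj_onI) (metis fold_exit Ggi)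
  have sub: "fold_pos ` exits gi S \<subseteq> exits g A - {z}"
  proof
    fix y assume "y \<in> fold_pos ` exits gi S"
    then obtain z' where z': "z' \<in> exits gi S" and y: "y = fold_pos z'" by blast
    note ex = exitD[OF z']
    have "y \<in> A" using ex by (simp add: y B_def E_def)
    moreover have "g y \<notin> A" using ex fold_exit[OF z'] fold_pos_id[of "gi z'"] by (simp add: y E_def)
    \<comment> \<open>For an exit over \<open>z\<close> the backward paths in the cover and in the
      half-line leave \<open>E\<close> and \<open>A\<close> after the same number \<open>n\<close>
      of steps. Its path would lead from the left half to the right half, against the choice of
      \<open>t\<close>.\<close>
    moreover have "y \<noteq> z"
    proof
      assume yz: "y = z"
      obtain m where m: "\<And>j. j < m \<Longrightarrow> (Gi ^^ j) z' \<in> E" "(Gi ^^ m) z' \<notin> E" "(Gi ^^ m) z' \<le> 0"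
        using ex by (auto simp: B_def)
      have "m = n"
        using m(1,2) by (intro n_unique) (auto simp: E_def fGn y[symmetric] yz)
      have "walk (p(0 := t)) (concat (replicate (Suc n) w)) ((Gi ^^ n) z') = gi z'"
        using gGn[of n z'] by (simp only: walk_funpow[symmetric] gi_def[symmetric] funpow.simps comp_apply)
      moreover have "fold_pos ((Gi ^^ n) z') = (G ^^ n) z"
        by (simp add: fGn y[symmetric] yz)
      ultimately have "gi z' \<ge> 1 \<longleftrightarrow> (Gi ^^ n) z' \<ge> 1" using side by metis
      then show False using ex m(3) \<open>m = n\<close> by simp
    qed
    ultimately show "y \<in> exits g A - {z}" by (simp add: exits_def)
  qed
  have fin: "finite (exits g A)" using A(1) by (simp add: exits_def)
  then have finS: "finite (exits gi S)" using inj sub by (meson finite_Diff inj_on_finite)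
  have "card (exits gi S) \<le> card (exits g A - {z})"
    using inj sub fin by (intro card_inj_on_le) auto
  also have "\<dots> < card (exits g A)" using z fin by (meson card_Diff1_less)
  finally have card: "card (exits gi S) < card (exits g A)" .
  define R where "R = Max (insert 0 (abs ` E))"
  have R: "\<bar>k\<bar> \<le> R" if "k \<in> E" for k using that finE by (auto simp: R_def intro!: Max_ge)
  have "R \<ge> 0" using finE by (auto simp: R_def intro!: Max_ge)
  show thesis
  proof (rule that[of t S R])
    show "k \<in> S" if "k < - R" for k using that R[of k] \<open>R \<ge> 0\<close> by (auto simp: S_def)
    show "k \<notin> S" if "k > R" for k using that R[of k] \<open>R \<ge> 0\<close> by (auto simp: S_def B_def)
  qed (use t finS card in \<open>simp_all add: gi_def\<close>)
qed

context
  assumes p_rec: "\<And>t R D. t < 3 \<Longrightarrow> \<exists>c>D. \<forall>n. \<bar>n\<bar> \<le> R \<longrightarrow> p (c + n) = (p(0 := t)) n"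
begin

text \<open>\<open>S\<close> looks like a half-line outside a bounded window and \<open>w\<close>
  moves points by at most its length, so all exits are near that window and depend on finitely many
  labels. These recur around some \<open>c\<close> as far out as desired. Truncating at 1 costs no
  exit because the half-line is invariant.\<close>

lemma transplant_cut:
  fixes w
  defines "g \<equiv> walk (p(0 := 3)) w"
  assumes t: "t < 3" and fin: "finite (exits (walk (p(0 := t)) w) S)"
    and left: "\<And>k. k < - R \<Longrightarrow> k \<in> S" and right: "\<And>k. k > R \<Longrightarrow> k \<notin> S"
  obtains A where "finite A" "A \<subseteq> {1..}" "{1..D} \<subseteq> A"
    "card (exits g A) \<le> card (exits (walk (p(0 := t)) w) S)"
proof -
  define L where "L = int (length w)"
  define R' where "R' = \<bar>R\<bar> + 2 * L + 5"
  \<comment> \<open>\<open>c\<close> is so large that all of \<open>{1..D}\<close> falls to the left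
    of the window, and that the window stays clear of the origin, where the half-line has label 3
    instead of the label of \<open>p\<close>.\<close>
  obtain c where c: "c > \<bar>D\<bar> + R' + \<bar>R\<bar> + L + 10"
    and pc: "\<And>n. \<bar>n\<bar> \<le> R' \<Longrightarrow> p (c + n) = (p(0 := t)) n"
    using p_rec[OF t, of "\<bar>D\<bar> + R' + \<bar>R\<bar> + L + 10" R'] by blast
  have L0: "L \<ge> 0" by (simp add: L_def)
  define A where "A = {k. 1 \<le> k \<and> k - 2 * c \<in> S}"
  have "A \<subseteq> {1..2 * c + R}"
  proof
    fix k assume "k \<in> A"
    then show "k \<in> {1..2 * c + R}" using right[of "k - 2 * c"] by (auto simp: A_def not_less[symmetric])
  qed
  then have finA: "finite A" by (rule finite_subset) simp
  have exit: "z - 2 * c \<in> exits (walk (p(0 := t)) w) S" if "z \<in> exits g A" for z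
  proof -
    have z: "1 \<le> z" "z - 2 * c \<in> S" "g z \<notin> A" using that by (auto simp: exits_def A_def)
    have "g z \<ge> 1" using walk_half_line z(1) by (simp add: g_def)
    then have gz: "g z - 2 * c \<notin> S" using z(3) by (simp add: A_def)
    have dist: "\<bar>g z - z\<bar> \<le> L" unfolding g_def L_def by (rule walk_dist)
    have "z - 2 * c \<le> R" using right[of "z - 2 * c"] z(2) by linarith
    moreover have "g z - 2 * c \<ge> - R" using left[of "g z - 2 * c"] gz by linarith
    ultimately have bd: "\<bar>z - 2 * c\<bar> \<le> \<bar>R\<bar> + L" using L0 dist by linarith
    have "walk (\<lambda>n. (p(0 := 3)) (n + c)) w (z - 2 * c) = walk (p(0 := t)) w (z - 2 * c)"
    proof (rule walk_cong)
      fix n assume "\<bar>2 * n - (z - 2 * c)\<bar> \<le> int (length w) + 1"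
      then have "\<bar>n\<bar> \<le> R'" using bd by (simp add: R'_def L_def)
      then show "(p(0 := 3)) (n + c) = (p(0 := t)) n"
        using pc[of n] c L0 by (auto simp: add.commute R'_def)
    qed
    then have "g z - 2 * c = walk (p(0 := t)) w (z - 2 * c)"
      using walk_shift[of "p(0 := 3)" c w "z - 2 * c"] by (simp add: g_def)
    then show ?thesis using z gz by (simp add: exits_def)
  qed
  show thesis
  proof
    show "{1..D} \<subseteq> A"
    proof
      fix k assume k: "k \<in> {1..D}"
      then have "k - 2 * c < - R" using c L0 unfolding R'_def by auto
      then show "k \<in> A" using left k by (simp add: A_def)
    qed
    show "card (exits g A) \<le> card (exits (walk (p(0 := t)) w) S)"
      by (rule card_inj_on_le[of "\<lambda>z. z - 2 * c"]) (use exit fin in \<open>auto intro: inj_onI\<close>)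
  qed (use finA in \<open>auto simp: A_def\<close>)
qed

lemma finite_invariant_set:
  obtains A where "finite A" "A \<subseteq> {1..}" "{1..int (length w)} \<subseteq> A"
    "\<And>k. k \<in> A \<Longrightarrow> walk (p(0 := 3)) w k \<in> A"
proof -
  define L where "L = int (length w)"
  define g where "g = walk (p(0 := 3)) w"
  \<comment> \<open>\<open>D\<close> is universally quantified so that both ends of a descent step
    are covered: the set to start from must contain \<open>{1..int (length w)}\<close>, and the new
    set must contain the interval for which \<open>m - 1\<close> exits do not suffice.\<close>
  define P where "P m \<longleftrightarrow> (\<forall>D. \<exists>A. finite A \<and> A \<subseteq> {1..} \<and> {1..D} \<subseteq> A \<and> card (exits g A) \<le> m)" for m
  have "P (length w)"
    unfolding P_def
  proof
    fix D
    \<comment> \<open>Only the last \<open>length w\<close> points of an interval can leave it,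
      since its left end is closed off by the invariance of the half-line.\<close>
    have "exits g {1..D} \<subseteq> {D - L<..D}"
    proof
      fix z assume z: "z \<in> exits g {1..D}"
      then have "g z \<ge> 1" using walk_half_line by (simp add: g_def exits_def)
      then show "z \<in> {D - L<..D}"
        using z walk_dist[of "p(0 := 3)" w z] by (auto simp: exits_def g_def L_def)
    qed
    then have "card (exits g {1..D}) \<le> card {D - L<..D}" by (intro card_mono) auto
    then show "\<exists>A. finite A \<and> A \<subseteq> {1..} \<and> {1..D} \<subseteq> A \<and> card (exits g A) \<le> length w"
      by (intro exI[of _ "{1..D}"]) (auto simp: L_def)
  qed
  define m where "m = (LEAST m. P m)"
  have Pm: "P m" unfolding m_def by (rule LeastI) fact
  have "m = 0"
  proof (rule ccontr)
    assume "m \<noteq> 0"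
    then have "\<not> P (m - 1)" unfolding m_def by (intro not_less_Least) simp
    then obtain D where
      D: "\<not> (\<exists>A. finite A \<and> A \<subseteq> {1..} \<and> {1..D} \<subseteq> A \<and> card (exits g A) \<le> m - 1)"
      unfolding P_def not_all by (elim exE)
    obtain A where A: "finite A" "A \<subseteq> {1..}" "{1..max D L} \<subseteq> A" and cA: "card (exits g A) \<le> m"
      using Pm[unfolded P_def, rule_format, of "max D L"] by (elim exE conjE)
    have "{1..D} \<subseteq> {1..max D L}" "{1..int (length w)} \<subseteq> {1..max D L}" by (auto simp: L_def)
    with A(3) have DA: "{1..D} \<subseteq> A" and LA: "{1..int (length w)} \<subseteq> A" by blast+
    have "exits g A \<noteq> {}"
    proof
      assume "exits g A = {}"
      then have "card (exits g A) \<le> m - 1" by simp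
      then show False using D A(1,2) DA by metis
    qed
    then obtain z where z: "z \<in> exits g A" by blast
    obtain t S R where *: "t < 3" "finite (exits (walk (p(0 := t)) w) S)"
      "card (exits (walk (p(0 := t)) w) S) < card (exits g A)"
      "\<And>k. k < - R \<Longrightarrow> k \<in> S" "\<And>k. k > R \<Longrightarrow> k \<notin> S"
      using smaller_cut[OF A(1,2) LA z[unfolded g_def]] unfolding g_def by metis
    obtain A' where A': "finite A'" "A' \<subseteq> {1..}" "{1..D} \<subseteq> A'"
      "card (exits g A') \<le> card (exits (walk (p(0 := t)) w) S)"
      using transplant_cut[OF *(1,2,4,5), where D = D] unfolding g_def by metis
    have "card (exits g A') \<le> m - 1" using A'(4) *(3) cA by linarith
    then show False using D A'(1,2,3) by metis
  qed
  then obtain A where A: "finite A" "A \<subseteq> {1..}" "{1..L} \<subseteq> A" "card (exits g A) = 0"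
    using Pm[unfolded P_def, rule_format, of L] by (elim exE conjE) simp
  then have "exits g A = {}" by (simp add: exits_def)
  then show thesis using that[of A] A by (auto simp: exits_def g_def L_def)
qed

text \<open>The lift of a finite invariant set is invariant in each double cover, so every long
  enough copy of the cover with label 0 contains an invariant block. With blocks at bounded distance
  on either side, orbits are trapped in sets of bounded size; \<open>K\<close> is the same for all
  \<open>u\<close> and \<open>k\<close>, hence so is \<open>N\<close>.\<close>

theorem walk_torsion:
  assumes rec: "\<And>R. \<exists>K. \<forall>u\<in>\<Omega>. \<forall>k. \<exists>c. k \<le> c \<and> c \<le> k + K \<and> (\<forall>n. \<bar>n\<bar> \<le> R \<longrightarrow> u (c + n) = (p(0 := 0)) n)"
  obtains N where "N > 0" "\<And>u k. u \<in> \<Omega> \<Longrightarrow> (walk u w ^^ N) k = k"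
proof -
  define L where "L = int (length w)"
  obtain A where A: "finite A" "A \<subseteq> {1..}" "{1..L} \<subseteq> A"
    and inv: "\<And>k. k \<in> A \<Longrightarrow> walk (p(0 := 3)) w k \<in> A"
    using finite_invariant_set unfolding L_def by metis
  define E where "E = {k. fold_pos k \<in> A}"
  have finE: "finite E" unfolding E_def using A(1) by (rule finite_fold_pos_vimage)
  have invE: "walk (p(0 := 0)) w k \<in> E" if "k \<in> E" for k
    using that inv by (simp only: E_def mem_Collect_eq fold_pos_walk)
  have inE: "k \<in> E" if "- L < k" "k \<le> L" for k
  proof -
    have "fold_pos k \<in> {1..L}" using that by (auto simp: fold_pos_def)
    then show ?thesis using A(3) unfolding E_def by blast
  qed
  define R where "R = Max (insert 0 (abs ` E))"
  have R: "\<bar>k\<bar> \<le> R" if "k \<in> E" for k using that finE by (auto simp: R_def intro!: Max_ge)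
  have R0: "R \<ge> 0" using finE by (auto simp: R_def intro!: Max_ge)
  have L0: "L \<ge> 0" by (simp add: L_def)
  define R' where "R' = R + L + 1"
  obtain K where K: "\<And>u k. u \<in> \<Omega> \<Longrightarrow> \<exists>c. k \<le> c \<and> c \<le> k + K \<and> (\<forall>n. \<bar>n\<bar> \<le> R' \<longrightarrow> u (c + n) = (p(0 := 0)) n)"
    using rec[of R'] by blast
  define M where "M = 2 * \<bar>K\<bar> + R + 10"
  \<comment> \<open>An orbit will have at most \<open>2 * M + 1\<close> points; the factorial is a
    common multiple of all possible periods.\<close>
  define N :: nat where "N = fact (nat (2 * M + 1))"
  show thesis
  proof
    show "N > 0" by (simp add: N_def)
    fix u k assume u: "u \<in> \<Omega>"
    define g where "g = walk u w"
    have block: "g (j + 2 * c) - 2 * c \<in> E"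
      if c: "\<And>n. \<bar>n\<bar> \<le> R' \<Longrightarrow> u (c + n) = (p(0 := 0)) n" and j: "j \<in> E" for c j
    proof -
      have "walk (\<lambda>n. u (n + c)) w j = walk (p(0 := 0)) w j"
        by (rule walk_cong) (use R[OF j] c in \<open>auto simp: R'_def L_def add.commute\<close>)
      then have "g (j + 2 * c) - 2 * c = walk (p(0 := 0)) w j"
        using walk_shift[of u c w j] by (simp add: g_def)
      then show ?thesis using invE[OF j] by metis
    qed
    obtain c1 where c1: "k div 2 - K - 1 \<le> c1" "c1 \<le> k div 2 - K - 1 + K"
      and uc1: "\<And>n. \<bar>n\<bar> \<le> R' \<Longrightarrow> u (c1 + n) = (p(0 := 0)) n"
      using K[OF u, of "k div 2 - K - 1"] by blast
    obtain c2 where c2: "k div 2 + 1 \<le> c2" "c2 \<le> k div 2 + 1 + K"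
      and uc2: "\<And>n. \<bar>n\<bar> \<le> R' \<Longrightarrow> u (c2 + n) = (p(0 := 0)) n"
      using K[OF u, of "k div 2 + 1"] by blast
    \<comment> \<open>The gap between the two blocks is closed off by the blocks themselves: each
      covers \<open>length w\<close> positions on either side of its central edge, so one
      application of \<open>w\<close> cannot jump over it.\<close>
    define S where "S = {j. (2 * c1 < j \<and> j \<le> 2 * c2) \<or> j - 2 * c1 \<in> E \<or> j - 2 * c2 \<in> E}"
    have "k \<in> S" using c1 c2 by (simp add: S_def) linarith
    have gS: "g j \<in> S" if "j \<in> S" for j
    proof (cases "j - 2 * c1 \<in> E \<or> j - 2 * c2 \<in> E")
      case True
      then show ?thesis
        using block[OF uc1, of "j - 2 * c1"] block[OF uc2, of "j - 2 * c2"] by (auto simp: S_def)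
    next
      case False
      then have j: "2 * c1 < j" "j \<le> 2 * c2" using that by (auto simp: S_def)
      have "j - 2 * c1 > L" "j - 2 * c2 \<le> - L"
        using inE[of "j - 2 * c1"] inE[of "j - 2 * c2"] False j L0 by linarith+
      then show ?thesis using walk_dist[of u w j] by (auto simp: S_def g_def L_def)
    qed
    have S_sub: "S \<subseteq> {k - M..k + M}"
    proof
      fix j assume "j \<in> S"
      then have "2 * c1 - R \<le> j \<and> j \<le> 2 * c2 + R"
        using R[of "j - 2 * c1"] R[of "j - 2 * c2"] c1 c2 R0 unfolding S_def by auto
      then show "j \<in> {k - M..k + M}" using c1 c2 R0 unfolding M_def by auto
    qed
    have orb: "(g ^^ n) k \<in> S" for n by (induction n) (use \<open>k \<in> S\<close> gS in auto)
    have M0: "M \<ge> 0" using R0 by (simp add: M_def)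
    have "\<not> inj_on (\<lambda>n. (g ^^ n) k) {0..nat (2 * M + 1)}"
    proof
      assume "inj_on (\<lambda>n. (g ^^ n) k) {0..nat (2 * M + 1)}"
      then have "card {0..nat (2 * M + 1)} \<le> card {k - M..k + M}"
        by (rule card_inj_on_le) (use orb S_sub in auto)
      then show False using M0 by simp
    qed
    then obtain m n where mn: "m < n" "n \<le> nat (2 * M + 1)" "(g ^^ m) k = (g ^^ n) k"
      by (metis atLeastAtMost_iff linorder_inj_onI' linorder_neqE_nat)
    have "inj g" unfolding g_def by (rule injI) (simp add: walk_inject)
    then have "inj (g ^^ m)" by (rule inj_fn)
    moreover have "(g ^^ m) ((g ^^ (n - m)) k) = (g ^^ m) k"
      using mn by (metis comp_apply funpow_add le_add_diff_inverse less_imp_le)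
    ultimately have per: "(g ^^ (n - m)) k = k" by (meson injD)
    have "n - m dvd N" unfolding N_def by (rule dvd_fact) (use mn in auto)
    then obtain d where "N = (n - m) * d" by blast
    then have "(g ^^ N) k = ((g ^^ (n - m)) ^^ d) k" by (simp add: funpow_mult mult.commute)
    also have "\<dots> = k" by (induction d) (simp_all add: per)
    finally show "(walk u w ^^ N) k = k" by (simp add: g_def)
  qed
qed

end

end

section \<open>Recurrence of the octants along a rotation of the torus\<close>

text \<open>Kronecker's theorem asks for coordinates that are rationally independent together with
  1. The first three powers of a fourth root of 1/2 have this property, can be handled by two
  quadratic extensions, and lie strictly between 0 and 1.\<close>

definition root_half :: real where
  "root_half = root 4 (1 / 2)"

lemma root_half_pow4: "root_half ^ 4 = 1 / 2"
  by (simp add: root_half_def)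

lemma root_half_bounds: "0 < root_half" "root_half < 1"
proof -
  show "0 < root_half" by (simp add: root_half_def)
  show "root_half < 1"
  proof (rule ccontr)
    assume "\<not> root_half < 1"
    then have "1 \<le> root_half ^ 4" by (simp add: one_le_power)
    then show False by (simp add: root_half_pow4)
  qed
qed

lemma root_half_square_irrational: "root_half ^ 2 \<notin> \<rat>"
proof
  assume "root_half ^ 2 \<in> \<rat>"
  then obtain m n :: nat where n: "n \<noteq> 0" and mn: "\<bar>root_half ^ 2\<bar> = real m / real n" and co: "coprime m n"
    by (rule Rats_abs_nat_div_natE)
  have "(root_half ^ 2)\<^sup>2 = 1 / 2" using root_half_pow4 by (simp flip: power_mult)
  then have "(real m / real n)\<^sup>2 = 1 / 2" using mn by (metis power2_abs)
  then have "real (2 * m\<^sup>2) = real (n\<^sup>2)" using n by (simp add: power_divide field_simps)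
  then have eq: "2 * m\<^sup>2 = n\<^sup>2" by (simp only: of_nat_eq_iff)
  then have "even (n\<^sup>2)" by (metis dvd_triv_left)
  then have "even n" by simp
  then obtain k where "n = 2 * k" by blast
  then have "m\<^sup>2 = 2 * k\<^sup>2" using eq by (simp add: power_mult_distrib)
  then have "even (m\<^sup>2)" by simp
  then have "even m" by simp
  then show False using co \<open>even n\<close> by (metis coprime_common_divisor_nat odd_one coprime_def)
qed

lemma rat_combination_eq_0:
  fixes a b x :: real
  assumes "a + b * x = 0" "a \<in> \<rat>" "b \<in> \<rat>" "x \<notin> \<rat>"
  shows "a = 0 \<and> b = 0"
proof (cases "b = 0")
  case False
  then have "x = - a / b" using assms(1) by (simp add: field_simps)
  moreover have "- a / b \<in> \<rat>" using assms(2,3) by simp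
  ultimately show ?thesis using assms(4) by simp
qed (use assms in simp)

text \<open>Over the field generated by the irrational \<open>S = root_half ^ 2\<close> the relation
  reads \<open>A + B * root_half = 0\<close>. A nonzero \<open>B\<close> would put
  \<open>root_half\<close> into that field, and comparing coefficients in
  \<open>S = (r + q * S) ^ 2\<close> would give both \<open>r ^ 2 + q ^ 2 / 2 = 0\<close> and
  \<open>2 * r * q = 1\<close>.\<close>

lemma root_half_independent:
  fixes a b c d :: int
  assumes "of_int a + of_int b * root_half + of_int c * root_half ^ 2 + of_int d * root_half ^ 3 = 0"
  shows "a = 0 \<and> b = 0 \<and> c = 0 \<and> d = 0"
proof -
  define S where "S = root_half ^ 2"
  have S: "S \<notin> \<rat>" "S * S = 1 / 2" "root_half * root_half = S" "root_half ^ 3 = S * root_half"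
    using root_half_square_irrational root_half_pow4
    by (simp_all add: S_def power2_eq_square power3_eq_cube flip: power_add)
      (simp add: eval_nat_numeral)
  define A B where "A = of_int a + of_int c * S" and "B = of_int b + of_int d * S"
  have eq: "A + B * root_half = 0" using assms by (simp add: A_def B_def S(4) S_def[symmetric] algebra_simps)
  have B0: "B = 0"
  proof (rule ccontr)
    assume "B \<noteq> 0"
    \<comment> \<open>\<open>N / 2\<close> is the norm of \<open>B\<close>, and
      \<open>r + q * S\<close> is \<open>- A / B\<close> with rationalised denominator.\<close>
    define N :: int where "N = 2 * b * b - d * d"
    define r where "r = (- 2 * of_int a * of_int b + of_int c * of_int d) / real_of_int N"
    define q where "q = (2 * of_int a * of_int d - 2 * of_int b * of_int c) / real_of_int N"
    have conj: "B * (of_int b - of_int d * S) = of_int N / 2"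
      using S(2) by (simp add: B_def N_def algebra_simps)
    have "of_int b - of_int d * S \<noteq> 0"
    proof
      assume "of_int b - of_int d * S = 0"
      then have "of_int b + of_int (- d) * S = 0" by simp
      then have "real_of_int b = 0 \<and> real_of_int (- d) = 0" by (rule rat_combination_eq_0) (use S in auto)
      then show False using \<open>B \<noteq> 0\<close> by (simp add: B_def)
    qed
    then have N: "real_of_int N \<noteq> 0" using conj \<open>B \<noteq> 0\<close> by auto
    have A: "A = - (B * root_half)" using eq by linarith
    have "root_half * (of_int N / 2) = - A * (of_int b - of_int d * S)"
      unfolding conj[symmetric] A by simp
    also have "\<dots> = (r + q * S) * (of_int N / 2)"
      using N S(2) by (simp add: r_def q_def A_def field_simps)
    finally have t: "root_half = r + q * S" using N by simp
    have "S = r * r + q * q / 2 + 2 * r * q * S"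
    proof -
      have "S = (r + q * S) * (r + q * S)" using S(3) t by metis
      also have "\<dots> = r * r + q * q * (S * S) + 2 * r * q * S" by (simp add: algebra_simps)
      finally show ?thesis by (simp add: S(2))
    qed
    then have "(r * r + q * q / 2) + (2 * r * q - 1) * S = 0" by (simp add: algebra_simps)
    moreover have "r \<in> \<rat>" "q \<in> \<rat>" by (auto simp: r_def q_def)
    ultimately have "r * r + q * q / 2 = 0 \<and> 2 * r * q - 1 = 0"
      by (intro rat_combination_eq_0[OF _ _ _ S(1)]) auto
    moreover from this have "r * r = 0" using zero_le_square[of r] zero_le_square[of q] by linarith
    ultimately show False by simp
  qed
  then have A0: "A = 0" using eq by simp
  have "real_of_int a = 0 \<and> real_of_int c = 0"
    using A0 unfolding A_def by (rule rat_combination_eq_0) (use S in auto)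
  moreover have "real_of_int b = 0 \<and> real_of_int d = 0"
    using B0 unfolding B_def by (rule rat_combination_eq_0) (use S in auto)
  ultimately show ?thesis by simp
qed

section \<open>Density of the rotation orbit with bounded waiting times\<close>

definition rot :: "real ^ 3" where
  "rot = vector [root_half, root_half ^ 2, root_half ^ 3]"

lemma rot_component [simp]: "rot $ 1 = root_half" "rot $ 2 = root_half ^ 2" "rot $ 3 = root_half ^ 3"
  by (simp_all add: rot_def vector_3)

lemma rot_bounds: "0 < rot $ i \<and> rot $ i < 1"
  using exhaust_3[of i] root_half_bounds by (auto simp: power_less_one_iff)

lemma rot_multiple_not_int:
  assumes "of_int n * rot $ i \<in> \<int>"
  shows "n = 0"
proof -
  obtain m where m: "of_int n * rot $ i = real_of_int m" using assms by (rule Ints_cases)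
  show ?thesis
    using exhaust_3[of i] m root_half_independent[of "- m" n 0 0] root_half_independent[of "- m" 0 n 0]
      root_half_independent[of "- m" 0 0 n] by auto
qed

lemma Kronecker_rot:
  fixes q :: "real ^ 3"
  assumes "e > 0"
  shows "\<exists>k :: int. \<forall>i. \<exists>m :: int. \<bar>of_int k * rot $ i - of_int m - q $ i\<bar> < e"
proof -
  interpret Modules.module "\<lambda>r. (*) (real_of_int r)"
    by (simp add: Modules.module.intro distrib_left mult.commute)
  \<comment> \<open>The last entry 1 brings the integers into the independent family, as
    approximation modulo 1 requires.\<close>
  define \<theta> :: "nat \<Rightarrow> real" where "\<theta> i = (if i = 0 then root_half else if i = 1 then root_half ^ 2
    else if i = 2 then root_half ^ 3 else 1)" for i
  define \<beta> :: "nat \<Rightarrow> real" where "\<beta> i = (if i = 0 then q $ 1 else if i = 1 then q $ 2 else q $ 3)" for i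
  have set: "{..3 :: nat} = {0, 1, 2, 3}" by auto
  have lt: "root_half ^ 2 < root_half" "root_half ^ 3 < root_half ^ 2" "root_half ^ 3 < root_half"
    "root_half ^ 2 < 1" "root_half ^ 3 < 1" "root_half < 1"
    using root_half_bounds power_strict_decreasing[of 1 2 root_half] power_strict_decreasing[of 2 3 root_half]
      power_strict_decreasing[of 1 3 root_half] by (auto simp: power_less_one_iff)
  have inj: "inj_on \<theta> {..3}" unfolding set using lt by (simp add: \<theta>_def inj_on_def)
  have img: "\<theta> ` {..3} = {root_half, root_half ^ 2, root_half ^ 3, 1}" unfolding set by (auto simp: \<theta>_def)
  have "independent (\<theta> ` {..3})"
  proof
    assume "dependent (\<theta> ` {..3})"
    then obtain u where u: "\<exists>x\<in>\<theta> ` {..3}. u x \<noteq> 0" "(\<Sum>x\<in>\<theta> ` {..3}. of_int (u x) * x) = 0"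
      by (subst (asm) dependent_finite) auto
    have "of_int (u 1) + of_int (u root_half) * root_half + of_int (u (root_half ^ 2)) * root_half ^ 2
      + of_int (u (root_half ^ 3)) * root_half ^ 3 = 0"
      using u(2) lt unfolding img by (simp add: algebra_simps)
    from root_half_independent[OF this] show False using u(1) unfolding img by auto
  qed
  then obtain k m where km: "\<And>i. i < 3 \<Longrightarrow> \<bar>of_int k * \<theta> i - of_int (m i) - \<beta> i\<bar> < e"
    using Kronecker_thm_2[of \<theta> 3 e \<beta>] inj assms by (auto simp: \<theta>_def)
  have "\<exists>m :: int. \<bar>of_int k * rot $ i - of_int m - q $ i\<bar> < e" for i
  proof -
    consider "i = 1" | "i = 2" | "i = 3" using exhaust_3 by blast
    then show ?thesis
      by cases (use km[of 0] km[of 1] km[of 2] in \<open>auto simp: \<theta>_def \<beta>_def\<close>)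
  qed
  then show ?thesis by blast
qed

text \<open>Compactness made explicit: approximation times are taken only for the finitely many
  points of a grid of mesh \<open>1 / M\<close>, and the bound is the spread of these times,
  independent of start and target.\<close>

lemma rot_dense_window:
  assumes "e > 0"
  obtains K :: int where "\<And>y \<theta> :: real ^ 3. \<And>k. \<exists>c. k \<le> c \<and> c \<le> k + K \<and>
    (\<forall>i. \<exists>m :: int. \<bar>y $ i + of_int c * rot $ i - \<theta> $ i - of_int m\<bar> < e)"
proof -
  obtain M :: nat where M: "M > 0" "1 / real M < e / 2"
    using assms by (metis half_gt_zero real_arch_inverse inverse_eq_divide gr0I)
  define A where "A = (\<lambda>j. real j / real M) ` {0..M}"
  define Q where "Q = {q :: real ^ 3. \<forall>i. q $ i \<in> A}"
  have "Q \<subseteq> vec_lambda ` (PiE (UNIV :: 3 set) (\<lambda>_. A))"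
  proof
    fix q assume "q \<in> Q"
    then have "vec_nth q \<in> PiE UNIV (\<lambda>_. A)" by (auto simp: Q_def)
    then show "q \<in> vec_lambda ` (PiE (UNIV :: 3 set) (\<lambda>_. A))" by (metis image_eqI vec_nth_inverse)
  qed
  then have finQ: "finite Q" by (rule finite_subset) (auto simp: A_def intro!: finite_imageI finite_PiE)
  obtain \<kappa> :: "real ^ 3 \<Rightarrow> int" where \<kappa>: "\<And>q i. \<exists>m :: int. \<bar>of_int (\<kappa> q) * rot $ i - of_int m - q $ i\<bar> < e / 2"
    using Kronecker_rot[of "e / 2"] assms by (metis half_gt_zero)
  define N where "N = Max (insert 0 ((\<lambda>q. \<bar>\<kappa> q\<bar>) ` Q))"
  have N: "\<bar>\<kappa> q\<bar> \<le> N" if "q \<in> Q" for q using that finQ by (auto simp: N_def intro!: Max_ge)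
  show thesis
  proof (rule that)
    fix y \<theta> :: "real ^ 3" and k :: int
    \<comment> \<open>The orbit is started at time \<open>k + N\<close> because the Kronecker times
      may be negative, but not below \<open>- N\<close>; thus \<open>c\<close> stays between
      \<open>k\<close> and \<open>k + 2 * N\<close>.\<close>
    define z where "z i = \<theta> $ i - y $ i - of_int (k + N) * rot $ i" for i
    define q :: "real ^ 3" where "q = (\<chi> i. real (nat \<lfloor>real M * frac (z i)\<rfloor>) / real M)"
    have fl: "0 \<le> \<lfloor>real M * frac (z i)\<rfloor>" for i by simp
    have "q \<in> Q"
      unfolding Q_def
    proof (intro CollectI allI)
      fix i
      have "real M * frac (z i) \<le> real M" using frac_lt_1[of "z i"] by (simp add: mult_left_le less_imp_le)
      then have "nat \<lfloor>real M * frac (z i)\<rfloor> \<le> M" by linarith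
      moreover have "q $ i = real (nat \<lfloor>real M * frac (z i)\<rfloor>) / real M" by (simp only: q_def vec_lambda_beta)
      ultimately show "q $ i \<in> A" unfolding A_def by (intro image_eqI) auto
    qed
    have qz: "\<bar>frac (z i) - q $ i\<bar> < e / 2" for i
    proof -
      have "real (nat \<lfloor>real M * frac (z i)\<rfloor>) = of_int \<lfloor>real M * frac (z i)\<rfloor>" using fl by simp
      then have "\<bar>real M * frac (z i) - real (nat \<lfloor>real M * frac (z i)\<rfloor>)\<bar> \<le> 1" by linarith
      moreover have "\<bar>frac (z i) - q $ i\<bar> = \<bar>real M * frac (z i) - real (nat \<lfloor>real M * frac (z i)\<rfloor>)\<bar> / real M"
      proof -
        have "frac (z i) - q $ i = (real M * frac (z i) - real (nat \<lfloor>real M * frac (z i)\<rfloor>)) / real M"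
          using M(1) by (simp only: q_def vec_lambda_beta) (simp add: field_simps)
        then show ?thesis by (simp only: abs_divide abs_of_nat)
      qed
      ultimately have "\<bar>frac (z i) - q $ i\<bar> \<le> 1 / real M" using M(1) by (simp add: divide_right_mono)
      then show ?thesis using M(2) by linarith
    qed
    define c where "c = k + N + \<kappa> q"
    have "k \<le> c" "c \<le> k + 2 * N" using N[OF \<open>q \<in> Q\<close>] by (auto simp: c_def)
    moreover have "\<exists>m :: int. \<bar>y $ i + of_int c * rot $ i - \<theta> $ i - of_int m\<bar> < e" for i
    proof -
      obtain m :: int where m: "\<bar>of_int (\<kappa> q) * rot $ i - of_int m - q $ i\<bar> < e / 2" using \<kappa> by blast
      have "y $ i + of_int c * rot $ i - \<theta> $ i - of_int (m - \<lfloor>z i\<rfloor>) =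
        (of_int (\<kappa> q) * rot $ i - of_int m - q $ i) - (frac (z i) - q $ i)"
        by (simp add: c_def z_def frac_def algebra_simps)
      then have "\<bar>y $ i + of_int c * rot $ i - \<theta> $ i - of_int (m - \<lfloor>z i\<rfloor>)\<bar> < e"
        using m qz[of i] by linarith
      then show ?thesis by blast
    qed
    ultimately show "\<exists>c. k \<le> c \<and> c \<le> k + 2 * N \<and>
      (\<forall>i. \<exists>m :: int. \<bar>y $ i + of_int c * rot $ i - \<theta> $ i - of_int m\<bar> < e)" by blast
  qed
qed

section \<open>Octants of the torus and the labels along an orbit\<close>

definition low_half :: "real \<Rightarrow> bool" where
  "low_half x \<longleftrightarrow> frac x < 1 / 2"

text \<open>Near the origin of the torus this is constant on pairs of opposite octants; the types 1 and 2
  are one pair each, the type 0 consists of the remaining two pairs.\<close>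

definition octant_type :: "real ^ 3 \<Rightarrow> nat" where
  "octant_type x = (if low_half (x $ 1) = low_half (x $ 2) \<and> low_half (x $ 1) \<noteq> low_half (x $ 3) then 1
     else if low_half (x $ 1) = low_half (x $ 3) \<and> low_half (x $ 1) \<noteq> low_half (x $ 2) then 2 else 0)"

lemma octant_type_cong:
  "(\<And>i. low_half (x $ i) = low_half (y $ i)) \<Longrightarrow> octant_type x = octant_type y"
  unfolding octant_type_def by presburger

lemma low_half_minus:
  assumes "2 * x \<notin> \<int>"
  shows "low_half (- x) \<longleftrightarrow> \<not> low_half x"
proof -
  have "x \<notin> \<int>" using assms by (metis Ints_mult Ints_numeral)
  moreover have "frac x \<noteq> 1 / 2"
  proof
    assume "frac x = 1 / 2"
    then have "2 * x = of_int (2 * \<lfloor>x\<rfloor> + 1)" by (simp add: frac_def)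
    then show False using assms by (metis Ints_of_int)
  qed
  ultimately show ?thesis by (auto simp: low_half_def frac_neg)
qed

lemma octant_type_minus:
  assumes "\<And>i. 2 * x $ i \<notin> \<int>"
  shows "octant_type (- x) = octant_type x"
  unfolding octant_type_def vector_uminus_component low_half_minus[OF assms] by presburger

lemma frac_add_small: "0 \<le> frac x + d \<Longrightarrow> frac x + d < 1 \<Longrightarrow> frac (x + d + of_int m) = frac x + d"
  by (subst frac_unique_iff) (simp add: frac_def)

lemma low_half_locally_constant:
  assumes "2 * x \<notin> \<int>"
  shows "\<exists>e>0. \<forall>z. \<forall>m :: int. \<bar>z - x - of_int m\<bar> < e \<longrightarrow> low_half z = low_half x"
proof -
  have "x \<notin> \<int>" using assms by (metis Ints_mult Ints_numeral)
  then have 0: "0 < frac x" "frac x < 1" by (simp_all add: frac_gt_0_iff frac_lt_1)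
  have ne: "frac x \<noteq> 1 / 2"
  proof
    assume "frac x = 1 / 2"
    then have "2 * x = of_int (2 * \<lfloor>x\<rfloor> + 1)" by (simp add: frac_def)
    then show False using assms by (metis Ints_of_int)
  qed
  define e where "e = min (min (frac x) (1 - frac x)) \<bar>frac x - 1 / 2\<bar>"
  have "e > 0" using 0 ne by (simp add: e_def)
  moreover have "low_half z = low_half x" if "\<bar>z - x - of_int m\<bar> < e" for z and m :: int
  proof -
    define d where "d = z - x - of_int m"
    have d: "\<bar>d\<bar> < e" using that by (simp add: d_def)
    have "frac (x + d + of_int m) = frac x + d"
      by (rule frac_add_small) (use d in \<open>auto simp: e_def\<close>)
    then have "frac z = frac x + d" by (simp add: d_def)
    then show ?thesis using d unfolding low_half_def e_def by linarith
  qed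
  ultimately show ?thesis by blast
qed

lemma octant_type_locally_constant:
  assumes "\<And>i. 2 * x $ i \<notin> \<int>"
  shows "\<exists>e>0. \<forall>z. (\<forall>i. \<exists>m :: int. \<bar>z $ i - x $ i - of_int m\<bar> < e) \<longrightarrow> octant_type z = octant_type x"
proof -
  obtain e where e: "\<And>i. e i > 0"
    "\<And>i z. \<And>m :: int. \<bar>z - x $ i - of_int m\<bar> < e i \<Longrightarrow> low_half z = low_half (x $ i)"
    using low_half_locally_constant[OF assms] by metis
  have "Min (range e) > 0" using e(1) by (subst Min_gr_iff) auto
  moreover have "octant_type z = octant_type x"
    if z: "\<forall>i. \<exists>m :: int. \<bar>z $ i - x $ i - of_int m\<bar> < Min (range e)" for z
  proof (rule octant_type_cong)
    fix i
    obtain m :: int where "\<bar>z $ i - x $ i - of_int m\<bar> < Min (range e)" using z by blast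
    also have "\<dots> \<le> e i" by (rule Min_le) auto
    finally show "low_half (z $ i) = low_half (x $ i)" by (rule e(2))
  qed
  ultimately show ?thesis by blast
qed

definition rot_type :: "real ^ 3 \<Rightarrow> int \<Rightarrow> nat" where
  "rot_type y n = octant_type (y + of_int n *\<^sub>R rot)"

lemma two_rot_not_int: "n \<noteq> 0 \<Longrightarrow> 2 * (of_int n *\<^sub>R rot) $ i \<notin> \<int>"
  using rot_multiple_not_int[of "2 * n" i] by (auto simp: mult.assoc)

lemma rot_type_sym: "rot_type 0 (- n) = rot_type 0 n"
proof (cases "n = 0")
  case False
  then show ?thesis using octant_type_minus[of "of_int n *\<^sub>R rot"] two_rot_not_int by (simp add: rot_type_def)
qed simp

text \<open>A return close to 0 in an octant of type \<open>t\<close> shows that type at time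
  \<open>c\<close>. At the times \<open>c + n\<close> with \<open>n\<close> nonzero the point is
  close to \<open>n\<close> times \<open>rot\<close>, which by irrationality lies off all walls of
  the octants, so these finitely many types are not disturbed.\<close>

lemma octant_pattern:
  assumes "t < 3"
  obtains e \<theta> where "e > 0" "\<And>y c n. (\<And>i. \<exists>m :: int. \<bar>y $ i + of_int c * rot $ i - \<theta> $ i - of_int m\<bar> < e) \<Longrightarrow>
    \<bar>n\<bar> \<le> R \<Longrightarrow> rot_type y (c + n) = ((rot_type 0)(0 := t)) n"
proof -
  have "\<forall>n. \<exists>e>0. n \<noteq> 0 \<longrightarrow> (\<forall>z. (\<forall>i. \<exists>m :: int. \<bar>z $ i - of_int n * rot $ i - of_int m\<bar> < e) \<longrightarrow> octant_type z = rot_type 0 n)"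
  proof
    fix n :: int
    show "\<exists>e>0. n \<noteq> 0 \<longrightarrow> (\<forall>z. (\<forall>i. \<exists>m :: int. \<bar>z $ i - of_int n * rot $ i - of_int m\<bar> < e) \<longrightarrow> octant_type z = rot_type 0 n)"
    proof (cases "n = 0")
      case True
      then show ?thesis by (auto intro: exI[of _ 1])
    next
      case False
      then show ?thesis
        using octant_type_locally_constant[of "of_int n *\<^sub>R rot"] two_rot_not_int[of n] by (simp add: rot_type_def)
    qed
  qed
  then obtain e where e: "\<And>n. e n > 0"
    "\<And>n z. n \<noteq> 0 \<Longrightarrow> (\<And>i. \<exists>m :: int. \<bar>z $ i - of_int n * rot $ i - of_int m\<bar> < e n) \<Longrightarrow> octant_type z = rot_type 0 n"
    by metis
  \<comment> \<open>\<open>d\<close> is half the least stability radius because the offset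
    \<open>\<theta>\<close> and the approximation error each contribute up to \<open>d\<close>; the
    entry \<open>1 / 2\<close> keeps the return within the octants adjacent to 0.\<close>
  define d where "d = Min (insert (1 / 2) (e ` {- R..R})) / 2"
  have fin: "finite (insert (1 / 2) (e ` {- R..R}))" by simp
  have "d > 0" using e(1) by (simp add: d_def Min_gr_iff)
  have d2: "2 * d = Min (insert (1 / 2) (e ` {- R..R}))" by (simp only: d_def)
  have d12: "2 * d \<le> 1 / 2" unfolding d2 using fin by (rule Min_le) simp
  have de: "2 * d \<le> e n" if "\<bar>n\<bar> \<le> R" for n unfolding d2 using fin by (rule Min_le) (use that in \<open>intro insertI2 imageI, auto\<close>)
  \<comment> \<open>The signs of \<open>\<theta>\<close> select an octant of type \<open>t\<close>;
    every coordinate keeps distance \<open>d\<close> from the wall at 0.\<close>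
  define \<theta> :: "real ^ 3" where "\<theta> = (if t = 0 then vector [d, d, d] else if t = 1 then vector [d, d, - d] else vector [d, - d, d])"
  have \<theta>: "\<theta> $ i = d \<or> \<theta> $ i = - d" for i
    using exhaust_3[of i] by (auto simp: \<theta>_def vector_3)
  show thesis
  proof (rule that[OF \<open>d > 0\<close>, of \<theta>])
    fix y :: "real ^ 3" and c n
    assume near: "\<And>i. \<exists>m :: int. \<bar>y $ i + of_int c * rot $ i - \<theta> $ i - of_int m\<bar> < d" and n: "\<bar>n\<bar> \<le> R"
    show "rot_type y (c + n) = ((rot_type 0)(0 := t)) n"
    proof (cases "n = 0")
      case False
      have "octant_type (y + of_int (c + n) *\<^sub>R rot) = rot_type 0 n"
      proof (rule e(2)[OF False])
        fix i
        obtain m :: int where m: "\<bar>y $ i + of_int c * rot $ i - \<theta> $ i - of_int m\<bar> < d" using near by blast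
        have "\<bar>y $ i + of_int c * rot $ i - of_int m\<bar> < 2 * d" using m \<theta>[of i] by linarith
        then have "\<bar>(y + of_int (c + n) *\<^sub>R rot) $ i - of_int n * rot $ i - of_int m\<bar> < e n"
          using de[OF n] by (simp add: algebra_simps)
        then show "\<exists>m :: int. \<bar>(y + of_int (c + n) *\<^sub>R rot) $ i - of_int n * rot $ i - of_int m\<bar> < e n" by blast
      qed
      then show ?thesis using False by (simp add: rot_type_def)
    next
      case True
      have lo: "low_half ((y + of_int c *\<^sub>R rot) $ i) \<longleftrightarrow> \<theta> $ i = d" for i
      proof -
        obtain m :: int where m: "\<bar>y $ i + of_int c * rot $ i - \<theta> $ i - of_int m\<bar> < d" using near by blast
        define r where "r = y $ i + of_int c * rot $ i - of_int m"
        have yr: "(y + of_int c *\<^sub>R rot) $ i = r + of_int m" by (simp add: r_def)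
        have fr: "frac (r + of_int m) = frac r" by (simp add: frac_def)
        show ?thesis
        proof (cases "\<theta> $ i = d")
          case True
          then have "0 < r" "r < 2 * d" using m by (auto simp: r_def)
          then have "frac r = r" using d12 by (simp add: frac_eq)
          then show ?thesis using True \<open>r < 2 * d\<close> d12 unfolding low_half_def yr fr by simp
        next
          case False
          then have "\<theta> $ i = - d" using \<theta> by blast
          then have "r < 0" "r > - 2 * d" using m by (auto simp: r_def)
          then have "frac r = r + 1" using d12 by (subst frac_unique_iff) auto
          then show ?thesis using False \<open>r > - 2 * d\<close> d12 unfolding low_half_def yr fr by simp
        qed
      qed
      have "octant_type (y + of_int c *\<^sub>R rot) = t"
        unfolding octant_type_def lo using \<open>d > 0\<close> assms by (auto simp: \<theta>_def vector_3)
      then show ?thesis using True by (simp add: rot_type_def)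
    qed
  qed
qed

theorem rot_walk_torsion:
  obtains N where "N > 0" "\<And>y k. (walk (rot_type y) w ^^ N) k = k"
proof -
  have rec1: "\<exists>c>D. \<forall>n. \<bar>n\<bar> \<le> R \<longrightarrow> rot_type 0 (c + n) = ((rot_type 0)(0 := t)) n" if t: "t < 3" for t R D
  proof -
    obtain e \<theta> where e: "e > 0" "\<And>y c n. (\<And>i. \<exists>m :: int. \<bar>y $ i + of_int c * rot $ i - \<theta> $ i - of_int m\<bar> < e) \<Longrightarrow>
      \<bar>n\<bar> \<le> R \<Longrightarrow> rot_type y (c + n) = ((rot_type 0)(0 := t)) n"
      using octant_pattern[OF t] by metis
    obtain c where "D + 1 \<le> c" "\<forall>i. \<exists>m :: int. \<bar>0 $ i + of_int c * rot $ i - \<theta> $ i - of_int m\<bar> < e"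
      using rot_dense_window[OF e(1)] by metis
    then show ?thesis using e(2)[of 0 c] by (intro exI[of _ c]) auto
  qed
  have rec2: "\<exists>K. \<forall>u\<in>range rot_type. \<forall>k. \<exists>c. k \<le> c \<and> c \<le> k + K \<and>
      (\<forall>n. \<bar>n\<bar> \<le> R \<longrightarrow> u (c + n) = ((rot_type 0)(0 := 0)) n)" for R
  proof -
    obtain e \<theta> where e: "e > 0" "\<And>y c n. (\<And>i. \<exists>m :: int. \<bar>y $ i + of_int c * rot $ i - \<theta> $ i - of_int m\<bar> < e) \<Longrightarrow>
      \<bar>n\<bar> \<le> R \<Longrightarrow> rot_type y (c + n) = ((rot_type 0)(0 := 0)) n"
      using octant_pattern[of 0] by (metis zero_less_numeral)
    obtain K where K: "\<And>y. \<And>k. \<exists>c. k \<le> c \<and> c \<le> k + K \<and>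
      (\<forall>i. \<exists>m :: int. \<bar>y $ i + of_int c * rot $ i - \<theta> $ i - of_int m\<bar> < e)"
      using rot_dense_window[OF e(1)] by metis
    show ?thesis
    proof (rule exI[of _ K], intro ballI allI)
      fix u k assume "u \<in> range rot_type"
      then obtain y where u: "u = rot_type y" by blast
      obtain c where "k \<le> c" "c \<le> k + K" "\<And>i. \<exists>m :: int. \<bar>y $ i + of_int c * rot $ i - \<theta> $ i - of_int m\<bar> < e"
        using K by metis
      then show "\<exists>c. k \<le> c \<and> c \<le> k + K \<and> (\<forall>n. \<bar>n\<bar> \<le> R \<longrightarrow> u (c + n) = ((rot_type 0)(0 := 0)) n)"
        using e(2) u by blast
    qed
  qed
  obtain N where "N > 0" "\<And>u k. u \<in> range rot_type \<Longrightarrow> (walk u w ^^ N) k = k"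
    using walk_torsion[of "rot_type 0" "range rot_type" w, OF rot_type_sym rec1 rec2] by metis
  then show thesis using that by blast
qed

section \<open>Piecewise isometries and grid cells\<close>

lemma small_subset: "small S \<Longrightarrow> T \<subseteq> S \<Longrightarrow> small T"
  unfolding small_def by (meson subset_trans)

lemma small_empty [simp]: "small {}"
  unfolding small_def by (rule exI[of _ "{}"]) simp

lemma small_Un: "small S \<Longrightarrow> small T \<Longrightarrow> small (S \<union> T)"
proof -
  assume "small S" "small T"
  then obtain F G where "finite F" "\<forall>H\<in>F. affine_hyperplane H" "S \<subseteq> \<Union>F"
    "finite G" "\<forall>H\<in>G. affine_hyperplane H" "T \<subseteq> \<Union>G"
    unfolding small_def by auto
  then show ?thesis unfolding small_def by (intro exI[of _ "F \<union> G"]) auto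
qed

lemma small_UN: "finite I \<Longrightarrow> (\<And>i. i \<in> I \<Longrightarrow> small (S i)) \<Longrightarrow> small (\<Union>i\<in>I. S i)"
  by (induction I rule: finite_induct) (auto intro: small_Un)

lemma small_hyperplane: "u \<noteq> 0 \<Longrightarrow> small {x. u \<bullet> x = c}"
  unfolding small_def affine_hyperplane_def by (rule exI[of _ "{{x. u \<bullet> x = c}}"]) auto

lemma small_coord: "small {x :: real ^ 'n. x $ i = t}"
  using small_hyperplane[of "axis i 1" t] by (simp add: inner_axis' axis_eq_0_iff)

lemma small_coords: "finite T \<Longrightarrow> small {x :: real ^ 'n. \<exists>i. x $ i \<in> T}"
proof -
  assume "finite T"
  then have "small (\<Union>i\<in>UNIV. \<Union>t\<in>T. {x :: real ^ 'n. x $ i = t})"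
    by (intro small_UN small_coord) auto
  then show ?thesis by (rule small_subset) auto
qed

lemma small_imp_negligible: "small S \<Longrightarrow> negligible S"
proof -
  assume "small S"
  then obtain F where F: "finite F" "\<forall>H\<in>F. affine_hyperplane H" "S \<subseteq> \<Union>F"
    unfolding small_def by auto
  have "negligible H" if H: "H \<in> F" for H
  proof -
    obtain u c where "u \<noteq> 0" "H = {x. u \<bullet> x = c}"
      using F(2) H unfolding affine_hyperplane_def by blast
    then show ?thesis using negligible_hyperplane[of u c] by simp
  qed
  then have "negligible (\<Union>F)" using F(1) by (rule negligible_Union[rotated])
  then show ?thesis using F(3) negligible_subset by blast
qed

text \<open>A diagonal matrix is represented by its diagonal, so that applying it is the
  componentwise product \<open>s * x\<close> and composing two of them is a product of
  vectors.\<close>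

definition sign_vec :: "real ^ 'n \<Rightarrow> bool" where
  "sign_vec s \<longleftrightarrow> (\<forall>i. s $ i = 1 \<or> s $ i = - 1)"

lemma sign_vec_one [simp]: "sign_vec 1" and sign_vec_minus_one [simp]: "sign_vec (- 1)"
  by (simp_all add: sign_vec_def)

lemma sign_vec_mult: "sign_vec s \<Longrightarrow> sign_vec t \<Longrightarrow> sign_vec (s * t)"
  unfolding sign_vec_def vector_mult_component by (metis mult_1 mult_minus1 minus_minus)

lemma sign_vec_square: "sign_vec s \<Longrightarrow> s * s = 1"
  unfolding sign_vec_def vec_eq_iff vector_mult_component one_index
  by (metis mult_1 mult_minus1 minus_minus)

lemma sign_vec_cancel: "sign_vec s \<Longrightarrow> s * (s * x) = x"
  by (metis mult.assoc mult_1 sign_vec_square)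

lemma norm_sign_vec_mult: "sign_vec s \<Longrightarrow> norm (s * x) = norm x"
proof -
  assume s: "sign_vec s"
  have "norm ((s * x) $ i) = norm (x $ i)" for i
    using s by (cases "s $ i = 1") (auto simp: sign_vec_def)
  then show ?thesis unfolding norm_vec_def by simp
qed

lemma dist_sign_vec: "sign_vec s \<Longrightarrow> dist (s * x + v) (s * y + v) = dist x y"
  by (simp add: dist_norm norm_sign_vec_mult flip: right_diff_distrib)

lemma inner_sign_vec_mult: "u \<bullet> (s * x) = (s * u) \<bullet> (x :: real ^ 'n)"
  by (simp add: inner_vec_def ac_simps)

lemma small_affine_preimage:
  assumes s: "sign_vec s" and S: "small S"
  shows "small {x. s * x + v \<in> S}"
proof -
  obtain F where F: "finite F" "\<forall>H\<in>F. affine_hyperplane H" "S \<subseteq> \<Union>F"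
    using S unfolding small_def by auto
  have "small {x. s * x + v \<in> H}" if "H \<in> F" for H
  proof -
    obtain u c where u: "u \<noteq> 0" and H: "H = {x. u \<bullet> x = c}"
      using F(2) \<open>H \<in> F\<close> unfolding affine_hyperplane_def by blast
    have "s * u \<noteq> 0" using u norm_sign_vec_mult[OF s, of u] by force
    moreover have "{x. s * x + v \<in> H} = {x. (s * u) \<bullet> x = c - u \<bullet> v}"
      by (auto simp: H inner_add_right inner_sign_vec_mult)
    ultimately show ?thesis using small_hyperplane by metis
  qed
  then have "small (\<Union>H\<in>F. {x. s * x + v \<in> H})" using F(1) by (intro small_UN)
  then show ?thesis by (rule small_subset) (use F(3) in auto)
qed

text \<open>The codes of the grid cells determined by the thresholds \<open>T\<close>: the fibres are products of
  intervals that are open on the left for \<open>lcell\<close> and closed on the left for \<open>rcell\<close>.\<close>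

definition lcell :: "real set \<Rightarrow> real ^ 'n \<Rightarrow> 'n \<Rightarrow> real set" where
  "lcell T x = (\<lambda>i. {t \<in> T. t < x $ i})"

definition rcell :: "real set \<Rightarrow> real ^ 'n \<Rightarrow> 'n \<Rightarrow> real set" where
  "rcell T x = (\<lambda>i. {t \<in> T. t \<le> x $ i})"

lemma lcell_eq_iff: "lcell T x = lcell T y \<longleftrightarrow> (\<forall>i. \<forall>t\<in>T. t < x $ i \<longleftrightarrow> t < y $ i)"
  unfolding lcell_def fun_eq_iff set_eq_iff by blast

lemma rcell_eq_iff: "rcell T x = rcell T y \<longleftrightarrow> (\<forall>i. \<forall>t\<in>T. t \<le> x $ i \<longleftrightarrow> t \<le> y $ i)"
  unfolding rcell_def fun_eq_iff set_eq_iff by blast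

lemma finite_range_cells:
  fixes T :: "real set"
  assumes "finite T" "\<And>x i. c x i \<subseteq> T"
  shows "finite (range (c :: real ^ 'n \<Rightarrow> 'n \<Rightarrow> real set))"
proof (rule finite_subset)
  show "range c \<subseteq> PiE UNIV (\<lambda>_. Pow T)" using assms(2) by (auto simp: PiE_UNIV_domain)
  show "finite (PiE (UNIV :: 'n set) (\<lambda>_. Pow T))" by (intro finite_PiE) (use assms(1) in auto)
qed

lemma finite_range_lcell: "finite T \<Longrightarrow> finite (range (lcell T :: real ^ 'n \<Rightarrow> _))"
  by (rule finite_range_cells) (auto simp: lcell_def)

lemma finite_range_rcell: "finite T \<Longrightarrow> finite (range (rcell T :: real ^ 'n \<Rightarrow> _))"
  by (rule finite_range_cells) (auto simp: rcell_def)

lemma dist_vec_less: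
  fixes x y :: "real ^ 'n"
  assumes "\<And>i. \<bar>x $ i - y $ i\<bar> < d / real CARD('n)"
  shows "dist x y < d"
proof -
  have "dist x y \<le> (\<Sum>i\<in>UNIV. \<bar>x $ i - y $ i\<bar>)"
    using norm_le_l1_cart[of "x - y"] by (simp add: dist_norm)
  also have "\<dots> < (\<Sum>i\<in>(UNIV :: 'n set). d / real CARD('n))"
    by (rule sum_strict_mono) (use assms in auto)
  also have "\<dots> = d" by simp
  finally show ?thesis .
qed

text \<open>The point is found in an open box just below \<open>x\<close>, or just above 0 in the
  coordinates that vanish: left-open cells extend downwards, and an open box is not negligible.
  Positivity of the thresholds ensures that none separates a zero coordinate from points slightly
  above it.\<close>

lemma lcell_dense:
  fixes x :: "real ^ 'n"
  assumes x: "x \<in> unit_cube" and T: "finite T" "T \<subseteq> {0<..}" and S: "negligible S" and "e > 0"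
  shows "\<exists>y\<in>unit_cube. y \<notin> S \<and> lcell T y = lcell T x \<and> dist y x < e \<and> (\<forall>i. 0 < y $ i)"
proof -
  define D where "D = insert (e / real CARD('n))
    (\<Union>i\<in>UNIV. (\<lambda>t. \<bar>x $ i - t\<bar>) ` ((T \<union> {0, 1}) - {x $ i}))"
  have "finite D" using T by (simp add: D_def)
  moreover have "\<And>d. d \<in> D \<Longrightarrow> d > 0" using \<open>e > 0\<close> by (auto simp: D_def)
  moreover have "D \<noteq> {}" by (simp add: D_def)
  ultimately obtain d where d: "d > 0" "\<And>d'. d' \<in> D \<Longrightarrow> d < d'"
    using field_lbound_gt_zero[of "Min D" "Min D"] by (metis Min_gr_iff)
  have d_gap: "d < \<bar>x $ i - t\<bar>" if "t \<in> T \<union> {0, 1}" "t \<noteq> x $ i" for i t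
    by (rule d(2)) (use that in \<open>auto simp: D_def\<close>)
  have d_e: "d < e / real CARD('n)" by (rule d(2)) (simp add: D_def)
  define a where "a = (\<chi> i. if x $ i = 0 then 0 else x $ i - d)"
  define b where "b = (\<chi> i. a $ i + d)"
  have "box a b \<noteq> {}" using \<open>d > 0\<close> by (auto simp: b_def interval_ne_empty_cart)
  then have "\<not> negligible (box a b)" using open_box open_not_negligible by blast
  then have "\<not> box a b \<subseteq> S" using S negligible_subset by blast
  then obtain y where y: "y \<in> box a b" "y \<notin> S" by blast
  have yi: "a $ i < y $ i \<and> y $ i < a $ i + d" for i
    using y(1) by (auto simp: mem_box_cart b_def)
  have xi: "0 \<le> x $ i" "x $ i < 1" for i using x by (auto simp: unit_cube_def)
  have y0: "0 < y $ i" "y $ i < 1" for i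
    using yi[of i] xi[of i] d_gap[of 0 i] d_gap[of 1 i] by (auto simp: a_def split: if_splits)
  show ?thesis
  proof (intro bexI[of _ y] conjI allI)
    show "y \<in> unit_cube" using y0 by (auto simp: unit_cube_def less_imp_le)
    show "lcell T y = lcell T x"
      unfolding lcell_eq_iff
    proof (intro allI ballI)
      fix i t assume t: "t \<in> T"
      then have "0 < t" using T(2) by auto
      then show "t < y $ i \<longleftrightarrow> t < x $ i"
        using yi[of i] xi[of i] d_gap[of t i] t by (auto simp: a_def split: if_splits)
    qed
    show "dist y x < e"
    proof (rule dist_vec_less)
      fix i show "\<bar>y $ i - x $ i\<bar> < e / real CARD('n)"
        using yi[of i] d_e by (auto simp: a_def split: if_splits)
    qed
  qed (use y y0 in auto)
qed

lemma tendsto_affine_coord: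
  fixes x :: "real ^ 'n"
  shows "((\<lambda>t. s * (\<chi> j. if j = i then t else x $ j) + v) \<longlongrightarrow> s * x + v) (at_left (x $ i))"
proof (rule vec_tendstoI)
  fix j
  have "((\<lambda>t. (\<chi> j. if j = i then t else x $ j) $ j) \<longlongrightarrow> x $ j) (at_left (x $ i))"
    by (cases "j = i") auto
  then show "((\<lambda>t. (s * (\<chi> j. if j = i then t else x $ j) + v) $ j) \<longlongrightarrow> (s * x + v) $ j) (at_left (x $ i))"
    unfolding vector_add_component vector_mult_component
    by (rule tendsto_add[OF tendsto_mult[OF tendsto_const] tendsto_const])
qed

text \<open>Left-continuity propagates the affine formula from the interior of a cell of \<^const>\<open>lcell\<close> to its
  upper faces.\<close>

lemma E_set_lcellD:
  fixes f :: "real ^ 'n \<Rightarrow> real ^ 'n"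
  assumes f: "f \<in> E_set"
  obtains T s v where "finite T" "T \<subseteq> {0<..<1}" "\<And>c. sign_vec (s c)"
    "\<And>x. x \<in> unit_cube \<Longrightarrow> f x = s (lcell T x) * x + v (lcell T x)"
proof -
  obtain P where P: "rect_partition P" and fP: "\<forall>R\<in>P. \<exists>a b s v. R = rect_co a b \<and> sign_vec s \<and>
        (\<forall>x\<in>R. (\<forall>i. a $ i < x $ i \<or> x $ i = 0) \<longrightarrow> f x = s * x + v)"
    using f unfolding E_set_def sign_vec_def times_vec_def by auto
  have lc: "left_cont_each_var f" using f by (simp add: E_set_def)
  obtain a b s v where R: "\<And>R. R \<in> P \<Longrightarrow> R = rect_co (a R) (b R)"
    and s: "\<And>R. R \<in> P \<Longrightarrow> sign_vec (s R)"
    and fR: "\<And>R x. R \<in> P \<Longrightarrow> x \<in> R \<Longrightarrow> (\<And>i. a R $ i < x $ i \<or> x $ i = 0) \<Longrightarrow> f x = s R * x + v R"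
    using bchoice[OF fP] by (metis (no_types) bchoice)
  define T where "T = (\<Union>R\<in>P. \<Union>i. {a R $ i, b R $ i}) \<inter> {0<..<1}"
  have finT: "finite T" using P by (auto simp: T_def rect_partition_def)
  have T01: "T \<subseteq> {0<..<1}" by (simp add: T_def)
  then have T0: "T \<subseteq> {0<..}" by auto
  \<comment> \<open>A representative with no coordinate in \<open>T\<close> cannot lie on an
    interior lower face, so the rectangle that contains it governs the interior of the cell.\<close>
  define rep where "rep c = (SOME z :: real ^ 'n. z \<in> unit_cube \<and> (\<forall>i. z $ i \<notin> T \<and> 0 < z $ i) \<and> lcell T z = c)" for c :: "'n \<Rightarrow> real set"
  have rep: "rep (lcell T x) \<in> unit_cube" "\<And>i. rep (lcell T x) $ i \<notin> T" "\<And>i. 0 < rep (lcell T x) $ i"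
    "lcell T (rep (lcell T x)) = lcell T x" if x: "x \<in> unit_cube" for x
  proof -
    have "\<exists>z. z \<in> unit_cube \<and> (\<forall>i. z $ i \<notin> T \<and> 0 < z $ i) \<and> lcell T z = lcell T x"
      using lcell_dense[OF x finT T0 small_imp_negligible[OF small_coords[OF finT]] zero_less_one] by auto
    then have "rep (lcell T x) \<in> unit_cube \<and> (\<forall>i. rep (lcell T x) $ i \<notin> T \<and> 0 < rep (lcell T x) $ i) \<and>
        lcell T (rep (lcell T x)) = lcell T x"
      unfolding rep_def by (rule someI_ex)
    then show "rep (lcell T x) \<in> unit_cube" "\<And>i. rep (lcell T x) $ i \<notin> T" "\<And>i. 0 < rep (lcell T x) $ i"
      "lcell T (rep (lcell T x)) = lcell T x"
      by blast+
  qed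
  define rect where "rect c = (SOME R. R \<in> P \<and> rep c \<in> R)" for c
  have rect: "rect (lcell T x) \<in> P" "rep (lcell T x) \<in> rect (lcell T x)" if "x \<in> unit_cube" for x
  proof -
    have "\<exists>R. R \<in> P \<and> rep (lcell T x) \<in> R" using rep(1)[OF that] P by (auto simp: rect_partition_def)
    then have "rect (lcell T x) \<in> P \<and> rep (lcell T x) \<in> rect (lcell T x)"
      unfolding rect_def by (rule someI_ex)
    then show "rect (lcell T x) \<in> P" "rep (lcell T x) \<in> rect (lcell T x)" by blast+
  qed
  have main: "f x = s (rect (lcell T x)) * x + v (rect (lcell T x))" if "x \<in> unit_cube" for x
    using that
  \<comment> \<open>Lowering a coordinate that lies in \<open>T\<close> slightly keeps the code of
    the cell but takes the coordinate off \<open>T\<close>; the formula at \<open>x\<close> is then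
    the left limit of formulas given by the induction hypothesis.\<close>
  proof (induction "card {i. x $ i \<in> T}" arbitrary: x rule: less_induct)
    case less
    let ?R = "rect (lcell T x)" let ?z = "rep (lcell T x)"
    note x = less.prems
    note rp = rep[OF x] and rc = rect[OF x]
    have z: "a ?R $ i \<le> ?z $ i" "?z $ i < b ?R $ i" "?z $ i < 1" for i
      using rc R[OF rc(1)] rp(1) by (auto simp: rect_co_def unit_cube_def)
    have same: "t < x $ i \<longleftrightarrow> t < ?z $ i" if "t \<in> T" for t i
      using rp(4) that unfolding lcell_eq_iff by blast
    have xi: "0 \<le> x $ i" "x $ i < 1" for i using x by (auto simp: unit_cube_def)
    show ?case
    proof (cases "\<exists>i. x $ i \<in> T")
      case False
      have "(a ?R $ i < x $ i \<or> a ?R $ i \<le> 0) \<and> x $ i < b ?R $ i" for i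
      proof
        show "a ?R $ i < x $ i \<or> a ?R $ i \<le> 0"
        proof (cases "a ?R $ i \<le> 0")
          case False
          then have aT: "a ?R $ i \<in> T" using rc(1) z[of i] by (auto simp: T_def)
          then have "a ?R $ i < ?z $ i" using z(1)[of i] rp(2)[of i] by (metis order_le_less)
          then show ?thesis using same aT by blast
        qed simp
        show "x $ i < b ?R $ i"
        proof (cases "b ?R $ i < 1")
          case True
          then have bT: "b ?R $ i \<in> T" using rc(1) z(2)[of i] rp(3)[of i] by (auto simp: T_def)
          then have "\<not> b ?R $ i < x $ i" using same[OF bT, of i] z(2)[of i] by simp
          then show ?thesis using False bT by (metis linorder_neqE_linordered_idom)
        qed (use xi(2)[of i] in simp)
      qed
      then have *: "\<And>i. (a ?R $ i < x $ i \<or> a ?R $ i \<le> 0)" "\<And>i. x $ i < b ?R $ i" by blast+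
      have "x \<in> rect_co (a ?R) (b ?R)"
        unfolding rect_co_def mem_Collect_eq
      proof (intro allI conjI)
        fix i show "a ?R $ i \<le> x $ i" using *(1)[of i] xi(1)[of i] by linarith
        show "x $ i < b ?R $ i" by (rule *(2))
      qed
      then have "x \<in> ?R" using R[OF rc(1)] by simp
      then show ?thesis
      proof (rule fR[OF rc(1)])
        fix i show "a ?R $ i < x $ i \<or> x $ i = 0" using *(1)[of i] xi(1)[of i] by linarith
      qed
    next
      case True
      then obtain i where i: "x $ i \<in> T" by blast
      then have "0 < x $ i" using T0 by auto
      define y where "y t = (\<chi> j. if j = i then t else x $ j)" for t
      define l where "l = Max (insert 0 {t \<in> T. t < x $ i})"
      have l: "l < x $ i" "l \<ge> 0" "\<And>t. t \<in> T \<Longrightarrow> t < x $ i \<Longrightarrow> t \<le> l"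
        using finT \<open>0 < x $ i\<close> by (auto simp: l_def intro!: Max_ge)
      have fy: "f (y t) = s ?R * y t + v ?R" if t: "l < t" "t < x $ i" for t
      proof -
        have tT: "t \<notin> T" using l(3) t by force
        have "t < 1" using t xi(2)[of i] by linarith
        then have "y t \<in> unit_cube" using x t l(2) by (auto simp: unit_cube_def y_def)
        moreover have "{j. y t $ j \<in> T} \<subset> {j. x $ j \<in> T}"
          using i tT by (auto simp: y_def split: if_splits)
        then have "card {j. y t $ j \<in> T} < card {j. x $ j \<in> T}" by (intro psubset_card_mono) auto
        moreover have "lcell T (y t) = lcell T x"
          unfolding lcell_eq_iff using l(3) t by (force simp: y_def)
        ultimately show ?thesis using less.hyps by metis
      qed
      have "((\<lambda>t. f (y t)) \<longlongrightarrow> f x) (at_left (x $ i))"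
        using lc x \<open>0 < x $ i\<close> unfolding left_cont_each_var_def y_def by blast
      moreover have "eventually (\<lambda>t. t \<in> {l<..<x $ i}) (at_left (x $ i))"
        using l(1) by (rule eventually_at_left_real)
      then have "eventually (\<lambda>t. f (y t) = s ?R * y t + v ?R) (at_left (x $ i))"
        by eventually_elim (use fy in auto)
      ultimately have lim1: "((\<lambda>t. s ?R * y t + v ?R) \<longlongrightarrow> f x) (at_left (x $ i))"
        by (rule Lim_transform_eventually)
      have "((\<lambda>t. s ?R * y t + v ?R) \<longlongrightarrow> s ?R * x + v ?R) (at_left (x $ i))"
        unfolding y_def by (rule tendsto_affine_coord)
      then show ?thesis using tendsto_unique[OF _ lim1] trivial_limit_at_left_real by blast
    qed
  qed
  show thesis
  \<comment> \<open>Codes that no point of the cube has may get an arbitrary rectangle; the default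
    1 makes \<open>sign_vec\<close> hold for every code.\<close>
  proof (rule that[OF finT T01, of "\<lambda>c. if sign_vec (s (rect c)) then s (rect c) else 1" "\<lambda>c. v (rect c)"])
    show "f x = (if sign_vec (s (rect (lcell T x))) then s (rect (lcell T x)) else 1) * x + v (rect (lcell T x))"
      if "x \<in> unit_cube" for x
      using main[OF that] s rect(1)[OF that] by simp
  qed simp
qed

lemma rcell_rectangle:
  fixes x :: "real ^ 'n"
  assumes x: "x \<in> unit_cube" and T: "finite T" "T \<subseteq> {0<..<1}"
  obtains a b where "{y \<in> unit_cube. rcell T y = rcell T x} = rect_co a b"
    "\<And>i. 0 \<le> a $ i" "\<And>i. a $ i < b $ i" "\<And>i. b $ i \<le> 1"
    "\<And>i t. t \<in> T \<Longrightarrow> \<not> (a $ i < t \<and> t < b $ i)"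
proof -
  define A where "A i = insert 0 {t \<in> T. t \<le> x $ i}" for i
  define B where "B i = insert 1 {t \<in> T. x $ i < t}" for i
  have fin: "finite (A i)" "finite (B i)" for i using T by (auto simp: A_def B_def)
  have ne: "A i \<noteq> {}" "B i \<noteq> {}" for i by (auto simp: A_def B_def)
  define a where "a = (\<chi> i. Max (A i))"
  define b where "b = (\<chi> i. Min (B i))"
  have ai: "a $ i \<in> A i" and bi: "b $ i \<in> B i" for i
    using Max_in[OF fin(1) ne(1)] Min_in[OF fin(2) ne(2)] by (simp_all add: a_def b_def)
  have a_ge: "t \<le> a $ i" if "t \<in> A i" for t i using that fin by (simp add: a_def)
  have b_le: "b $ i \<le> t" if "t \<in> B i" for t i using that fin by (simp add: b_def)
  have xi: "0 \<le> x $ i" "x $ i < 1" for i using x by (auto simp: unit_cube_def)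
  have ax: "a $ i \<le> x $ i" for i using ai[of i] xi[of i] by (auto simp: A_def)
  have xb: "x $ i < b $ i" for i using bi[of i] xi[of i] by (auto simp: B_def)
  have a0: "0 \<le> a $ i" for i by (rule a_ge) (simp add: A_def)
  have b1: "b $ i \<le> 1" for i by (rule b_le) (simp add: B_def)
  show thesis
  proof (rule that[of a b])
    show "{y \<in> unit_cube. rcell T y = rcell T x} = rect_co a b"
    proof (intro equalityI subsetI)
      fix y assume "y \<in> {y \<in> unit_cube. rcell T y = rcell T x}"
      then have y: "y \<in> unit_cube" and same: "\<And>i t. t \<in> T \<Longrightarrow> t \<le> y $ i \<longleftrightarrow> t \<le> x $ i"
        by (auto simp: rcell_eq_iff)
      have yi: "0 \<le> y $ i" "y $ i < 1" for i using y by (auto simp: unit_cube_def)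
      show "y \<in> rect_co a b"
        unfolding rect_co_def
      proof (intro CollectI allI conjI)
        fix i
        show "a $ i \<le> y $ i" using ai[of i] yi[of i] same[of "a $ i" i] by (auto simp: A_def)
        show "y $ i < b $ i" using bi[of i] yi[of i] same[of "b $ i" i] by (auto simp: B_def)
      qed
    next
      fix y assume y: "y \<in> rect_co a b"
      then have yi: "a $ i \<le> y $ i" "y $ i < b $ i" for i by (auto simp: rect_co_def)
      have "t \<le> y $ i \<longleftrightarrow> t \<le> x $ i" if t: "t \<in> T" for t i
      proof (cases "t \<le> x $ i")
        case True
        then have "t \<le> a $ i" using t by (intro a_ge) (simp add: A_def)
        then show ?thesis using True yi(1)[of i] by linarith
      next
        case False
        then have "b $ i \<le> t" using t by (intro b_le) (simp add: B_def)
        then show ?thesis using False yi(2)[of i] by linarith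
      qed
      then have "rcell T y = rcell T x" by (simp add: rcell_eq_iff)
      moreover have "y \<in> unit_cube"
        unfolding unit_cube_def
      proof (intro CollectI allI conjI)
        fix i
        show "0 \<le> y $ i" using a0[of i] yi(1)[of i] by linarith
        show "y $ i < 1" using b1[of i] yi(2)[of i] by linarith
      qed
      ultimately show "y \<in> {y \<in> unit_cube. rcell T y = rcell T x}" by simp
    qed
    show "a $ i < b $ i" for i using ax[of i] xb[of i] by linarith
    show "\<not> (a $ i < t \<and> t < b $ i)" if "t \<in> T" for i t
    proof (cases "t \<le> x $ i")
      case True
      then have "t \<in> A i" using \<open>t \<in> T\<close> by (simp add: A_def)
      then show ?thesis using a_ge[of t i] by linarith
    next
      case False
      then have "t \<in> B i" using \<open>t \<in> T\<close> by (simp add: B_def)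
      then show ?thesis using b_le[of t i] by linarith
    qed
  qed (use a0 b1 in auto)
qed

definition rcell_partition :: "real set \<Rightarrow> (real ^ 'n) set set" where
  "rcell_partition T = (\<lambda>x. {y \<in> unit_cube. rcell T y = rcell T x}) ` unit_cube"

lemma rect_partition_rcells:
  assumes T: "finite T" "T \<subseteq> {0<..<1}"
  shows "rect_partition (rcell_partition T :: (real ^ 'n) set set)"
  unfolding rect_partition_def
proof (intro conjI ballI impI)
  have "rcell_partition T \<subseteq> (\<lambda>c. {y :: real ^ 'n. y \<in> unit_cube \<and> rcell T y = c}) ` range (rcell T :: real ^ 'n \<Rightarrow> _)"
    by (auto simp: rcell_partition_def)
  then show "finite (rcell_partition T :: (real ^ 'n) set set)"
    using finite_range_rcell[OF T(1)] finite_subset by blast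
  show "is_rectangle R" if R: "R \<in> rcell_partition T" for R :: "(real ^ 'n) set"
  proof -
    obtain x where x: "x \<in> unit_cube" "R = {y \<in> unit_cube. rcell T y = rcell T x}"
      using R by (auto simp: rcell_partition_def)
    show ?thesis
      unfolding is_rectangle_def x(2) by (rule rcell_rectangle[OF x(1) T]) blast
  qed
  show "\<Union> (rcell_partition T) = unit_cube" by (auto simp: rcell_partition_def)
qed (auto simp: rcell_partition_def)

lemma E_set_lcellI:
  fixes f :: "real ^ 'n \<Rightarrow> real ^ 'n"
  assumes T: "finite T" "T \<subseteq> {0<..<1}" and s: "\<And>c. sign_vec (s c)"
    and f: "\<And>x. x \<in> unit_cube \<Longrightarrow> f x = s (lcell T x) * x + v (lcell T x)"
    and closed: "\<And>x. x \<in> unit_cube \<Longrightarrow> f x \<in> closed_unit_cube" and outside: "extensional_cube f"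
  shows "f \<in> E_set"
  unfolding E_set_def
proof (intro CollectI conjI ballI)
  show "left_cont_each_var f"
    unfolding left_cont_each_var_def
  proof (intro ballI allI impI)
    fix x :: "real ^ 'n" and i assume x: "x \<in> unit_cube" and "0 < x $ i"
    have xi: "x $ i < 1" using x by (auto simp: unit_cube_def)
    define y where "y t = (\<chi> j. if j = i then t else x $ j)" for t
    define l where "l = Max (insert 0 {t \<in> T. t < x $ i})"
    have l: "l < x $ i" "l \<ge> 0" "\<And>t. t \<in> T \<Longrightarrow> t < x $ i \<Longrightarrow> t \<le> l"
      using T(1) \<open>0 < x $ i\<close> by (auto simp: l_def intro!: Max_ge)
    have fy: "s (lcell T x) * y t + v (lcell T x) = f (y t)" if t: "l < t" "t < x $ i" for t
    proof -
      have "t < 1" using t xi by linarith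
      then have "y t \<in> unit_cube" using x t l(2) by (auto simp: unit_cube_def y_def)
      moreover have "lcell T (y t) = lcell T x"
        unfolding lcell_eq_iff using l(3) t by (force simp: y_def)
      ultimately show ?thesis using f by metis
    qed
    have "eventually (\<lambda>t. t \<in> {l<..<x $ i}) (at_left (x $ i))"
      using l(1) by (rule eventually_at_left_real)
    then have "eventually (\<lambda>t. s (lcell T x) * y t + v (lcell T x) = f (y t)) (at_left (x $ i))"
      by eventually_elim (use fy in auto)
    moreover have "((\<lambda>t. s (lcell T x) * y t + v (lcell T x)) \<longlongrightarrow> f x) (at_left (x $ i))"
      unfolding y_def f[OF x] by (rule tendsto_affine_coord)
    ultimately show "((\<lambda>t. f (\<chi> j. if j = i then t else x $ j)) \<longlongrightarrow> f x) (at_left (x $ i))"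
      unfolding y_def[symmetric] by (rule Lim_transform_eventually[rotated])
  qed
  show "\<exists>P. rect_partition P \<and> (\<forall>R\<in>P. \<exists>a b s v. R = rect_co a b \<and> (\<forall>i. s $ i = 1 \<or> s $ i = - 1) \<and>
     (\<forall>x\<in>R. (\<forall>i. a $ i < x $ i \<or> x $ i = 0) \<longrightarrow> f x = (\<chi> i. s $ i * x $ i) + v))"
  proof (intro exI[of _ "rcell_partition T"] conjI ballI)
    show "rect_partition (rcell_partition T :: (real ^ 'n) set set)" using T by (rule rect_partition_rcells)
    fix R :: "(real ^ 'n) set" assume R: "R \<in> rcell_partition T"
    obtain x where x: "x \<in> unit_cube" "R = {y \<in> unit_cube. rcell T y = rcell T x}"
      using R by (auto simp: rcell_partition_def)
    obtain a b where ab: "R = rect_co a b" "\<And>i. 0 \<le> a $ i" "\<And>i t. t \<in> T \<Longrightarrow> \<not> (a $ i < t \<and> t < b $ i)"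
      by (rule rcell_rectangle[OF x(1) T, folded x(2)], rule that)
    \<comment> \<open>Off the interior lower faces a threshold lies strictly below
      \<open>y $ i\<close> exactly if it is at most \<open>a $ i\<close>, so all such points of the
      left-closed rectangle share this left-open code.\<close>
    define c where "c = (\<lambda>i. {t \<in> T. t \<le> a $ i})"
    have "f y = s c * y + v c" if y: "y \<in> R" "\<And>i. a $ i < y $ i \<or> y $ i = 0" for y
    proof -
      have yi: "a $ i \<le> y $ i" "y $ i < b $ i" for i using y(1) by (auto simp: ab(1) rect_co_def)
      have "t < y $ i \<longleftrightarrow> t \<le> a $ i" if t: "t \<in> T" for t i
      proof -
        have "t > 0" using t T(2) by auto
        then show ?thesis using ab(3)[OF t, of i] ab(2)[of i] yi[of i] y(2)[of i] by linarith
      qed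
      then have "lcell T y = c" unfolding lcell_def c_def by (intro ext Collect_cong) blast
      moreover have "y \<in> unit_cube" using y(1) x(2) by blast
      ultimately show ?thesis using f by metis
    qed
    then show "\<exists>a b s v. R = rect_co a b \<and> (\<forall>i. s $ i = 1 \<or> s $ i = - 1) \<and>
     (\<forall>x\<in>R. (\<forall>i. a $ i < x $ i \<or> x $ i = 0) \<longrightarrow> f x = (\<chi> i. s $ i * x $ i) + v)"
      using ab(1) s[of c] unfolding sign_vec_def times_vec_def by blast
  qed
qed (use closed outside in auto)

lemma lcell_antimono: "lcell T x = lcell T y \<Longrightarrow> T' \<subseteq> T \<Longrightarrow> lcell T' x = lcell T' y"
  unfolding lcell_eq_iff by blast

text \<open>Each point of the cube is a limit of points off \<open>S\<close> in a cell on which both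
  maps are isometries. The form with negligible sets serves the orbits, which are understood only
  off a countable union of hyperplanes.\<close>

lemma E_set_eqI:
  fixes f g :: "real ^ 'n \<Rightarrow> real ^ 'n"
  assumes f: "f \<in> E_set" and g: "g \<in> E_set" and S: "negligible S"
    and eq: "\<And>x. x \<in> unit_cube \<Longrightarrow> x \<notin> S \<Longrightarrow> f x = g x"
  shows "f = g"
proof
  fix x
  show "f x = g x"
  proof (cases "x \<in> unit_cube")
    case False
    then show ?thesis using f g by (simp add: E_set_def extensional_cube_def)
  next
    case x: True
    obtain T s v where T: "finite T" "T \<subseteq> {0<..<1}" and s: "\<And>c. sign_vec (s c)"
      and f': "\<And>x. x \<in> unit_cube \<Longrightarrow> f x = s (lcell T x) * x + v (lcell T x)"
      using E_set_lcellD[OF f] by metis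
    obtain T' s' v' where T': "finite T'" "T' \<subseteq> {0<..<1}" and s': "\<And>c. sign_vec (s' c)"
      and g': "\<And>x. x \<in> unit_cube \<Longrightarrow> g x = s' (lcell T' x) * x + v' (lcell T' x)"
      using E_set_lcellD[OF g] by metis
    have "dist (f x) (g x) < e" if "e > 0" for e
    proof -
      have "finite (T \<union> T')" "T \<union> T' \<subseteq> {0<..}" "e / 2 > 0" using T T' \<open>e > 0\<close> by auto
      then obtain y where y: "y \<in> unit_cube" "y \<notin> S" "lcell (T \<union> T') y = lcell (T \<union> T') x" "dist y x < e / 2"
        using lcell_dense[OF x _ _ S] by metis
      have "lcell T y = lcell T x" "lcell T' y = lcell T' x"
        using lcell_antimono[OF y(3)] by blast+
      then have "dist (f y) (f x) = dist y x" "dist (g y) (g x) = dist y x"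
        using f'[OF x] f'[OF y(1)] g'[OF x] g'[OF y(1)] dist_sign_vec s s' by metis+
      moreover have "f y = g y" using eq y by blast
      ultimately show ?thesis
        using dist_triangle3[of "f x" "g x" "f y"] y(4) by simp
    qed
    then show ?thesis by (metis dist_self less_irrefl zero_less_dist_iff)
  qed
qed

lemma closed_unit_cube_eq: "closed_unit_cube = cbox 0 (1 :: real ^ 'n)"
  by (auto simp: closed_unit_cube_def mem_box_cart)

text \<open>The way to produce elements of \<open>E_set\<close>: a formula valid off a small set,
  with coefficients constant on cells, is extended to each whole cell from a representative. The
  added values are limits of old ones, so they stay in the cube because it is the closed
  one.\<close>

lemma E_set_extend:
  fixes q :: "real ^ 'n \<Rightarrow> real ^ 'n"
  assumes T: "finite T" and Z: "small Z"
    and s: "\<And>x. x \<in> unit_cube \<Longrightarrow> x \<notin> Z \<Longrightarrow> sign_vec (s x)"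
    and q: "\<And>x. x \<in> unit_cube \<Longrightarrow> x \<notin> Z \<Longrightarrow> q x = s x * x + v x"
    and closed: "\<And>x. x \<in> unit_cube \<Longrightarrow> x \<notin> Z \<Longrightarrow> q x \<in> closed_unit_cube"
    and const: "\<And>x y. x \<in> unit_cube \<Longrightarrow> y \<in> unit_cube \<Longrightarrow> x \<notin> Z \<Longrightarrow> y \<notin> Z \<Longrightarrow> lcell T x = lcell T y \<Longrightarrow>
      s x = s y \<and> v x = v y"
  obtains h Z' where "h \<in> E_set" "small Z'" "\<And>x. x \<in> unit_cube \<Longrightarrow> x \<notin> Z' \<Longrightarrow> h x = q x"
proof -
  define T0 where "T0 = T \<inter> {0<..<1}"
  have T0: "finite T0" "T0 \<subseteq> {0<..<1}" "T0 \<subseteq> {0<..}" using T by (auto simp: T0_def)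
  \<comment> \<open>Points without zero coordinates have all coordinates strictly between 0 and 1,
    where the thresholds discarded from \<open>T\<close> separate nothing.\<close>
  define Z' where "Z' = Z \<union> {x. \<exists>i. x $ i \<in> {0}}"
  have Z': "small Z'" unfolding Z'_def by (intro small_Un Z small_coords) simp
  have const': "s x = s y \<and> v x = v y"
    if x: "x \<in> unit_cube" "x \<notin> Z'" and y: "y \<in> unit_cube" "y \<notin> Z'" and c: "lcell T0 x = lcell T0 y" for x y
  proof (rule const)
    have b: "0 < x $ i" "x $ i < 1" "0 < y $ i" "y $ i < 1" for i
      using x y by (auto simp: Z'_def unit_cube_def order.strict_iff_order)
    show "lcell T x = lcell T y"
      unfolding lcell_eq_iff
    proof (intro allI ballI)
      fix i t assume "t \<in> T"
      then show "t < x $ i \<longleftrightarrow> t < y $ i"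
        using c b[of i] unfolding lcell_eq_iff T0_def by (cases "0 < t"; cases "t < 1") auto
    qed
  qed (use x y in \<open>auto simp: Z'_def\<close>)
  define rep where "rep c = (SOME z. z \<in> unit_cube \<and> z \<notin> Z' \<and> lcell T0 z = c)" for c :: "'n \<Rightarrow> real set"
  have rep: "rep (lcell T0 x) \<in> unit_cube \<and> rep (lcell T0 x) \<notin> Z' \<and> lcell T0 (rep (lcell T0 x)) = lcell T0 x"
    if "x \<in> unit_cube" for x
    unfolding rep_def
    by (rule someI_ex) (use lcell_dense[OF that T0(1,3) small_imp_negligible[OF Z'] zero_less_one] in blast)
  define s' where "s' c = (if sign_vec (s (rep c)) then s (rep c) else 1)" for c
  have s': "sign_vec (s' c)" for c by (simp add: s'_def)
  define h where "h x = (if x \<in> unit_cube then s' (lcell T0 x) * x + v (rep (lcell T0 x)) else x)" for x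
  have hq: "h x = q x" if x: "x \<in> unit_cube" "x \<notin> Z'" for x
  proof -
    have "s (rep (lcell T0 x)) = s x \<and> v (rep (lcell T0 x)) = v x"
      by (rule const') (use rep[OF x(1)] x in auto)
    then show ?thesis using x q s by (simp add: h_def s'_def Z'_def)
  qed
  have "h \<in> E_set"
  proof (rule E_set_lcellI[OF T0(1,2) s'])
    show "h x = s' (lcell T0 x) * x + v (rep (lcell T0 x))" if "x \<in> unit_cube" for x
      using that by (simp add: h_def)
    show "extensional_cube h" by (simp add: h_def extensional_cube_def)
    show "h x \<in> closed_unit_cube" if x: "x \<in> unit_cube" for x
    proof -
      have "\<exists>z\<in>closed_unit_cube. dist z (h x) < e" if "e > 0" for e
      proof -
        obtain y where y: "y \<in> unit_cube" "y \<notin> Z'" "lcell T0 y = lcell T0 x" "dist y x < e"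
          using lcell_dense[OF x T0(1,3) small_imp_negligible[OF Z'] \<open>e > 0\<close>] by blast
        have "h y \<in> closed_unit_cube" using closed hq[OF y(1,2)] y by (simp add: Z'_def)
        moreover have "dist (h y) (h x) = dist y x"
          using x y by (simp add: h_def dist_norm norm_sign_vec_mult[OF s'] flip: right_diff_distrib)
        ultimately show ?thesis using y(4) by metis
      qed
      then have "h x \<in> closure closed_unit_cube" by (simp add: closure_approachable)
      then show ?thesis by (simp add: closed_unit_cube_eq)
    qed
  qed
  then show thesis using that Z' hq by metis
qed

lemma E_set_vimage_small:
  fixes f :: "real ^ 'n \<Rightarrow> real ^ 'n"
  assumes f: "f \<in> E_set" and S: "small S"
  shows "small {x \<in> unit_cube. f x \<in> S}"
proof -
  obtain T s v where T: "finite T" "T \<subseteq> {0<..<1}" and s: "\<And>c. sign_vec (s c)"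
    and f': "\<And>x. x \<in> unit_cube \<Longrightarrow> f x = s (lcell T x) * x + v (lcell T x)"
    using E_set_lcellD[OF f] by metis
  have "small (\<Union>c\<in>range (lcell T :: real ^ 'n \<Rightarrow> _). {x. s c * x + v c \<in> S})"
    by (intro small_UN finite_range_lcell T small_affine_preimage s S)
  then show ?thesis by (rule small_subset) (auto simp: f')
qed

text \<open>An element of \<open>E_set\<close> leaves the half-open cube only through a coordinate
  equal to 1, hence only on a small set; this gives \<open>g \<circ> f\<close> a meaning off a small
  set.\<close>

lemma E_set_vimage_small':
  assumes f: "f \<in> E_set" and S: "small S"
  shows "small {x \<in> unit_cube. f x \<notin> unit_cube - S}"
proof -
  have "small (S \<union> {x. \<exists>i. x $ i \<in> {1}})" by (intro small_Un S small_coords) simp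
  from E_set_vimage_small[OF f this] show ?thesis
  proof (rule small_subset)
    have "f x \<in> closed_unit_cube" if "x \<in> unit_cube" for x using f that by (simp add: E_set_def)
    then show "{x \<in> unit_cube. f x \<notin> unit_cube - S} \<subseteq> {x \<in> unit_cube. f x \<in> S \<union> {x. \<exists>i. x $ i \<in> {1}}}"
      by (force simp: unit_cube_def closed_unit_cube_def order.order_iff_strict)
  qed
qed

text \<open>The preimages of the thresholds \<open>t\<close> under the coordinate maps
  \<open>x \<mapsto> x + r\<close> and \<open>x \<mapsto> r - x\<close>.\<close>

definition shifted_thresholds :: "real set \<Rightarrow> real set \<Rightarrow> real set" where
  "shifted_thresholds T V = (\<lambda>(t, r). t - r) ` (T \<times> V) \<union> (\<lambda>(t, r). r - t) ` (T \<times> V)"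

lemma finite_shifted_thresholds: "finite T \<Longrightarrow> finite V \<Longrightarrow> finite (shifted_thresholds T V)"
  by (simp add: shifted_thresholds_def)

text \<open>A reflected coordinate turns left-open cells into right-open ones, so codes can be
  compared only away from the thresholds; this is the reason for deleting the hyperplanes of
  \<open>T'\<close>.\<close>

lemma affine_threshold:
  fixes x y s v :: "real ^ 'n"
  assumes s: "sign_vec s" and sub: "shifted_thresholds T V \<subseteq> T'" and v: "v $ i \<in> V" and t: "t \<in> T"
    and c: "lcell T' x = lcell T' y" and x: "x $ i \<notin> T'" and y: "y $ i \<notin> T'"
  shows "(t < (s * x + v) $ i \<longleftrightarrow> t < (s * y + v) $ i) \<and> (s * x + v) $ i \<noteq> t"
proof -
  have T': "t - v $ i \<in> T'" "v $ i - t \<in> T'" using sub v t by (force simp: shifted_thresholds_def)+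
  have ne: "x $ i \<noteq> t - v $ i" "x $ i \<noteq> v $ i - t" "y $ i \<noteq> t - v $ i" "y $ i \<noteq> v $ i - t"
    using T' x y by metis+
  have same: "t - v $ i < x $ i \<longleftrightarrow> t - v $ i < y $ i" "v $ i - t < x $ i \<longleftrightarrow> v $ i - t < y $ i"
    using c T' unfolding lcell_eq_iff by blast+
  consider "s $ i = 1" | "s $ i = - 1" using s unfolding sign_vec_def by blast
  then show ?thesis
  proof cases
    case 1
    then show ?thesis using ne(1) same(1) by (simp add: less_diff_eq diff_less_eq)
  next
    case 2
    then show ?thesis using ne same(2) by simp linarith
  qed
qed

section \<open>The groups\<close>

lemma RecB_comp_exists:
  fixes f g :: "real ^ 'n \<Rightarrow> real ^ 'n"
  assumes f: "f \<in> RecB_set" and g: "g \<in> RecB_set"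
  shows "\<exists>h\<in>RecB_set. \<exists>S. small S \<and> (\<forall>x\<in>unit_cube - S. h x = g (f x))"
proof -
  have fE: "f \<in> E_set" and gE: "g \<in> E_set" using f g by (auto simp: RecB_set_def)
  obtain Sf where Sf: "small Sf" "inj_on f (unit_cube - Sf)" using f by (auto simp: RecB_set_def)
  obtain Sg where Sg: "small Sg" "inj_on g (unit_cube - Sg)" using g by (auto simp: RecB_set_def)
  obtain T s v where T: "finite T" "T \<subseteq> {0<..<1}" and s: "\<And>c. sign_vec (s c)"
    and f': "\<And>x. x \<in> unit_cube \<Longrightarrow> f x = s (lcell T x) * x + v (lcell T x)"
    using E_set_lcellD[OF fE] by metis
  obtain Tg sg vg where Tg: "finite Tg" "Tg \<subseteq> {0<..<1}" and sg: "\<And>c. sign_vec (sg c)"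
    and g': "\<And>x. x \<in> unit_cube \<Longrightarrow> g x = sg (lcell Tg x) * x + vg (lcell Tg x)"
    using E_set_lcellD[OF gE] by metis
  define V where "V = (\<Union>i. (\<lambda>c. v c $ i) ` range (lcell T :: real ^ 'n \<Rightarrow> _))"
  have "finite V" unfolding V_def by (intro finite_UN_I finite_imageI finite_range_lcell T) simp
  define T' where "T' = T \<union> shifted_thresholds Tg V"
  have T': "finite T'" unfolding T'_def by (intro finite_UnI finite_shifted_thresholds T Tg \<open>finite V\<close>)
  define Z where "Z = {x \<in> unit_cube. f x \<notin> unit_cube - Sg} \<union> {x. \<exists>i. x $ i \<in> T'}"
  have Z: "small Z" unfolding Z_def by (intro small_Un small_coords T' E_set_vimage_small' fE Sg)
  have fx: "f x \<in> unit_cube" "f x \<notin> Sg" if "x \<in> unit_cube" "x \<notin> Z" for x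
    using that by (auto simp: Z_def)
  define s' where "s' x = sg (lcell Tg (f x)) * s (lcell T x)" for x
  define v' where "v' x = sg (lcell Tg (f x)) * v (lcell T x) + vg (lcell Tg (f x))" for x
  have const: "s' x = s' y \<and> v' x = v' y"
    if x: "x \<in> unit_cube" "x \<notin> Z" and y: "y \<in> unit_cube" "y \<notin> Z" and c: "lcell T' x = lcell T' y" for x y
  proof -
    have cT: "lcell T y = lcell T x" using lcell_antimono[OF c, of T] by (simp add: T'_def)
    have "lcell Tg (f x) = lcell Tg (f y)"
      unfolding lcell_eq_iff f'[OF x(1)] f'[OF y(1)] cT
    proof (intro allI ballI)
      fix i t assume t: "t \<in> Tg"
      have "v (lcell T x) $ i \<in> V" by (auto simp: V_def)
      then show "t < (s (lcell T x) * x + v (lcell T x)) $ i \<longleftrightarrow> t < (s (lcell T x) * y + v (lcell T x)) $ i"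
        using affine_threshold[OF s _ _ t c, of V "v (lcell T x)" i "lcell T x"] x y by (auto simp: T'_def Z_def)
    qed
    then show ?thesis by (simp add: s'_def v'_def cT)
  qed
  obtain h Z' where h: "h \<in> E_set" and Z': "small Z'"
    and hq: "\<And>x. x \<in> unit_cube \<Longrightarrow> x \<notin> Z' \<Longrightarrow> h x = (g \<circ> f) x"
  proof (rule E_set_extend[OF T' Z, where q = "g \<circ> f" and s = s' and v = v'])
    show "sign_vec (s' x)" for x unfolding s'_def by (intro sign_vec_mult s sg)
    show "(g \<circ> f) x = s' x * x + v' x" if x: "x \<in> unit_cube" "x \<notin> Z" for x
    proof -
      have "(g \<circ> f) x = sg (lcell Tg (f x)) * f x + vg (lcell Tg (f x))" using g' fx[OF x] by simp
      also have "\<dots> = sg (lcell Tg (f x)) * (s (lcell T x) * x + v (lcell T x)) + vg (lcell Tg (f x))"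
        by (simp add: f'[OF x(1), symmetric])
      finally show ?thesis by (simp add: s'_def v'_def distrib_left mult.assoc add.assoc)
    qed
    show "(g \<circ> f) x \<in> closed_unit_cube" if x: "x \<in> unit_cube" "x \<notin> Z" for x
      using gE fx[OF x] by (simp add: E_set_def)
  qed (use const that in blast)+
  have "inj_on h (unit_cube - (Sf \<union> Z \<union> Z'))"
  proof (rule inj_onI)
    fix x y assume x: "x \<in> unit_cube - (Sf \<union> Z \<union> Z')" and y: "y \<in> unit_cube - (Sf \<union> Z \<union> Z')" and "h x = h y"
    then have "g (f x) = g (f y)" using hq by auto
    then have "f x = f y" using fx[of x] fx[of y] x y Sg(2) by (auto dest: inj_onD)
    then show "x = y" using x y Sf(2) by (auto dest: inj_onD)
  qed
  moreover have "small (Sf \<union> Z \<union> Z')" by (intro small_Un Sf Z Z')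
  ultimately have "h \<in> RecB_set" using h unfolding RecB_set_def by blast
  then show ?thesis using Z' hq by (intro bexI[of _ h] exI[of _ Z']) auto
qed

section \<open>Inverses by comparison of volumes\<close>

lemma continuous_affine_sign:
  assumes "sign_vec s"
  shows "continuous_on A (\<lambda>x. s * x + v)"
  unfolding continuous_on_iff using dist_sign_vec[OF assms] by metis

lemma measure_affine_sign:
  fixes s :: "real ^ ('n :: {finite, wellorder})"
  assumes s: "sign_vec s" and S: "S \<in> lmeasurable"
  shows "(\<lambda>x. s * x + v) ` S \<in> lmeasurable \<and> measure lebesgue ((\<lambda>x. s * x + v) ` S) = measure lebesgue S"
proof -
  have "linear ((*) s)"
    by (rule linearI) (auto simp: distrib_left vec_eq_iff)
  then have o: "orthogonal_transformation ((*) s)"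
    by (simp add: orthogonal_transformation norm_sign_vec_mult[OF s])
  have "(\<lambda>x. s * x + v) ` S = (+) v ` ((*) s ` S)" by (simp add: image_image add.commute)
  then show ?thesis
    using measurable_orthogonal_image[OF o S] measure_orthogonal_image[OF o S]
    by (simp add: measurable_translation measure_translation)
qed

lemma affine_sign_inverse:
  assumes "sign_vec s"
  shows "s * y + - (s * v) = x \<longleftrightarrow> y = s * x + v"
proof
  assume "s * y + - (s * v) = x"
  then have "s * (y - v) = x" by (simp add: right_diff_distrib)
  then show "y = s * x + v" using sign_vec_cancel[OF assms] by (metis diff_add_cancel)
qed (simp add: distrib_left sign_vec_cancel[OF assms])

text \<open>An injective element of \<open>E\<close> maps its open cells to pairwise disjoint open sets of the same
  total volume as the cube, so that up to a small set these cover the cube.\<close>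

lemma RecB_left_inverse_exists:
  fixes f :: "real ^ ('n :: {finite, wellorder}) \<Rightarrow> (real, 'n) vec"
  assumes f: "f \<in> RecB_set"
  shows "\<exists>h\<in>RecB_set. \<exists>S. small S \<and> (\<forall>x\<in>unit_cube - S. h (f x) = x)"
proof -
  have fE: "f \<in> E_set" using f by (auto simp: RecB_set_def)
  obtain Sf where Sf: "small Sf" "inj_on f (unit_cube - Sf)" using f by (auto simp: RecB_set_def)
  obtain T s v where T: "finite T" "T \<subseteq> {0<..<1}" and s: "\<And>c. sign_vec (s c)"
    and f': "\<And>x. x \<in> unit_cube \<Longrightarrow> f x = s (lcell T x) * x + v (lcell T x)"
    using E_set_lcellD[OF fE] by metis
  define C where "C = range (lcell T :: (real, 'n) vec \<Rightarrow> _)"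
  have finC: "finite C" unfolding C_def by (rule finite_range_lcell[OF T(1)])
  define F where "F c x = s c * x + v c" for c x
  define B where "B = {x :: (real, 'n) vec. \<exists>i. x $ i \<in> T \<union> {0, 1}}"
  have B: "small B" unfolding B_def using T(1) by (intro small_coords) simp
  \<comment> \<open>Deleting the hyperplanes in \<open>B\<close> makes the cells open, so that an
    overlap of images, or an uncovered part, has positive volume unless it is empty.\<close>
  define Oc where "Oc c = {x :: (real, 'n) vec. x \<in> unit_cube \<and> x \<notin> B \<and> lcell T x = c}" for c
  define W where "W c = F c ` Oc c" for c
  have Oc_iff: "x \<in> Oc c \<longleftrightarrow>
      (\<forall>i. 0 < x $ i \<and> x $ i < 1 \<and> (\<forall>t\<in>T. if t \<in> c i then t < x $ i else x $ i < t))" if "c \<in> C" for c x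
  proof
    assume "x \<in> Oc c"
    then have x: "x \<in> unit_cube" "x \<notin> B" "lcell T x = c" by (auto simp: Oc_def)
    have ne: "x $ i \<noteq> t" if "t \<in> T \<union> {0, 1}" for i t using x(2) that by (auto simp: B_def)
    show "\<forall>i. 0 < x $ i \<and> x $ i < 1 \<and> (\<forall>t\<in>T. if t \<in> c i then t < x $ i else x $ i < t)"
    proof (intro allI conjI ballI)
      fix i
      have "0 \<le> x $ i" using x(1) by (simp add: unit_cube_def)
      then show "0 < x $ i" using ne[of 0 i] by simp
      show "x $ i < 1" using x(1) by (simp add: unit_cube_def)
      fix t assume t: "t \<in> T"
      then have "t \<in> c i \<longleftrightarrow> t < x $ i" using x(3) by (auto simp: lcell_def)
      then show "if t \<in> c i then t < x $ i else x $ i < t" using ne[of t i] t by auto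
    qed
  next
    assume x: "\<forall>i. 0 < x $ i \<and> x $ i < 1 \<and> (\<forall>t\<in>T. if t \<in> c i then t < x $ i else x $ i < t)"
    have cT: "c i \<subseteq> T" for i using that by (auto simp: C_def lcell_def)
    have xt: "(t < x $ i \<longleftrightarrow> t \<in> c i) \<and> x $ i \<noteq> t" if "t \<in> T" for i t
      using x that by (cases "t \<in> c i") (metis less_irrefl less_asym)+
    have "x $ i \<noteq> 0" "x $ i \<noteq> 1" for i using x by (metis less_irrefl)+
    then have "x \<notin> B" using xt by (auto simp: B_def)
    moreover have "lcell T x = c" using cT xt by (auto simp: lcell_def fun_eq_iff)
    ultimately show "x \<in> Oc c" using x by (auto simp: Oc_def unit_cube_def less_imp_le)
  qed
  have openO: "open (Oc c)" if "c \<in> C" for c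
  proof -
    define H where "H i t = {x :: (real, 'n) vec. if t \<in> c i then t < x $ i else x $ i < t}" for i t
    have "Oc c = (\<Inter>i. {x. 0 < x $ i} \<inter> {x. x $ i < 1} \<inter> (\<Inter>t\<in>T. H i t))"
      by (simp add: set_eq_iff Oc_iff[OF that] H_def)
    moreover have "open (H i t)" for i t
      by (cases "t \<in> c i") (simp_all add: H_def open_halfspace_component_lt_cart open_halfspace_component_gt_cart)
    ultimately show ?thesis using T(1)
      by (auto intro!: open_INT open_Int open_halfspace_component_lt_cart open_halfspace_component_gt_cart)
  qed
  have closureO: "closure (Oc c) \<subseteq> Oc c \<union> B" if "c \<in> C" for c
  proof
    fix x assume "x \<in> closure (Oc c)"
    define H where "H i t = {x :: (real, 'n) vec. if t \<in> c i then t \<le> x $ i else x $ i \<le> t}" for i t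
    have "closed (H i t)" for i t
      by (cases "t \<in> c i") (simp_all add: H_def closed_halfspace_component_le_cart closed_halfspace_component_ge_cart)
    then have "closed (\<Inter>i. {x. 0 \<le> x $ i} \<inter> {x. x $ i \<le> 1} \<inter> (\<Inter>t\<in>T. H i t))"
      by (auto intro!: closed_INT closed_Int closed_halfspace_component_le_cart closed_halfspace_component_ge_cart)
    moreover have "Oc c \<subseteq> (\<Inter>i. {x. 0 \<le> x $ i} \<inter> {x. x $ i \<le> 1} \<inter> (\<Inter>t\<in>T. H i t))"
      by (auto simp: Oc_iff[OF that] H_def less_imp_le split: if_splits)
    ultimately have "closure (Oc c) \<subseteq> (\<Inter>i. {x. 0 \<le> x $ i} \<inter> {x. x $ i \<le> 1} \<inter> (\<Inter>t\<in>T. H i t))"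
      by (rule closure_minimal[rotated])
    then have "x \<in> (\<Inter>i. {x. 0 \<le> x $ i} \<inter> {x. x $ i \<le> 1} \<inter> (\<Inter>t\<in>T. H i t))"
      using \<open>x \<in> closure (Oc c)\<close> by blast
    then have le: "0 \<le> x $ i" "x $ i \<le> 1" and H: "t \<in> T \<Longrightarrow> x \<in> H i t" for i t by auto
    show "x \<in> Oc c \<union> B"
    proof (cases "x \<in> B")
      case False
      then have ne: "x $ i \<noteq> t" if "t \<in> T \<union> {0, 1}" for i t using that by (auto simp: B_def)
      have "0 < x $ i" "x $ i < 1" for i using le[of i] ne[of 0 i] ne[of 1 i] by auto
      moreover have "if t \<in> c i then t < x $ i else x $ i < t" if "t \<in> T" for t i
        using H[OF that, of i] ne[of t i] that by (auto simp: H_def)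
      ultimately show ?thesis using Oc_iff[OF \<open>c \<in> C\<close>] by blast
    qed simp
  qed
  have Fx: "f x = F c x" if "x \<in> Oc c" for x c using that f' by (auto simp: Oc_def F_def)
  have F_inv: "s c * y + - (s c * v c) = x \<longleftrightarrow> y = F c x" for c x y
    unfolding F_def by (rule affine_sign_inverse[OF s])
  have F_image: "F c ` A = {y. s c * y + - (s c * v c) \<in> A}" for c A
    unfolding set_eq_iff image_iff mem_Collect_eq F_inv[symmetric] by blast
  have openW: "open (W c)" if "c \<in> C" for c
  proof -
    have "open ((\<lambda>y. s c * y + - (s c * v c)) -` Oc c)"
      by (rule open_vimage[OF openO[OF that] continuous_affine_sign[OF s]])
    then show ?thesis by (simp add: W_def F_image vimage_def)
  qed
  have W_cube: "W c \<subseteq> closed_unit_cube" for c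
    using Fx fE by (force simp: W_def E_set_def Oc_def)
  \<comment> \<open>A nonempty overlap is open, so it contains a point that is not the image of a
    point of \<open>Sf\<close>; its two preimages would contradict injectivity.\<close>
  have disj: "W c \<inter> W d = {}" if cd: "c \<in> C" "d \<in> C" "c \<noteq> d" for c d
  proof (rule ccontr)
    assume ne: "W c \<inter> W d \<noteq> {}"
    have sm: "small (F c ` Sf)" for c
      unfolding F_image by (rule small_affine_preimage[OF s Sf(1)])
    have "\<not> negligible (W c \<inter> W d)" using ne openW cd by (intro open_not_negligible) auto
    moreover have "negligible (F c ` Sf \<union> F d ` Sf)"
      by (intro small_imp_negligible small_Un sm)
    ultimately have "\<not> W c \<inter> W d \<subseteq> F c ` Sf \<union> F d ` Sf" using negligible_subset by blast
    then obtain y where y: "y \<in> W c" "y \<in> W d" "y \<notin> F c ` Sf" "y \<notin> F d ` Sf" by blast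
    obtain x where x: "x \<in> Oc c" "y = F c x" using y(1) by (auto simp: W_def)
    obtain x' where x': "x' \<in> Oc d" "y = F d x'" using y(2) by (auto simp: W_def)
    have "x \<notin> Sf" "x' \<notin> Sf" using x x' y by blast+
    moreover have "f x = f x'" using Fx x x' by metis
    ultimately have "x = x'" using Sf(2) x(1) x'(1) by (auto simp: Oc_def dest: inj_onD)
    then show False using x(1) x'(1) cd(3) by (auto simp: Oc_def)
  qed
  define G where "G = (\<Union>c\<in>C. F c ` B)"
  have G: "small G" unfolding G_def F_image by (intro small_UN finC small_affine_preimage s B)
  have cover: "box 0 1 \<subseteq> (\<Union>c\<in>C. W c) \<union> G"
  proof -
    \<comment> \<open>The closures make the uncovered part \<open>U\<close> open; since the images
      of the cells already have the volume of the cube, \<open>U\<close> is negligible and therefore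
      empty. What the closures add lies in \<open>G\<close>.\<close>
    define U where "U = box 0 1 - (\<Union>c\<in>C. F c ` closure (Oc c))"
    have "closed (F c ` closure (Oc c))" for c
    proof -
      have "closed ((\<lambda>y. s c * y + - (s c * v c)) -` closure (Oc c))"
        by (rule closed_vimage[OF closed_closure continuous_affine_sign[OF s]])
      then show ?thesis by (simp add: F_image vimage_def)
    qed
    then have openU: "open U" unfolding U_def using finC by (intro open_Diff open_box closed_UN) auto
    have OcM: "Oc c \<in> lmeasurable" if "c \<in> C" for c
    proof (rule lmeasurable_open[OF _ openO[OF that]])
      have "Oc c \<subseteq> cbox 0 1" by (auto simp: Oc_def unit_cube_def mem_box_cart less_imp_le)
      then show "bounded (Oc c)" using bounded_cbox bounded_subset by blast
    qed
    have WM: "W c \<in> lmeasurable" "measure lebesgue (W c) = measure lebesgue (Oc c)" if "c \<in> C" for c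
      using measure_affine_sign[OF s OcM[OF that]] by (auto simp: W_def F_def[abs_def])
    have Ocdisj: "Oc c \<inter> Oc d = {}" if "c \<noteq> d" for c d using that by (auto simp: Oc_def)
    have "measure lebesgue (\<Union>c\<in>C. W c) = (\<Sum>c\<in>C. measure lebesgue (W c))"
      using finC WM disj by (intro measure_negligible_finite_Union_image) (auto simp: pairwise_def)
    also have "\<dots> = (\<Sum>c\<in>C. measure lebesgue (Oc c))" using WM by simp
    also have "\<dots> = measure lebesgue (\<Union>c\<in>C. Oc c)"
      using finC OcM Ocdisj by (intro measure_negligible_finite_Union_image[symmetric]) (auto simp: pairwise_def)
    also have "\<dots> = measure lebesgue (cbox 0 (1 :: (real, 'n) vec))"
    proof (rule measure_negligible_symdiff)
      show "cbox 0 1 \<in> lmeasurable" by simp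
      have "(\<Union>c\<in>C. Oc c) \<subseteq> cbox 0 1" by (auto simp: Oc_def unit_cube_def mem_box_cart less_imp_le)
      moreover have "cbox 0 1 - (\<Union>c\<in>C. Oc c) \<subseteq> B"
      proof
        fix x :: "(real, 'n) vec" assume x: "x \<in> cbox 0 1 - (\<Union>c\<in>C. Oc c)"
        show "x \<in> B"
        proof (rule ccontr)
          assume "x \<notin> B"
          then have "x \<in> unit_cube" using x by (auto simp: B_def unit_cube_def mem_box_cart order.strict_iff_order)
          then have "x \<in> Oc (lcell T x)" using \<open>x \<notin> B\<close> by (simp add: Oc_def)
          then show False using x by (auto simp: C_def)
        qed
      qed
      ultimately show "negligible (cbox 0 1 - (\<Union>c\<in>C. Oc c) \<union> ((\<Union>c\<in>C. Oc c) - cbox 0 1))"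
        by (intro negligible_subset[OF small_imp_negligible[OF B]]) auto
    qed
    finally have meq: "measure lebesgue (\<Union>c\<in>C. W c) = measure lebesgue (cbox 0 (1 :: (real, 'n) vec))" .
    have UM: "U \<in> lmeasurable"
      by (rule lmeasurable_open[OF _ openU]) (auto simp: U_def intro: bounded_subset[OF bounded_box[of 0 1]])
    have MM: "(\<Union>c\<in>C. W c) \<in> lmeasurable" using finC WM by (intro fmeasurable.finite_UN) auto
    have "U \<inter> (\<Union>c\<in>C. W c) = {}" using closure_subset by (force simp: U_def W_def)
    then have "measure lebesgue U + measure lebesgue (\<Union>c\<in>C. W c) = measure lebesgue (U \<union> (\<Union>c\<in>C. W c))"
      using fmeasurableD2[OF UM] fmeasurableD2[OF MM] UM MM
      by (intro measure_Union[symmetric]) (auto simp: infinity_ennreal_def)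
    also have "\<dots> \<le> measure lebesgue (cbox 0 (1 :: (real, 'n) vec))"
    proof (rule measure_mono_fmeasurable)
      show "U \<union> (\<Union>c\<in>C. W c) \<subseteq> cbox 0 1"
        using W_cube box_subset_cbox unfolding U_def closed_unit_cube_eq by blast
    qed (use UM MM in auto)
    finally have "measure lebesgue U = 0" using meq measure_nonneg[of lebesgue U] by linarith
    then have "negligible U" using UM negligible_iff_measure0 by blast
    then have "U = {}" using openU open_not_negligible by blast
    show ?thesis
    proof
      fix y :: "(real, 'n) vec" assume "y \<in> box 0 1"
      then obtain c x where c: "c \<in> C" "x \<in> closure (Oc c)" "y = F c x"
        using \<open>U = {}\<close> unfolding U_def by blast
      then have "x \<in> Oc c \<union> B" using closureO by blast
      then show "y \<in> (\<Union>c\<in>C. W c) \<union> G" using c unfolding W_def G_def by blast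
    qed
  qed
  define cell where "cell y = (THE c. c \<in> C \<and> y \<in> W c)" for y
  have cell: "cell y = c" if "c \<in> C" "y \<in> W c" for c y
    unfolding cell_def using that disj by (intro the_equality) blast+
  define s' where "s' y = s (cell y)" for y
  define v' where "v' y = - (s (cell y) * v (cell y))" for y
  define q where "q y = s' y * y + v' y" for y
  have q: "q y = x" if "c \<in> C" "x \<in> Oc c" "y = F c x" for c x y
  proof -
    have "cell y = c" using that by (intro cell) (auto simp: W_def)
    then show ?thesis using F_inv that(3) unfolding q_def s'_def v'_def by metis
  qed
  define V where "V = (\<Union>i. (\<lambda>c. (- (s c * v c)) $ i) ` C)"
  have "finite V" unfolding V_def by (intro finite_UN_I finite_imageI finC) simp
  \<comment> \<open>0 and 1 are treated as thresholds here so that, for two points of one cell of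
    \<open>T'\<close>, the preimage of the second stays in the cube with that of the first.\<close>
  define T' where "T' = shifted_thresholds (T \<union> {0, 1}) V"
  have T': "finite T'" unfolding T'_def by (intro finite_shifted_thresholds \<open>finite V\<close>) (use T in simp)
  define Z where "Z = G \<union> {x. \<exists>i. x $ i \<in> T' \<union> {0}}"
  have Z: "small Z" unfolding Z_def by (intro small_Un small_coords G) (use T' in simp)
  have inW: "\<exists>c\<in>C. \<exists>x\<in>Oc c. y = F c x" if "y \<in> unit_cube" "y \<notin> Z" for y
  proof -
    have "y \<in> box 0 1" using that by (auto simp: Z_def unit_cube_def mem_box_cart order.strict_iff_order)
    then show ?thesis using cover that(2) unfolding Z_def W_def by blast
  qed
  have same_cell: "cell y = cell y'"
    if y: "y \<in> unit_cube" "y \<notin> Z" and y': "y' \<in> unit_cube" "y' \<notin> Z" and eq: "lcell T' y = lcell T' y'" for y y'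
  proof -
    obtain c x where c: "c \<in> C" "x \<in> Oc c" "y = F c x" using inW[OF y] by blast
    have x_eq: "x = s c * y + - (s c * v c)" using c(3) F_inv by metis
    define x' where "x' = s c * y' + - (s c * v c)"
    have th: "(t < x $ i \<longleftrightarrow> t < x' $ i) \<and> x $ i \<noteq> t \<and> x' $ i \<noteq> t" if t: "t \<in> T \<union> {0, 1}" for t i
    proof -
      have V: "(- (s c * v c)) $ i \<in> V" using c(1) by (auto simp: V_def)
      have "y $ i \<notin> T'" "y' $ i \<notin> T'" using y(2) y'(2) by (auto simp: Z_def)
      then show ?thesis
        using affine_threshold[OF s order_refl V t eq[unfolded T'_def], of c]
          affine_threshold[OF s order_refl V t eq[unfolded T'_def, symmetric], of c]
        unfolding x_eq x'_def T'_def by blast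
    qed
    have x: "x \<in> unit_cube" "lcell T x = c" using c(2) by (auto simp: Oc_def)
    have "lcell T x' = lcell T x" unfolding lcell_eq_iff using th by blast
    moreover have "x' \<notin> B" using th by (auto simp: B_def)
    moreover have "x' \<in> unit_cube"
      unfolding unit_cube_def
    proof (intro CollectI allI)
      fix i
      have xi: "0 \<le> x $ i" "x $ i < 1" using x(1) by (auto simp: unit_cube_def)
      have "0 < x' $ i" using th[of 0 i] xi by auto
      moreover have "x' $ i < 1" using th[of 1 i] xi by auto
      ultimately show "0 \<le> x' $ i \<and> x' $ i < 1" by simp
    qed
    ultimately have "x' \<in> Oc c" using x by (simp add: Oc_def)
    then have "y' \<in> W c" using F_inv[of c y' x'] by (auto simp: W_def x'_def)
    then show ?thesis using cell[OF c(1)] c by (auto simp: W_def)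
  qed
  obtain h Z' where h: "h \<in> E_set" and Z': "small Z'"
    and hq: "\<And>x. x \<in> unit_cube \<Longrightarrow> x \<notin> Z' \<Longrightarrow> h x = q x"
  proof (rule E_set_extend[OF T' Z, where q = q and s = s' and v = v'])
    show "sign_vec (s' y)" for y by (simp add: s'_def s)
    show "q y = s' y * y + v' y" for y by (simp add: q_def)
    show "q y \<in> closed_unit_cube" if y: "y \<in> unit_cube" "y \<notin> Z" for y
    proof -
      obtain c x where c: "c \<in> C" "x \<in> Oc c" "y = F c x" using inW[OF y] by blast
      then show ?thesis using q[OF c] by (auto simp: Oc_def unit_cube_def closed_unit_cube_def less_imp_le)
    qed
    show "s' y = s' y' \<and> v' y = v' y'"
      if "y \<in> unit_cube" "y' \<in> unit_cube" "y \<notin> Z" "y' \<notin> Z" "lcell T' y = lcell T' y'" for y y'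
      using same_cell[OF that(1,3,2,4,5)] by (simp add: s'_def v'_def)
  qed (use that in blast)
  have "inj_on h (unit_cube - (Z \<union> Z'))"
  proof (rule inj_onI)
    fix y y' assume y: "y \<in> unit_cube - (Z \<union> Z')" and y': "y' \<in> unit_cube - (Z \<union> Z')" and eq: "h y = h y'"
    obtain c x where c: "c \<in> C" "x \<in> Oc c" "y = F c x" using inW y by blast
    obtain d x' where d: "d \<in> C" "x' \<in> Oc d" "y' = F d x'" using inW y' by blast
    have "q y = q y'" using eq hq y y' by auto
    then have "x = x'" using q[OF c] q[OF d] by simp
    then show "y = y'" using Fx c d by metis
  qed
  moreover have ZZ: "small (Z \<union> Z')" by (intro small_Un Z Z')
  ultimately have hB: "h \<in> RecB_set" using h unfolding RecB_set_def by blast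
  have "h (f x) = x" if x: "x \<in> unit_cube" "x \<notin> B" "f x \<in> unit_cube - (Z \<union> Z')" for x
  proof -
    have "x \<in> Oc (lcell T x)" "lcell T x \<in> C" using x by (simp_all add: Oc_def C_def)
    then show ?thesis using q[of "lcell T x" x "f x"] Fx hq[of "f x"] x(3) by auto
  qed
  moreover have "small (B \<union> {x \<in> unit_cube. f x \<notin> unit_cube - (Z \<union> Z')})"
    by (intro small_Un B E_set_vimage_small' fE ZZ)
  ultimately show ?thesis
    using hB by (intro bexI[of _ h] exI[of _ "B \<union> {x \<in> unit_cube. f x \<notin> unit_cube - (Z \<union> Z')}"]) auto
qed

lemma RecB_set_eqI:
  assumes "f \<in> RecB_set" "g \<in> RecB_set" "negligible S"
    "\<And>x. x \<in> unit_cube \<Longrightarrow> x \<notin> S \<Longrightarrow> f x = g x"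
  shows "f = g"
  using E_set_eqI[of f g S] assms unfolding RecB_set_def by blast

lemma RecB_mult_eqI:
  assumes h: "h \<in> RecB_set" and S: "small S" and eq: "\<And>x. x \<in> unit_cube \<Longrightarrow> x \<notin> S \<Longrightarrow> h x = g (f x)"
  shows "RecB_mult g f = h"
  unfolding RecB_mult_def
proof (rule the_equality)
  show "h \<in> RecB_set \<and> (\<exists>S. small S \<and> (\<forall>x\<in>unit_cube - S. h x = g (f x)))" using assms by blast
  fix h' assume h': "h' \<in> RecB_set \<and> (\<exists>S. small S \<and> (\<forall>x\<in>unit_cube - S. h' x = g (f x)))"
  then obtain S' where S': "small S'" "\<forall>x\<in>unit_cube - S'. h' x = g (f x)" by blast
  have "negligible (S \<union> S')" by (intro small_imp_negligible small_Un S S'(1))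
  then show "h' = h" by (rule RecB_set_eqI[rotated 2]) (use h h' eq S' in auto)
qed

lemma RecB_multD:
  fixes f g :: "real ^ 'n \<Rightarrow> real ^ 'n"
  assumes "f \<in> RecB_set" "g \<in> RecB_set"
  obtains S where "RecB_mult g f \<in> RecB_set" "small S"
    "\<And>x. x \<in> unit_cube \<Longrightarrow> x \<notin> S \<Longrightarrow> RecB_mult g f x = g (f x)"
proof -
  obtain h S where h: "h \<in> RecB_set" "small S" "\<And>x. x \<in> unit_cube \<Longrightarrow> x \<notin> S \<Longrightarrow> h x = g (f x)"
    using RecB_comp_exists[OF assms] by blast
  then have "RecB_mult g f = h" by (rule RecB_mult_eqI)
  then show thesis using that h by metis
qed

lemma id_in_RecB_set: "id \<in> RecB_set"
proof -
  have "(id :: real ^ 'n \<Rightarrow> real ^ 'n) \<in> E_set"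
    by (rule E_set_lcellI[of "{}" "\<lambda>_. 1" _ "\<lambda>_. 0"])
       (auto simp: unit_cube_def closed_unit_cube_def extensional_cube_def less_imp_le)
  then show ?thesis unfolding RecB_set_def by (auto intro!: exI[of _ "{}"])
qed

lemma RecB_vimage_small:
  assumes "f \<in> RecB_set" "small S"
  shows "small {x \<in> unit_cube. f x \<notin> unit_cube - S}"
  using assms E_set_vimage_small' by (auto simp: RecB_set_def)

text \<open>Associativity and inverses reduce, through uniqueness off small sets, to pointwise
  identities. The sort \<open>wellorder\<close> comes from the volume argument for inverses.\<close>

theorem group_RecB: "group (RecB :: (real ^ ('n :: {finite, wellorder}) \<Rightarrow> (real, 'n) vec) monoid)"
proof (rule groupI; unfold RecB_def; simp)
  show "RecB_mult g f \<in> RecB_set" if "g \<in> RecB_set" "f \<in> RecB_set" for f g :: "(real, 'n) vec \<Rightarrow> (real, 'n) vec"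
    by (rule RecB_multD[OF that(2,1)])
  show "id \<in> RecB_set" by (rule id_in_RecB_set)
  show "RecB_mult id f = f" if "f \<in> RecB_set" for f :: "(real, 'n) vec \<Rightarrow> (real, 'n) vec"
    by (rule RecB_mult_eqI[OF that small_empty]) simp
  show "\<exists>h\<in>RecB_set. RecB_mult h f = id" if f: "f \<in> RecB_set" for f :: "(real, 'n) vec \<Rightarrow> (real, 'n) vec"
  proof -
    obtain h S where h: "h \<in> RecB_set" "small S" "\<And>x. x \<in> unit_cube \<Longrightarrow> x \<notin> S \<Longrightarrow> h (f x) = x"
      using RecB_left_inverse_exists[OF f] by blast
    have "RecB_mult h f = id" by (rule RecB_mult_eqI[OF id_in_RecB_set h(2)]) (simp add: h(3))
    then show ?thesis using h(1) by blast
  qed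
  fix f g h :: "(real, 'n) vec \<Rightarrow> (real, 'n) vec"
  assume fgh: "f \<in> RecB_set" "g \<in> RecB_set" "h \<in> RecB_set"
  obtain S1 where S1: "RecB_mult f g \<in> RecB_set" "small S1"
    "\<And>x. x \<in> unit_cube \<Longrightarrow> x \<notin> S1 \<Longrightarrow> RecB_mult f g x = f (g x)"
    using RecB_multD[OF fgh(2,1)] by metis
  obtain S2 where S2: "RecB_mult g h \<in> RecB_set" "small S2"
    "\<And>x. x \<in> unit_cube \<Longrightarrow> x \<notin> S2 \<Longrightarrow> RecB_mult g h x = g (h x)"
    using RecB_multD[OF fgh(3,2)] by metis
  obtain S3 where S3: "RecB_mult f (RecB_mult g h) \<in> RecB_set" "small S3"
    "\<And>x. x \<in> unit_cube \<Longrightarrow> x \<notin> S3 \<Longrightarrow> RecB_mult f (RecB_mult g h) x = f (RecB_mult g h x)"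
    using RecB_multD[OF S2(1) fgh(1)] by metis
  show "RecB_mult (RecB_mult f g) h = RecB_mult f (RecB_mult g h)"
  proof (rule RecB_mult_eqI[OF S3(1)])
    show "small (S2 \<union> S3 \<union> {x \<in> unit_cube. h x \<notin> unit_cube - S1})"
      by (intro small_Un S2 S3 RecB_vimage_small fgh S1)
  qed (use S1(3) S2(3) S3(3) in auto)
qed

text \<open>Partitions are traded for threshold sets: the displacement \<open>f x - x\<close>
  depends only on the cell. Common refinements then become unions of finite sets.\<close>

lemma Rec_set_iff:
  fixes f :: "real ^ 'n \<Rightarrow> real ^ 'n"
  shows "f \<in> Rec_set \<longleftrightarrow> bij_betw f unit_cube unit_cube \<and> extensional_cube f \<and>
    (\<exists>T. finite T \<and> (\<forall>x\<in>unit_cube. \<forall>y\<in>unit_cube. rcell T x = rcell T y \<longrightarrow> f x - x = f y - y))"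
proof (intro iffI conjI; (elim conjE)?)
  assume f: "f \<in> Rec_set"
  then show "bij_betw f unit_cube unit_cube" "extensional_cube f" by (auto simp: Rec_set_def)
  obtain P where P: "rect_partition P" "\<forall>R\<in>P. \<exists>v. \<forall>x\<in>R. f x = x + v" using f by (auto simp: Rec_set_def)
  obtain a b where ab: "\<And>R. R \<in> P \<Longrightarrow> R = rect_co (a R) (b R)"
    using P(1) unfolding rect_partition_def is_rectangle_def by metis
  define T where "T = (\<Union>R\<in>P. \<Union>i. {a R $ i, b R $ i})"
  have finT: "finite T" using P(1) by (auto simp: T_def rect_partition_def)
  show "\<exists>T. finite T \<and> (\<forall>x\<in>unit_cube. \<forall>y\<in>unit_cube. rcell T x = rcell T y \<longrightarrow> f x - x = f y - y)"
  proof (intro exI[of _ T] conjI finT ballI impI)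
    fix x y :: "real ^ 'n" assume "x \<in> unit_cube" "y \<in> unit_cube" and same: "rcell T x = rcell T y"
    then obtain R where R: "R \<in> P" "x \<in> R" using P(1) unfolding rect_partition_def by blast
    have xi: "a R $ i \<le> x $ i" "x $ i < b R $ i" for i
      using R ab[OF R(1)] by (auto simp: rect_co_def)
    have aT: "a R $ i \<in> T" and bT: "b R $ i \<in> T" for i using R(1) by (auto simp: T_def)
    have "a R $ i \<le> x $ i \<longleftrightarrow> a R $ i \<le> y $ i" "b R $ i \<le> x $ i \<longleftrightarrow> b R $ i \<le> y $ i" for i
      using same aT[of i] bT[of i] unfolding rcell_eq_iff by blast+
    then have "a R $ i \<le> y $ i" "\<not> b R $ i \<le> y $ i" for i
      using xi[of i] by (metis not_le)+
    then have "y \<in> R" using ab[OF R(1)] by (auto simp: rect_co_def not_le)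
    then show "f x - x = f y - y" using P(2) R by (metis add_diff_cancel_left')
  qed
next
  assume bij: "bij_betw f unit_cube unit_cube" and ext: "extensional_cube f"
    and "\<exists>T. finite T \<and> (\<forall>x\<in>unit_cube. \<forall>y\<in>unit_cube. rcell T x = rcell T y \<longrightarrow> f x - x = f y - y)"
  then obtain T where T: "finite T"
    and f: "\<And>x y. x \<in> unit_cube \<Longrightarrow> y \<in> unit_cube \<Longrightarrow> rcell T x = rcell T y \<Longrightarrow> f x - x = f y - y" by blast
  define T0 where "T0 = T \<inter> {0<..<1}"
  have T0: "finite T0" "T0 \<subseteq> {0<..<1}" using T by (auto simp: T0_def)
  have rc: "rcell T x = rcell T y"
    if x: "x \<in> unit_cube" and y: "y \<in> unit_cube" and c: "rcell T0 x = rcell T0 y" for x y :: "real ^ 'n"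
    unfolding rcell_eq_iff
  proof (intro allI ballI)
    fix i t assume t: "t \<in> T"
    have "0 \<le> x $ i" "x $ i < 1" "0 \<le> y $ i" "y $ i < 1" using x y by (auto simp: unit_cube_def)
    then show "t \<le> x $ i \<longleftrightarrow> t \<le> y $ i"
      using c t unfolding rcell_eq_iff T0_def by (cases "0 < t"; cases "t < 1") auto
  qed
  have "\<exists>v. \<forall>x\<in>R. f x = x + v" if R: "R \<in> rcell_partition T0" for R
  proof -
    obtain x where x: "x \<in> unit_cube" "R = {y \<in> unit_cube. rcell T0 y = rcell T0 x}"
      using R by (auto simp: rcell_partition_def)
    have "f y = y + (f x - x)" if "y \<in> R" for y
    proof -
      have "f y - y = f x - x" using f rc x that by blast
      then show ?thesis by (simp add: algebra_simps)
    qed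
    then show ?thesis by blast
  qed
  then show "f \<in> Rec_set"
    using bij ext rect_partition_rcells[OF T0] unfolding Rec_set_def by blast
qed

lemma finite_displacements:
  fixes f :: "real ^ 'n \<Rightarrow> real ^ 'n"
  assumes "finite T" and f: "\<And>x y. x \<in> unit_cube \<Longrightarrow> y \<in> unit_cube \<Longrightarrow> rcell T x = rcell T y \<Longrightarrow> f x - x = f y - y"
  shows "finite ((\<lambda>x. f x - x) ` unit_cube)"
proof (rule finite_subset)
  let ?r = "\<lambda>c. SOME x :: real ^ 'n. x \<in> unit_cube \<and> rcell T x = c"
  show "(\<lambda>x. f x - x) ` unit_cube \<subseteq> (\<lambda>c. f (?r c) - ?r c) ` range (rcell T :: real ^ 'n \<Rightarrow> _)"
  proof
    fix v assume "v \<in> (\<lambda>x. f x - x) ` unit_cube"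
    then obtain x where x: "x \<in> unit_cube" "v = f x - x" by blast
    have "?r (rcell T x) \<in> unit_cube \<and> rcell T (?r (rcell T x)) = rcell T x"
      by (rule someI[of _ x]) (use x in simp)
    then have "v = f (?r (rcell T x)) - ?r (rcell T x)" using f[of "?r (rcell T x)" x] x by simp
    then show "v \<in> (\<lambda>c. f (?r c) - ?r c) ` range (rcell T :: real ^ 'n \<Rightarrow> _)" by blast
  qed
qed (intro finite_imageI finite_range_rcell assms(1))

lemma Rec_set_comp:
  fixes f g :: "real ^ 'n \<Rightarrow> real ^ 'n"
  assumes f: "f \<in> Rec_set" and g: "g \<in> Rec_set"
  shows "g \<circ> f \<in> Rec_set"
proof -
  obtain T where T: "finite T"
    and f': "\<And>x y. x \<in> unit_cube \<Longrightarrow> y \<in> unit_cube \<Longrightarrow> rcell T x = rcell T y \<Longrightarrow> f x - x = f y - y"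
    using f unfolding Rec_set_iff by blast
  obtain Tg where Tg: "finite Tg"
    and g': "\<And>x y. x \<in> unit_cube \<Longrightarrow> y \<in> unit_cube \<Longrightarrow> rcell Tg x = rcell Tg y \<Longrightarrow> g x - x = g y - y"
    using g unfolding Rec_set_iff by blast
  have bij: "bij_betw f unit_cube unit_cube" "bij_betw g unit_cube unit_cube"
    and ext: "extensional_cube f" "extensional_cube g" using f g by (auto simp: Rec_set_iff)
  define V where "V = (\<lambda>x. f x - x) ` unit_cube"
  have "finite V" unfolding V_def by (rule finite_displacements[OF T f'])
  define T' where "T' = T \<union> (\<Union>i. \<Union>v\<in>V. (\<lambda>t. t - v $ i) ` Tg)"
  have "(g \<circ> f) x - x = (g \<circ> f) y - y"
    if x: "x \<in> unit_cube" and y: "y \<in> unit_cube" and c: "rcell T' x = rcell T' y" for x y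
  proof -
    have fxy: "f x - x = f y - y" by (rule f'[OF x y]) (use c in \<open>auto simp: rcell_eq_iff T'_def\<close>)
    define v where "v = f x - x"
    have fx: "f x = x + v" "f y = y + v" using fxy by (auto simp: v_def algebra_simps)
    have "v \<in> V" using x by (auto simp: V_def v_def)
    have "rcell Tg (f x) = rcell Tg (f y)"
      unfolding rcell_eq_iff
    proof (intro allI ballI)
      fix i t assume "t \<in> Tg"
      then have "t - v $ i \<in> T'" using \<open>v \<in> V\<close> by (auto simp: T'_def)
      then have "t - v $ i \<le> x $ i \<longleftrightarrow> t - v $ i \<le> y $ i" using c unfolding rcell_eq_iff by blast
      then show "t \<le> f x $ i \<longleftrightarrow> t \<le> f y $ i" by (simp add: fx diff_le_eq)
    qed
    then have "g (f x) - f x = g (f y) - f y" using g' bij(1) x y by (meson bij_betwE)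
    then have "(g (f x) - f x) + v = (g (f y) - f y) + v" by simp
    then show ?thesis by (simp add: fx(1) fx(2) algebra_simps)
  qed
  moreover have "finite T'" using T Tg \<open>finite V\<close> by (simp add: T'_def)
  moreover have "bij_betw (g \<circ> f) unit_cube unit_cube" using bij by (rule bij_betw_trans)
  moreover have "extensional_cube (g \<circ> f)" using ext by (simp add: extensional_cube_def)
  ultimately show ?thesis unfolding Rec_set_iff by blast
qed

lemma Rec_set_inverse:
  fixes f :: "real ^ 'n \<Rightarrow> real ^ 'n"
  assumes f: "f \<in> Rec_set"
  shows "\<exists>g\<in>Rec_set. g \<circ> f = id"
proof -
  obtain T where T: "finite T"
    and f': "\<And>x y. x \<in> unit_cube \<Longrightarrow> y \<in> unit_cube \<Longrightarrow> rcell T x = rcell T y \<Longrightarrow> f x - x = f y - y"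
    using f unfolding Rec_set_iff by blast
  have bij: "bij_betw f unit_cube unit_cube" and ext: "extensional_cube f" using f by (auto simp: Rec_set_iff)
  define V where "V = (\<lambda>x. f x - x) ` unit_cube"
  have "finite V" unfolding V_def by (rule finite_displacements[OF T f'])
  \<comment> \<open>The thresholds 0 and 1 are moved along so that the candidate preimage
    \<open>y' - v\<close> lies in the cube.\<close>
  define T' where "T' = (\<Union>i. \<Union>v\<in>V. (\<lambda>t. t + v $ i) ` (T \<union> {0, 1}))"
  define g where "g y = (if y \<in> unit_cube then the_inv_into unit_cube f y else y)" for y
  have gf: "g (f x) = x" for x
  proof (cases "x \<in> unit_cube")
    case True
    then show ?thesis using bij by (auto simp: g_def bij_betw_def the_inv_into_f_f)
  next
    case False
    then show ?thesis using ext by (simp add: g_def extensional_cube_def)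
  qed
  have "g y - y = g y' - y'"
    if y: "y \<in> unit_cube" and y': "y' \<in> unit_cube" and c: "rcell T' y = rcell T' y'" for y y'
  proof -
    obtain x where x: "x \<in> unit_cube" "y = f x" using y bij unfolding bij_betw_def by blast
    define v where "v = f x - x"
    have "v \<in> V" using x by (auto simp: V_def v_def)
    define z where "z = y' - v"
    have th: "t \<le> z $ i \<longleftrightarrow> t \<le> x $ i" if "t \<in> T \<union> {0, 1}" for t i
    proof -
      have "t + v $ i \<in> T'" using that \<open>v \<in> V\<close> unfolding T'_def by blast
      then have "t + v $ i \<le> y $ i \<longleftrightarrow> t + v $ i \<le> y' $ i" using c unfolding rcell_eq_iff by blast
      then show ?thesis by (simp add: z_def x(2) v_def algebra_simps)
    qed
    have "z \<in> unit_cube"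
      using x(1) th[of 0] th[of 1] unfolding unit_cube_def by (simp add: not_le[symmetric])
    moreover have "rcell T z = rcell T x" using th by (simp add: rcell_eq_iff)
    ultimately have "f z - z = v" using f' x(1) unfolding v_def by blast
    then have "f z = y'" by (simp add: z_def algebra_simps)
    then have "g y' = z" using gf by metis
    then show ?thesis using gf[of x] by (simp add: x(2) z_def v_def)
  qed
  moreover have "finite T'" using T \<open>finite V\<close> by (simp add: T'_def)
  moreover have "bij_betw g unit_cube unit_cube"
    using bij_betw_the_inv_into[OF bij] by (rule iffD1[OF bij_betw_cong, rotated]) (simp add: g_def)
  moreover have "extensional_cube g" by (simp add: g_def extensional_cube_def)
  ultimately have "g \<in> Rec_set" unfolding Rec_set_iff by blast
  moreover have "g \<circ> f = id" using gf by auto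
  ultimately show ?thesis by blast
qed

theorem group_Rec: "group (Rec :: (real ^ 'n \<Rightarrow> real ^ 'n) monoid)"
proof (rule groupI; unfold Rec_def; simp)
  show "(id :: real ^ 'n \<Rightarrow> real ^ 'n) \<in> Rec_set"
    unfolding Rec_set_iff by (auto simp: extensional_cube_def intro: exI[of _ "{}"])
qed (auto simp: Rec_set_comp o_assoc Rec_set_inverse)

section \<open>Flips of the torus\<close>

definition word_prod :: "('a, 'b) monoid_scheme \<Rightarrow> ('l \<Rightarrow> 'a) \<Rightarrow> 'l list \<Rightarrow> 'a" where
  "word_prod G g w = foldr (\<lambda>l h. g l \<otimes>\<^bsub>G\<^esub> h) w \<one>\<^bsub>G\<^esub>"

lemma word_prod_Nil [simp]: "word_prod G g [] = \<one>\<^bsub>G\<^esub>"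
  and word_prod_Cons [simp]: "word_prod G g (l # w) = g l \<otimes>\<^bsub>G\<^esub> word_prod G g w"
  by (simp_all add: word_prod_def)

context group
begin

lemma word_prod_closed: "(\<And>l. g l \<in> carrier G) \<Longrightarrow> word_prod G g w \<in> carrier G"
  by (induction w) auto

lemma word_prod_append:
  "(\<And>l. g l \<in> carrier G) \<Longrightarrow> word_prod G g (w @ w') = word_prod G g w \<otimes> word_prod G g w'"
  by (induction w) (auto simp: word_prod_closed m_assoc)

lemma word_prod_pow:
  assumes "\<And>l. g l \<in> carrier G"
  shows "word_prod G g w [^] n = word_prod G g (concat (replicate n w))"
proof (induction n)
  case (Suc n)
  have "word_prod G g w [^] Suc n = word_prod G g w \<otimes> word_prod G g w [^] n"
    using word_prod_closed[OF assms] by (rule nat_pow_Suc2)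
  then show ?case using Suc by (simp add: word_prod_append[OF assms])
qed simp

text \<open>A generator is its own inverse, so words without inverses exhaust the subgroup; each
  element is thereby tied to a walk.\<close>

lemma generate_involutions:
  assumes g: "\<And>l. g l \<in> carrier G" and inv: "\<And>l. g l \<otimes> g l = \<one>"
  shows "generate G (range g) = range (word_prod G g)"
proof (intro equalityI subsetI)
  fix h assume "h \<in> generate G (range g)"
  then show "h \<in> range (word_prod G g)"
  proof induction
    case one
    show ?case by (rule range_eqI[of _ _ "[]"]) simp
  next
    case (incl h)
    then obtain l where "h = g l" by blast
    then show ?case using g by (intro range_eqI[of _ _ "[l]"]) simp
  next
    case (inv h)
    then obtain l where "h = g l" by blast
    then have "inv h = g l" using assms by (metis inv_equality)
    then show ?case using g by (intro range_eqI[of _ _ "[l]"]) simp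
  next
    case (eng h1 h2)
    then obtain w1 w2 where "h1 = word_prod G g w1" "h2 = word_prod G g w2" by blast
    then show ?case using word_prod_append[of g, OF g] by (intro range_eqI[of _ _ "w1 @ w2"]) simp
  qed
next
  fix h assume "h \<in> range (word_prod G g)"
  then obtain w where "h = word_prod G g w" by blast
  moreover have "word_prod G g w \<in> generate G (range g)"
    by (induction w) (auto intro: generate.intros)
  ultimately show "h \<in> generate G (range g)" by simp
qed

lemma ord_involution:
  assumes "x \<in> carrier G" "x \<otimes> x = \<one>" "x \<noteq> \<one>"
  shows "ord x = 2"
proof -
  have "x [^] (2::nat) = \<one>" using assms by (simp add: numeral_2_eq_2)
  then have "ord x dvd 2" using assms(1) pow_eq_id by blast
  moreover have "ord x \<noteq> 1" using assms ord_eq_1 by blast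
  ultimately show ?thesis using prime_nat_iff two_is_prime_nat by blast
qed

end

lemma UNIV_letter: "UNIV = {GA, GB, GC}"
proof -
  have "l \<in> {GA, GB, GC}" for l by (cases l) auto
  then show ?thesis by blast
qed

lemma octant_type_lt_3: "octant_type x < 3"
  by (simp add: octant_type_def)

text \<open>At each of the types 0, 1, 2 at least one of \<open>GB\<close> and \<open>GC\<close>
  crosses, so every edge to the right can be traversed; this is the source of infinite
  orbits.\<close>

lemma walk_reaches:
  assumes "\<And>n. u n < 3"
  shows "\<exists>w. walk u w 0 = int k"
proof (induction k)
  case 0
  show ?case by (rule exI[of _ "[]"]) simp
next
  case (Suc k)
  then obtain w where w: "walk u w 0 = int k" by blast
  show ?case
  proof (cases "even k")
    case True
    have "moves GB (u (int k div 2)) \<or> moves GC (u (int k div 2))"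
      using assms[of "int k div 2"] by (auto simp: moves_def)
    then show ?thesis
    proof
      assume "moves GB (u (int k div 2))"
      then show ?thesis using w True by (intro exI[of _ "GB # w"]) (simp add: step_def)
    next
      assume "moves GC (u (int k div 2))"
      then show ?thesis using w True by (intro exI[of _ "GC # w"]) (simp add: step_def)
    qed
  next
    case False
    then show ?thesis using w by (intro exI[of _ "GA # w"]) (simp add: step_def)
  qed
qed

section \<open>The action on the torus and its orbits as labelled lines\<close>

definition vec_frac :: "real ^ 'n \<Rightarrow> real ^ 'n" where
  "vec_frac x = (\<chi> i. frac (x $ i))"

lemma vec_frac_component [simp]: "vec_frac x $ i = frac (x $ i)"
  by (simp add: vec_frac_def)

lemma vec_frac_in_unit_cube [simp]: "vec_frac x \<in> unit_cube"
  by (simp add: unit_cube_def frac_lt_1)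

lemma vec_frac_id: "x \<in> unit_cube \<Longrightarrow> vec_frac x = x"
  by (simp add: vec_eq_iff unit_cube_def frac_eq)

lemma frac_eq_iff: "frac a = frac b \<longleftrightarrow> a - b \<in> \<int>" for a b :: real
proof
  assume "frac a = frac b"
  then have "a - b = of_int (\<lfloor>a\<rfloor> - \<lfloor>b\<rfloor>)" by (simp add: frac_def)
  then show "a - b \<in> \<int>" by (metis Ints_of_int)
next
  assume "a - b \<in> \<int>"
  then obtain m :: int where "a - b = of_int m" by (rule Ints_cases)
  then have "a = b + of_int m" by simp
  then show "frac a = frac b" by (simp add: frac_def)
qed

lemma vec_frac_diff_frac: "vec_frac (a - vec_frac b) = vec_frac (a - b)"
  and vec_frac_add_frac: "vec_frac (vec_frac b + a) = vec_frac (b + a)"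
  and vec_frac_frac_diff: "vec_frac (vec_frac b - a) = vec_frac (b - a)"
  by (simp_all add: vec_eq_iff frac_eq_iff) (simp_all add: frac_def)

lemma vec_frac_minus_frac: "vec_frac (- vec_frac b) = vec_frac (- b)"
  using vec_frac_diff_frac[of 0 b] by simp

lemma octant_type_vec_frac [simp]: "octant_type (vec_frac x) = octant_type x"
  by (rule octant_type_cong) (simp add: low_half_def)

text \<open>Working formulas for the cube. They need not be left-continuous on the walls of the
  octants, nor the identity outside the cube, so the generators are only required to agree with them
  off small sets.\<close>

fun flip_map :: "letter \<Rightarrow> real ^ 3 \<Rightarrow> real ^ 3" where
  "flip_map GA x = vec_frac (rot - x)"
| "flip_map GB x = (if moves GB (octant_type x) then vec_frac (- x) else x)"
| "flip_map GC x = (if moves GC (octant_type x) then vec_frac (- x) else x)"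

lemma flip_map_fragment:
  "l \<noteq> GA \<Longrightarrow> flip_map l x = (if moves l (octant_type x) then vec_frac (- x) else x)"
  by (cases l) auto

definition flip_track :: "real ^ 3 \<Rightarrow> int \<Rightarrow> real ^ 3" where
  "flip_track y k = (if even k then vec_frac (y + of_int (k div 2) *\<^sub>R rot)
     else vec_frac (- (y + of_int (k div 2) *\<^sub>R rot)))"

text \<open>For even \<open>n\<close> the condition puts coordinate \<open>i\<close> of
  \<open>x + (n / 2) \<alpha>\<close> on a wall 0 or 1/2; in general it makes coordinate
  \<open>i\<close> of \<open>x + m \<alpha>\<close> and of \<open>- (x + l \<alpha>)\<close>
  coincide modulo 1 whenever \<open>m + l = n\<close>. Off this countable union of hyperplanes an
  orbit never meets a wall and forms a proper line.\<close>

definition resonant :: "(real ^ 3) set" where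
  "resonant = {x. \<exists>i. \<exists>n :: int. 2 * x $ i + of_int n * rot $ i \<in> \<int>}"

lemma negligible_resonant: "negligible resonant"
proof -
  have "resonant \<subseteq> (\<Union>(i, n, m) \<in> (UNIV :: (3 \<times> int \<times> int) set). {x. x $ i = (of_int m - of_int n * rot $ i) / 2})"
  proof
    fix x assume "x \<in> resonant"
    then obtain i and n :: int where "2 * x $ i + of_int n * rot $ i \<in> \<int>" unfolding resonant_def by blast
    then obtain m :: int where "2 * x $ i + of_int n * rot $ i = of_int m" by (rule Ints_cases)
    then have "x $ i = (of_int m - of_int n * rot $ i) / 2" by simp
    then show "x \<in> (\<Union>(i, n, m) \<in> (UNIV :: (3 \<times> int \<times> int) set). {x. x $ i = (of_int m - of_int n * rot $ i) / 2})"
      by blast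
  qed
  moreover have "negligible (\<Union>(i, n, m) \<in> (UNIV :: (3 \<times> int \<times> int) set). {x :: real ^ 3. x $ i = (of_int m - of_int n * rot $ i) / 2})"
  proof (rule negligible_countable_Union)
    fix S assume "S \<in> (\<lambda>(i, n, m). {x :: real ^ 3. x $ i = (of_int m - of_int n * rot $ i) / 2}) ` (UNIV :: (3 \<times> int \<times> int) set)"
    then obtain i r where "S = {x :: real ^ 3. x $ i = r}" by fast
    then show "negligible S" using small_imp_negligible small_coord by metis
  qed simp
  ultimately show ?thesis by (rule negligible_subset[rotated])
qed

lemma resonantI: "2 * x $ i + of_int n * rot $ i \<in> \<int> \<Longrightarrow> x \<in> resonant"
  unfolding resonant_def by blast

text \<open>Odd positions carry \<open>- z\<close> where even ones carry \<open>z\<close>, and off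
  the walls both have the same octant type, as the shared label \<open>rot_type y n\<close>
  demands.\<close>

lemma flip_map_track:
  assumes y: "y \<notin> resonant"
  shows "flip_map l (flip_track y k) = flip_track y (step (rot_type y) l k)"
proof -
  define n where "n = k div 2"
  define z where "z = y + of_int n *\<^sub>R rot"
  have u: "rot_type y n = octant_type z" by (simp add: rot_type_def z_def)
  have "2 * z $ i \<notin> \<int>" for i
    using y resonantI[of y i "2 * n"] by (auto simp: z_def algebra_simps)
  then have tm: "octant_type (- z) = octant_type z" by (rule octant_type_minus)
  show ?thesis
  proof (cases "even k")
    case True
    then have k: "k = 2 * n" by (simp add: n_def)
    have tr: "flip_track y k = vec_frac z" "flip_track y (k + 1) = vec_frac (- z)"
      "flip_track y (k - 1) = vec_frac (rot - z)"
    proof -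
      have d: "(n * 2 - 1) div 2 = n - 1" by presburger
      show "flip_track y k = vec_frac z" "flip_track y (k + 1) = vec_frac (- z)"
        by (simp_all add: flip_track_def k z_def)
      show "flip_track y (k - 1) = vec_frac (rot - z)"
        by (simp add: flip_track_def k z_def mult.commute[of 2 n] d) (simp add: algebra_simps)
    qed
    show ?thesis
    proof (cases "l = GA")
      case True
      then show ?thesis using \<open>even k\<close> by (simp add: step_def tr vec_frac_diff_frac)
    next
      case False
      then show ?thesis
        using \<open>even k\<close> by (simp add: flip_map_fragment step_def tr u[symmetric] vec_frac_minus_frac flip: n_def)
    qed
  next
    case False
    then have k: "k = 2 * n + 1" by (simp add: n_def)
    have tr: "flip_track y k = vec_frac (- z)" "flip_track y (k - 1) = vec_frac z"
      "flip_track y (k + 1) = vec_frac (rot + z)"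
      by (simp_all add: flip_track_def k z_def algebra_simps)
    show ?thesis
    proof (cases "l = GA")
      case True
      then show ?thesis using \<open>odd k\<close> by (simp add: step_def tr vec_frac_diff_frac)
    next
      case False
      then show ?thesis
        using \<open>odd k\<close> by (simp add: flip_map_fragment step_def tr tm u[symmetric] vec_frac_minus_frac flip: n_def)
    qed
  qed
qed

lemma foldr_flip_map_track:
  "y \<notin> resonant \<Longrightarrow> foldr flip_map w (flip_track y k) = flip_track y (walk (rot_type y) w k)"
  by (induction w) (simp_all add: flip_map_track)

lemma flip_track_0: "y \<in> unit_cube \<Longrightarrow> flip_track y 0 = y"
  by (simp add: flip_track_def vec_frac_id)

text \<open>Distinct positions of equal parity could coincide only if a nonzero multiple of
  \<open>rot $ 1\<close> were integral, positions of opposite parity only at a resonance. The first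
  coordinate alone decides.\<close>

lemma flip_track_inject:
  assumes y: "y \<notin> resonant" and eq: "flip_track y k = flip_track y l"
  shows "k = l"
proof -
  define m n where "m = k div 2" and "n = l div 2"
  have "flip_track y k $ 1 = flip_track y l $ 1" using eq by simp
  then have *: "(if even k then 1 else - 1) * (y $ 1 + of_int m * rot $ 1) -
      (if even l then 1 else - 1) * (y $ 1 + of_int n * rot $ 1) \<in> \<int>"
    by (auto simp: flip_track_def frac_eq_iff m_def n_def split: if_splits)
  have neg: "- a \<in> \<int> \<Longrightarrow> a \<in> \<int>" for a :: real using Ints_minus[of "- a"] by simp
  show ?thesis
  proof (cases "even k = even l")
    case True
    have "of_int (m - n) * rot $ 1 \<in> \<int>"
    proof (cases "even k")
      case True
      then show ?thesis using * \<open>even k = even l\<close> by (simp add: left_diff_distrib)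
    next
      case False
      then have "- (of_int (m - n) * rot $ 1) \<in> \<int>" using * \<open>even k = even l\<close> by (simp add: algebra_simps)
      then show ?thesis by (rule neg)
    qed
    then have "m - n = 0" by (rule rot_multiple_not_int)
    then show ?thesis using True unfolding m_def n_def by (metis eq_iff_diff_eq_0 dvd_mult_div_cancel odd_two_times_div_two_succ)
  next
    case False
    have "2 * y $ 1 + of_int (m + n) * rot $ 1 \<in> \<int>"
    proof (cases "even k")
      case True
      then show ?thesis using * False by (simp add: algebra_simps)
    next
      case False
      then have "- (2 * y $ 1 + of_int (m + n) * rot $ 1) \<in> \<int>"
        using * \<open>even k \<noteq> even l\<close> by (simp add: algebra_simps)
      then show ?thesis by (rule neg)
    qed
    then show ?thesis using resonantI y by blast
  qed
qed

lemma flip_map_involution: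
  assumes x: "x \<in> unit_cube" "\<And>i. x $ i \<notin> {0, 1 / 2}"
  shows "flip_map l (flip_map l x) = x"
proof (cases "l = GA")
  case True
  then show ?thesis using x(1) by (simp add: vec_frac_diff_frac vec_frac_id)
next
  case False
  have "2 * x $ i \<notin> \<int>" for i
  proof
    assume "2 * x $ i \<in> \<int>"
    then obtain m :: int where m: "2 * x $ i = of_int m" by (rule Ints_cases)
    have "0 \<le> x $ i" "x $ i < 1" using x(1) by (auto simp: unit_cube_def)
    then have "m = 0 \<or> m = 1" using m by linarith
    then show False using x(2)[of i] m by auto
  qed
  then have "octant_type (- x) = octant_type x" by (rule octant_type_minus)
  then show ?thesis using x(1) False by (simp add: flip_map_fragment vec_frac_minus_frac vec_frac_id)
qed

lemma flip_map_in_E_set: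
  "\<exists>h\<in>E_set. \<exists>Z. small Z \<and> (\<forall>x\<in>unit_cube - Z. h x = flip_map l x)"
proof (cases "l = GA")
  case True
  \<comment> \<open>\<open>frac (rot $ i - x $ i)\<close> wraps exactly for \<open>x $ i\<close>
    beyond \<open>rot $ i\<close>, so the coordinates of \<open>rot\<close> are the thresholds of
    \<open>GA\<close>.\<close>
  define v :: "real ^ 3 \<Rightarrow> real ^ 3" where "v x = (\<chi> i. rot $ i + (if rot $ i < x $ i then 1 else 0))" for x
  obtain h Z where h: "h \<in> E_set" "small Z" "\<And>x. x \<in> unit_cube \<Longrightarrow> x \<notin> Z \<Longrightarrow> h x = flip_map l x"
  proof (rule E_set_extend[of "range (($) rot)" "{}" "\<lambda>_. - 1" "flip_map l" v])
    show "flip_map l x = - 1 * x + v x" if x: "x \<in> unit_cube" for x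
    proof -
      have "frac (rot $ i - x $ i) = v x $ i - x $ i" for i
      proof -
        have "0 \<le> x $ i" "x $ i < 1" using x by (auto simp: unit_cube_def)
        then show ?thesis
          using rot_bounds[of i] by (subst frac_unique_iff) (auto simp: v_def)
      qed
      then show ?thesis using True by (simp add: vec_eq_iff)
    qed
    show "flip_map l x \<in> closed_unit_cube" for x
      using True by (simp add: closed_unit_cube_def frac_lt_1 less_imp_le)
    show "- 1 = - (1 :: real ^ 3) \<and> v x = v y" if "lcell (range (($) rot)) x = lcell (range (($) rot)) y" for x y
      using that unfolding lcell_eq_iff v_def by simp
  qed auto
  then show ?thesis by blast
next
  case False
  define Z where "Z = {x :: real ^ 3. \<exists>i. x $ i \<in> {0, 1 / 2}}"
  have Z: "small Z" unfolding Z_def by (intro small_coords) simp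
  define M where "M x \<longleftrightarrow> moves l (octant_type x)" for x
  obtain h Z' where h: "h \<in> E_set" "small Z'" "\<And>x. x \<in> unit_cube \<Longrightarrow> x \<notin> Z' \<Longrightarrow> h x = flip_map l x"
  proof (rule E_set_extend[of "{1 / 2}" Z "\<lambda>x. if M x then - 1 else 1" "flip_map l" "\<lambda>x. if M x then 1 else 0"])
    show "flip_map l x = (if M x then - 1 else 1) * x + (if M x then 1 else 0)"
      if x: "x \<in> unit_cube" "x \<notin> Z" for x
    proof -
      have "frac (- x $ i) = 1 - x $ i" for i
      proof -
        have "0 \<le> x $ i" "x $ i < 1" "x $ i \<noteq> 0" using x by (auto simp: unit_cube_def Z_def)
        then show ?thesis by (subst frac_unique_iff) auto
      qed
      then show ?thesis using False by (simp add: flip_map_fragment M_def vec_eq_iff)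
    qed
    show "flip_map l x \<in> closed_unit_cube" if "x \<in> unit_cube" for x
      using False that by (auto simp: flip_map_fragment closed_unit_cube_def unit_cube_def frac_lt_1 less_imp_le)
    show "(if M x then - 1 else 1) = (if M y then - 1 else (1 :: real ^ 3)) \<and>
        (if M x then 1 else 0) = (if M y then 1 else (0 :: real ^ 3))"
      if x: "x \<in> unit_cube" "x \<notin> Z" and y: "y \<in> unit_cube" "y \<notin> Z"
        and c: "lcell {1 / 2} x = lcell {1 / 2} y" for x y
    proof -
      have "low_half (x $ i) = low_half (y $ i)" for i
      proof -
        have "frac (x $ i) = x $ i" "frac (y $ i) = y $ i"
          using x y by (auto simp: unit_cube_def frac_eq)
        moreover have "x $ i \<noteq> 1 / 2" "y $ i \<noteq> 1 / 2" using x y by (auto simp: Z_def)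
        moreover have "1 / 2 < x $ i \<longleftrightarrow> 1 / 2 < y $ i" using c by (simp add: lcell_eq_iff)
        ultimately show ?thesis unfolding low_half_def by linarith
      qed
      then have "M x = M y" unfolding M_def by (simp add: octant_type_cong[of x y])
      then show ?thesis by simp
    qed
  qed (use Z in auto)
  then show ?thesis by blast
qed

lemma flip_map_in_RecB_set:
  "\<exists>h\<in>RecB_set. \<exists>Z. small Z \<and> (\<forall>x\<in>unit_cube - Z. h x = flip_map l x)"
proof -
  obtain h Z where h: "h \<in> E_set" and Z: "small Z" and hq: "\<And>x. x \<in> unit_cube - Z \<Longrightarrow> h x = flip_map l x"
    using flip_map_in_E_set by metis
  define S where "S = Z \<union> {x :: real ^ 3. \<exists>i. x $ i \<in> {0, 1 / 2}}"
  have "small S" unfolding S_def by (intro small_Un Z small_coords) simp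
  moreover have "inj_on h (unit_cube - S)"
  proof (rule inj_onI)
    fix x y assume x: "x \<in> unit_cube - S" and y: "y \<in> unit_cube - S" and "h x = h y"
    then have "flip_map l (flip_map l x) = flip_map l (flip_map l y)" using hq by (simp add: S_def)
    moreover have "flip_map l (flip_map l x) = x" by (rule flip_map_involution) (use x in \<open>auto simp: S_def\<close>)
    moreover have "flip_map l (flip_map l y) = y" by (rule flip_map_involution) (use y in \<open>auto simp: S_def\<close>)
    ultimately show "x = y" by simp
  qed
  ultimately have "h \<in> RecB_set" using h unfolding RecB_set_def by blast
  then show ?thesis using Z hq by blast
qed

lemma not_resonant_of_type:
  assumes S: "negligible S" and t: "t < 3"
  obtains x where "x \<in> unit_cube" "x \<notin> S" "x \<notin> resonant" "octant_type x = t"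
proof -
  \<comment> \<open>The centre of an octant of type \<open>t\<close>; a generic point of the same
    cell inherits the type.\<close>
  define x0 :: "real ^ 3" where "x0 = vector [1 / 4, if t = 2 then 3 / 4 else 1 / 4, if t = 1 then 3 / 4 else 1 / 4]"
  have x0: "x0 $ 1 = 1 / 4" "x0 $ 2 = (if t = 2 then 3 / 4 else 1 / 4)" "x0 $ 3 = (if t = 1 then 3 / 4 else 1 / 4)"
    by (simp_all add: x0_def vector_3)
  have x0c: "x0 \<in> unit_cube" unfolding unit_cube_def by (auto simp: forall_3 x0)
  have "negligible (S \<union> resonant)" using S negligible_resonant by (rule negligible_Un)
  then obtain x where x: "x \<in> unit_cube" "x \<notin> S \<union> resonant" "lcell {1 / 2} x = lcell {1 / 2} x0"
    using lcell_dense[OF x0c, of "{1 / 2}" "S \<union> resonant" 1] by auto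
  have lo: "low_half (x $ i) \<longleftrightarrow> x0 $ i < 1 / 2" for i
  proof -
    have "2 * x $ i \<notin> \<int>" using x(2) resonantI[of x i 0] by auto
    then have "x $ i \<noteq> 1 / 2" by (metis Ints_1 nonzero_mult_div_cancel_left times_divide_eq_right mult_1_right zero_neq_numeral)
    moreover have "frac (x $ i) = x $ i" using x(1) by (simp add: unit_cube_def frac_eq)
    moreover have "1 / 2 < x $ i \<longleftrightarrow> 1 / 2 < x0 $ i" using x(3) by (simp add: lcell_eq_iff)
    moreover have "x0 $ i \<noteq> 1 / 2" using exhaust_3[of i] x0 by (auto split: if_splits)
    ultimately show ?thesis unfolding low_half_def by linarith
  qed
  have "octant_type x = t" unfolding octant_type_def lo x0 using t by auto
  then show thesis using that x by blast
qed

theorem RecB_torsion_group: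
  obtains g :: "letter \<Rightarrow> real ^ 3 \<Rightarrow> real ^ 3" where "\<And>l. g l \<in> carrier RecB" "inj g"
    "\<And>l. group.ord RecB (g l) = 2" "infinite (generate RecB (range g))" "torsion_set RecB (generate RecB (range g))"
proof -
  interpret group "RecB :: (real ^ 3 \<Rightarrow> real ^ 3) monoid" by (rule group_RecB)
  have carr [simp]: "carrier RecB = RecB_set" and mult [simp]: "(\<otimes>\<^bsub>RecB\<^esub>) = RecB_mult"
    and one [simp]: "\<one>\<^bsub>RecB\<^esub> = id"
    by (simp_all add: RecB_def)
  obtain g Z where g: "\<And>l. g l \<in> RecB_set" and Z: "\<And>l. small (Z l)"
    and gZ: "\<And>l x. x \<in> unit_cube - Z l \<Longrightarrow> g l x = flip_map l x"
    using flip_map_in_RecB_set by metis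
  have g': "\<And>l. g l \<in> carrier RecB" using g by simp
  have inv: "RecB_mult (g l) (g l) = id" for l
  proof (rule RecB_mult_eqI[OF id_in_RecB_set])
    show "small (Z l \<union> {x. \<exists>i. x $ i \<in> {0, 1 / 2}} \<union> {x \<in> unit_cube. g l x \<notin> unit_cube - Z l})"
      by (intro small_Un Z small_coords RecB_vimage_small g) simp
    fix x assume x: "x \<in> unit_cube" "x \<notin> Z l \<union> {x. \<exists>i. x $ i \<in> {0, 1 / 2}} \<union> {x \<in> unit_cube. g l x \<notin> unit_cube - Z l}"
    then have "g l (g l x) = flip_map l (flip_map l x)" using gZ[of x l] gZ[of "g l x" l] by auto
    also have "\<dots> = x" by (rule flip_map_involution) (use x in auto)
    finally show "id x = g l (g l x)" by simp
  qed
  have "\<exists>S. word_prod RecB g w \<in> RecB_set \<and> small S \<and> (\<forall>x\<in>unit_cube - S. word_prod RecB g w x = foldr flip_map w x)" for w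
  proof (induction w)
    case Nil
    show ?case
      by (intro exI[of _ "{}"] conjI ballI) (simp_all only: word_prod_Nil one id_in_RecB_set small_empty foldr.simps)
  next
    case (Cons l w)
    then obtain S where S: "word_prod RecB g w \<in> RecB_set" "small S"
      "\<And>x. x \<in> unit_cube - S \<Longrightarrow> word_prod RecB g w x = foldr flip_map w x" by blast
    obtain S' where S': "RecB_mult (g l) (word_prod RecB g w) \<in> RecB_set" "small S'"
      "\<And>x. x \<in> unit_cube \<Longrightarrow> x \<notin> S' \<Longrightarrow> RecB_mult (g l) (word_prod RecB g w) x = g l (word_prod RecB g w x)"
      using RecB_multD[OF S(1) g] by metis
    let ?S = "S \<union> S' \<union> {x \<in> unit_cube. word_prod RecB g w x \<notin> unit_cube - Z l}"
    show ?case
    proof (intro exI[of _ ?S] conjI ballI)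
      show "small ?S" by (intro small_Un S S' RecB_vimage_small Z)
      fix x assume x: "x \<in> unit_cube - ?S"
      then have "word_prod RecB g (l # w) x = g l (word_prod RecB g w x)" using S'(3) by simp
      also have "\<dots> = flip_map l (word_prod RecB g w x)" by (rule gZ) (use x in auto)
      finally show "word_prod RecB g (l # w) x = foldr flip_map (l # w) x" using S(3) x by simp
    qed (use S' in simp)
  qed
  then obtain S where wB: "\<And>w. word_prod RecB g w \<in> RecB_set" and S: "\<And>w. small (S w)"
    and wS: "\<And>w x. x \<in> unit_cube - S w \<Longrightarrow> word_prod RecB g w x = foldr flip_map w x"
    by metis
  have gen: "generate RecB (range g) = range (word_prod RecB g)"
    by (rule generate_involutions) (use g inv in auto)
  \<comment> \<open>One null set absorbs the exceptional sets of all words, of which there are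
    countably many. At a nonresonant point outside it every group element acts as its walk.\<close>
  define B where "B = (\<Union>w. S w) \<union> (\<Union>l. Z l)"
  have "negligible B" unfolding B_def
  proof (intro negligible_Un negligible_countable_Union)
    have "countable (UNIV :: letter list set)"
    proof -
      have "finite (UNIV :: letter set)" by (simp add: UNIV_letter)
      then have "countable (lists (UNIV :: letter set))" by (intro countable_lists countable_finite)
      then show ?thesis by simp
    qed
    then show "countable (range S)" by simp
    have "finite (UNIV :: letter set)" by (simp add: UNIV_letter)
    then show "countable (range Z)" by (intro countable_finite finite_imageI)
  qed (use S Z small_imp_negligible in auto)
  have tr: "word_prod RecB g w x = flip_track x (walk (rot_type x) w 0)"
    if x: "x \<in> unit_cube" "x \<notin> S w" "x \<notin> resonant" for x w
    using wS[of x w] x foldr_flip_map_track[OF x(3), of w 0] by (simp add: flip_track_0)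
  have gtr: "g l x = flip_track x (step (rot_type x) l 0)"
    if x: "x \<in> unit_cube" "x \<notin> Z l" "x \<notin> resonant" for x l
    using gZ[of x l] x flip_map_track[OF x(3), of l 0] by (simp add: flip_track_0)
  have torsion: "torsion_set RecB (generate RecB (range g))"
    unfolding torsion_set_def gen
  proof
    fix h assume "h \<in> range (word_prod RecB g)"
    then obtain w where h: "h = word_prod RecB g w" by blast
    obtain N where N: "N > 0" "\<And>y k. (walk (rot_type y) w ^^ N) k = k"
      using rot_walk_torsion by metis
    define W where "W = concat (replicate N w)"
    have "word_prod RecB g W = id"
    proof (rule RecB_set_eqI[OF wB id_in_RecB_set])
      show "negligible (S W \<union> resonant)" by (intro negligible_Un small_imp_negligible S negligible_resonant)
      show "word_prod RecB g W x = id x" if "x \<in> unit_cube" "x \<notin> S W \<union> resonant" for x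
        using tr[of x W] that N(2)[of x 0] walk_funpow[of N "rot_type x" w 0] by (simp add: W_def flip_track_0)
    qed
    then have "h [^]\<^bsub>RecB\<^esub> N = \<one>\<^bsub>RecB\<^esub>" using word_prod_pow[of g w N] g by (simp add: h W_def)
    then show "\<exists>n::nat. 0 < n \<and> h [^]\<^bsub>RecB\<^esub> n = \<one>\<^bsub>RecB\<^esub>" using N(1) by blast
  qed
  have u0: "rot_type x 0 = octant_type x" for x by (simp add: rot_type_def)
  obtain x1 where x1: "x1 \<in> unit_cube" "x1 \<notin> B" "x1 \<notin> resonant" "octant_type x1 = 1"
    using not_resonant_of_type[OF \<open>negligible B\<close>, of 1] by auto
  obtain x2 where x2: "x2 \<in> unit_cube" "x2 \<notin> B" "x2 \<notin> resonant" "octant_type x2 = 2"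
    using not_resonant_of_type[OF \<open>negligible B\<close>, of 2] by auto
  \<comment> \<open>The images of position 0 under the letters. The point of type 1 tells the three
    letters apart, but \<open>GB\<close> fixes it; the point of type 2 shows that \<open>GB\<close>
    is not the identity.\<close>
  define c1 c2 :: "letter \<Rightarrow> int" where
    "c1 l = (if l = GA then - 1 else if l = GB then 0 else 1)" and
    "c2 l = (if l = GA then - 1 else if l = GB then 1 else 0)" for l
  have g1: "g l x1 = flip_track x1 (c1 l)" for l
    using gtr[of x1 l] x1 by (cases l) (auto simp: B_def step_def u0 moves_def c1_def)
  have g2: "g l x2 = flip_track x2 (c2 l)" for l
    using gtr[of x2 l] x2 by (cases l) (auto simp: B_def step_def u0 moves_def c2_def)
  have "inj g"
  proof (rule injI)
    fix l l' assume "g l = g l'"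
    then have "c1 l = c1 l'" using g1[of l] g1[of l'] by (intro flip_track_inject[OF x1(3)]) simp
    then show "l = l'" by (cases l; cases l') (auto simp: c1_def)
  qed
  have "g l \<noteq> id" for l
  proof
    assume "g l = id"
    then have "flip_track x1 (c1 l) = flip_track x1 0" "flip_track x2 (c2 l) = flip_track x2 0"
      using g1[of l] g2[of l] x1(1) x2(1) by (simp_all add: flip_track_0)
    then have "c1 l = 0" "c2 l = 0"
      using flip_track_inject[OF x1(3)] flip_track_inject[OF x2(3)] by blast+
    then show False by (cases l) (auto simp: c1_def c2_def)
  qed
  then have "ord (g l) = 2" for l using g inv by (intro ord_involution) auto
  moreover have "infinite (generate RecB (range g))"
  proof
    assume "finite (generate RecB (range g))"
    then have fin: "finite ((\<lambda>h. h x1) ` generate RecB (range g))" by (rule finite_imageI)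
    have "inj (\<lambda>k. flip_track x1 (int k))" by (rule injI) (use flip_track_inject[OF x1(3)] in force)
    then have "infinite (range (\<lambda>k. flip_track x1 (int k)))" by (rule range_inj_infinite)
    moreover have "range (\<lambda>k. flip_track x1 (int k)) \<subseteq> (\<lambda>h. h x1) ` generate RecB (range g)"
    proof
      fix y assume "y \<in> range (\<lambda>k. flip_track x1 (int k))"
      then obtain k where y: "y = flip_track x1 (int k)" by blast
      obtain w where "walk (rot_type x1) w 0 = int k"
        using walk_reaches[of "rot_type x1" k] octant_type_lt_3 unfolding rot_type_def by metis
      then have "y = word_prod RecB g w x1" using tr[of x1 w] x1 y by (auto simp: B_def)
      then show "y \<in> (\<lambda>h. h x1) ` generate RecB (range g)" unfolding gen by blast
    qed
    ultimately show False using fin finite_subset by blast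
  qed
  ultimately show thesis using that g' \<open>inj g\<close> torsion by blast
qed

section \<open>The orientation double cover\<close>

text \<open>The orientation double cover of the torus, realised in the cube by halving the first
  coordinate; on it the flips become translations.\<close>

definition cover_point :: "real ^ 3 \<Rightarrow> bool \<Rightarrow> real ^ 3" where
  "cover_point y b = (\<chi> i. if i = 1 then (y $ 1 + of_bool b) / 2 else y $ i)"

definition cover_base :: "real ^ 3 \<Rightarrow> real ^ 3" where
  "cover_base x = (\<chi> i. if i = 1 then frac (2 * x $ 1) else x $ i)"

definition cover_sheet :: "real ^ 3 \<Rightarrow> bool" where
  "cover_sheet x \<longleftrightarrow> 1 / 2 \<le> x $ 1"

lemma cover_base_point: "y \<in> unit_cube \<Longrightarrow> cover_base (cover_point y b) = y"
proof -
  assume "y \<in> unit_cube"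
  then have "0 \<le> y $ 1" "y $ 1 < 1" by (auto simp: unit_cube_def)
  then have "frac (y $ 1 + of_bool b) = y $ 1" by (cases b) (subst frac_unique_iff, auto)+
  moreover have "2 * ((y $ 1 + of_bool b) / 2) = y $ 1 + of_bool b" by simp
  ultimately have "cover_base (cover_point y b) $ i = y $ i" for i
    by (cases "i = 1") (simp_all only: cover_base_def cover_point_def vec_lambda_beta if_True if_False simp_thms)
  then show ?thesis by (simp add: vec_eq_iff)
qed

lemma cover_sheet_point: "y \<in> unit_cube \<Longrightarrow> cover_sheet (cover_point y b) \<longleftrightarrow> b"
  by (cases b) (auto simp: cover_sheet_def cover_point_def unit_cube_def not_le)

lemma cover_point_in_unit_cube: "y \<in> unit_cube \<Longrightarrow> cover_point y b \<in> unit_cube"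
proof -
  assume y: "y \<in> unit_cube"
  then have "0 \<le> y $ 1" "y $ 1 < 1" by (auto simp: unit_cube_def)
  then have "0 \<le> (y $ 1 + of_bool b) / 2 \<and> (y $ 1 + of_bool b) / 2 < 1" by (cases b) auto
  then show ?thesis using y unfolding cover_point_def unit_cube_def by simp
qed

lemma cover_base_in_unit_cube: "x \<in> unit_cube \<Longrightarrow> cover_base x \<in> unit_cube"
  by (auto simp: cover_base_def unit_cube_def frac_lt_1)

lemma frac_double:
  assumes "x \<in> unit_cube"
  shows "frac (2 * x $ 1) = 2 * x $ 1 - of_bool (cover_sheet x)"
proof -
  have "0 \<le> x $ 1" "x $ 1 < 1" using assms by (auto simp: unit_cube_def)
  then show ?thesis by (subst frac_unique_iff) (auto simp: cover_sheet_def)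
qed

lemma cover_point_base: "x \<in> unit_cube \<Longrightarrow> cover_point (cover_base x) (cover_sheet x) = x"
  by (simp add: cover_base_def cover_point_def vec_eq_iff frac_double)

text \<open>\<open>cover_point z b\<close> stands for \<open>z\<close>, or for \<open>- z\<close>
  with reversed orientation if \<open>b\<close> holds. In these coordinates
  \<open>x \<mapsto> - x\<close> merely changes the sheet, and
  \<open>x \<mapsto> \<alpha> - x\<close> changes the sheet and moves \<open>z\<close> by
  \<open>- \<alpha>\<close> or \<open>\<alpha>\<close>; both are piecewise translations.\<close>

definition cover_map :: "letter \<Rightarrow> real ^ 3 \<Rightarrow> real ^ 3" where
  "cover_map l x = (if x \<notin> unit_cube then x
     else if l = GA then cover_point (vec_frac (cover_base x + (if cover_sheet x then rot else - rot))) (\<not> cover_sheet x)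
     else cover_point (cover_base x) (cover_sheet x \<noteq> moves l (octant_type (cover_base x))))"

definition cover_track :: "real ^ 3 \<Rightarrow> int \<Rightarrow> real ^ 3" where
  "cover_track y k = cover_point (vec_frac (y + of_int (k div 2) *\<^sub>R rot)) (odd k)"

text \<open>The octant type is read off at \<open>z\<close> on both sheets, never at
  \<open>- z\<close>; therefore, unlike for the flips of the torus, the identity holds at all
  points, resonant or not.\<close>

lemma cover_map_track: "cover_map l (cover_track y k) = cover_track y (step (rot_type y) l k)"
proof -
  define n where "n = k div 2"
  define z where "z = y + of_int n *\<^sub>R rot"
  have u: "rot_type y n = octant_type z" by (simp add: rot_type_def z_def)
  have tr: "cover_track y k = cover_point (vec_frac z) (odd k)" by (simp add: cover_track_def z_def n_def)
  have m: "cover_map l (cover_track y k) = (if l = GA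
      then cover_point (vec_frac (z + (if odd k then rot else - rot))) (even k)
      else cover_point (vec_frac z) (odd k \<noteq> moves l (octant_type z)))"
    by (simp add: cover_map_def tr cover_point_in_unit_cube cover_base_point cover_sheet_point vec_frac_add_frac
        vec_frac_frac_diff)
  show ?thesis
  proof (cases "even k")
    case True
    then have k: "k = 2 * n" by (simp add: n_def)
    have d: "(n * 2 - 1) div 2 = n - 1" by presburger
    have "cover_track y (k - 1) = cover_point (vec_frac (z - rot)) True"
      by (simp add: cover_track_def k z_def mult.commute[of 2 n] d) (simp add: algebra_simps)
    moreover have "cover_track y (k + 1) = cover_point (vec_frac z) True"
      by (simp add: cover_track_def k z_def)
    ultimately show ?thesis
      using True unfolding m step_def n_def[symmetric] u by (simp add: tr)
  next
    case False
    then have k: "k = 2 * n + 1" by (simp add: n_def)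
    have "cover_track y (k + 1) = cover_point (vec_frac (z + rot)) False"
      "cover_track y (k - 1) = cover_point (vec_frac z) False"
      by (simp_all add: cover_track_def k z_def algebra_simps)
    then show ?thesis
      using False unfolding m step_def n_def[symmetric] u by (simp add: tr)
  qed
qed

lemma foldr_cover_map_track: "foldr cover_map w (cover_track y k) = cover_track y (walk (rot_type y) w k)"
  by (induction w) (simp_all add: cover_map_track)

lemma cover_track_base:
  assumes "x \<in> unit_cube"
  shows "x = cover_track (cover_base x) (of_bool (cover_sheet x))"
  using assms cover_point_base[of x] cover_base_in_unit_cube[of x]
  by (cases "cover_sheet x") (simp_all add: cover_track_def vec_frac_id)

lemma cover_track_in_unit_cube: "cover_track y k \<in> unit_cube"
  by (simp add: cover_track_def cover_point_in_unit_cube)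

text \<open>Even positions lie on one sheet, where the track is a plain rotation orbit; a
  coincidence would make a nonzero multiple of \<open>rot $ 2\<close> integral.\<close>

lemma cover_track_even_inject:
  assumes "cover_track y (2 * int m) = cover_track y (2 * int n)"
  shows "m = n"
proof -
  have "cover_base (cover_track y (2 * int m)) $ 2 = cover_base (cover_track y (2 * int n)) $ 2"
    using assms by simp
  then have "frac (y $ 2 + of_int (int m) * rot $ 2) = frac (y $ 2 + of_int (int n) * rot $ 2)"
    by (simp add: cover_track_def cover_base_point)
  then have "of_int (int m - int n) * rot $ 2 \<in> \<int>"
    unfolding frac_eq_iff by (simp add: algebra_simps)
  then have "int m - int n = 0" by (rule rot_multiple_not_int)
  then show ?thesis by simp
qed

text \<open>Every point of the cube is at position 0 or 1 of the track of its base, and letters are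
  involutions on positions.\<close>

lemma cover_map_involution: "cover_map l (cover_map l x) = x"
proof (cases "x \<in> unit_cube")
  case True
  then show ?thesis by (metis cover_track_base cover_map_track step_step)
qed (simp add: cover_map_def)

lemma cover_map_in_unit_cube: "x \<in> unit_cube \<Longrightarrow> cover_map l x \<in> unit_cube"
  by (metis cover_track_base cover_map_track cover_track_in_unit_cube)

lemma frac_add_rot: "0 \<le> r \<Longrightarrow> r < 1 \<Longrightarrow> frac (r + rot $ i) = r + rot $ i - of_bool (1 - rot $ i \<le> r)"
  and frac_diff_rot: "0 \<le> r \<Longrightarrow> r < 1 \<Longrightarrow> frac (r - rot $ i) = r - rot $ i + of_bool (\<not> rot $ i \<le> r)"
  using rot_bounds[of i] by (subst frac_unique_iff; simp)+

lemma cover_map_in_Rec_set: "cover_map l \<in> Rec_set"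
  unfolding Rec_set_iff
proof (intro conjI exI ballI impI)
  show "bij_betw (cover_map l) unit_cube unit_cube"
    by (rule bij_betw_byWitness[of _ "cover_map l"]) (auto simp: cover_map_involution cover_map_in_unit_cube)
  show "extensional_cube (cover_map l)" by (simp add: extensional_cube_def cover_map_def)
  \<comment> \<open>1/2 separates the sheets and is the octant wall of coordinates 2 and 3; 1/4 and
    3/4 are the octant walls of the first coordinate on the two sheets. \<open>rot $ 1 / 2\<close>
    and \<open>1 - rot $ 1 / 2\<close> are where its translation by \<open>GA\<close> wraps on the
    lower and on the upper sheet; \<open>rot $ i\<close> and \<open>1 - rot $ i\<close> play this
    part for the other coordinates.\<close>
  let ?T = "{1 / 4, 1 / 2, 3 / 4, rot $ 1 / 2, 1 - rot $ 1 / 2} \<union> range (($) rot) \<union> range (\<lambda>i. 1 - rot $ i)"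
  show "finite ?T" by simp
  fix x y :: "real ^ 3"
  assume x: "x \<in> unit_cube" and y: "y \<in> unit_cube" and c: "rcell ?T x = rcell ?T y"
  have le: "t \<le> x $ i \<longleftrightarrow> t \<le> y $ i" if "t \<in> ?T" for t i using c that unfolding rcell_eq_iff by blast
  have le': "1 / 4 \<le> x $ i \<longleftrightarrow> 1 / 4 \<le> y $ i" "1 / 2 \<le> x $ i \<longleftrightarrow> 1 / 2 \<le> y $ i" "3 / 4 \<le> x $ i \<longleftrightarrow> 3 / 4 \<le> y $ i"
    "rot $ 1 / 2 \<le> x $ i \<longleftrightarrow> rot $ 1 / 2 \<le> y $ i" "1 - rot $ 1 / 2 \<le> x $ i \<longleftrightarrow> 1 - rot $ 1 / 2 \<le> y $ i"
    "rot $ i \<le> x $ i \<longleftrightarrow> rot $ i \<le> y $ i" "1 - rot $ i \<le> x $ i \<longleftrightarrow> 1 - rot $ i \<le> y $ i" for i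
    by (rule le; blast)+
  have sheet: "cover_sheet x = cover_sheet y" using le'(2) by (simp add: cover_sheet_def)
  have bx: "0 \<le> x $ i" "x $ i < 1" and by': "0 \<le> y $ i" "y $ i < 1" for i
    using x y by (auto simp: unit_cube_def)
  show "cover_map l x - x = cover_map l y - y"
  proof (cases "l = GA")
    case True
    have disp: "(cover_map l x - x) $ i = (if i = 1 then (if cover_sheet x then (rot $ 1 - 1 - of_bool (1 - rot $ 1 / 2 \<le> x $ 1)) / 2
          else (1 - rot $ 1 + of_bool (\<not> rot $ 1 / 2 \<le> x $ 1)) / 2)
        else if cover_sheet x then rot $ i - of_bool (1 - rot $ i \<le> x $ i) else - rot $ i + of_bool (\<not> rot $ i \<le> x $ i))"
      if x: "x \<in> unit_cube" for x i
    proof -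
      have b: "0 \<le> x $ i" "x $ i < 1" for i using x by (auto simp: unit_cube_def)
      have s: "cover_sheet x \<longleftrightarrow> 1 / 2 \<le> x $ 1" by (simp add: cover_sheet_def)
      have base: "cover_base x $ 1 = 2 * x $ 1 - of_bool (cover_sheet x)" "i \<noteq> 1 \<Longrightarrow> cover_base x $ i = x $ i"
        using frac_double[OF x] by (simp_all add: cover_base_def)
      have b1: "0 \<le> cover_base x $ 1" "cover_base x $ 1 < 1"
        using cover_base_in_unit_cube[OF x] by (auto simp: unit_cube_def)
      have m: "(cover_map l x) $ i = (if i = 1 then (frac (if cover_sheet x then cover_base x $ 1 + rot $ 1 else cover_base x $ 1 - rot $ 1)
          + of_bool (\<not> cover_sheet x)) / 2 else frac (if cover_sheet x then x $ i + rot $ i else x $ i - rot $ i))"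
        using True x base(2) by (simp add: cover_map_def cover_point_def)
      show ?thesis
      proof (cases "i = 1")
        case i: True
        show ?thesis
        proof (cases "cover_sheet x")
          case True
          have "1 - rot $ 1 \<le> cover_base x $ 1 \<longleftrightarrow> 1 - rot $ 1 / 2 \<le> x $ 1"
            using True by (simp only: base(1)) (auto simp: field_simps)
          then show ?thesis
            unfolding vector_minus_component m using i True frac_add_rot[OF b1, of 1] by (simp only: if_True base(1)) (simp add: field_simps)
        next
          case False
          have "rot $ 1 \<le> cover_base x $ 1 \<longleftrightarrow> rot $ 1 / 2 \<le> x $ 1"
            using False by (simp only: base(1)) (auto simp: field_simps)
          then show ?thesis
            unfolding vector_minus_component m using i False frac_diff_rot[OF b1, of 1] by (simp only: if_True if_False base(1)) (simp add: field_simps)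
        qed
      next
        case False
        then show ?thesis
          unfolding vector_minus_component m using frac_add_rot[OF b[of i], of i] frac_diff_rot[OF b[of i], of i] by simp
      qed
    qed
    show ?thesis
      unfolding vec_eq_iff disp[OF x] disp[OF y] sheet le' by simp
  next
    case False
    have "low_half (cover_base x $ i) = low_half (cover_base y $ i)" for i
    proof (cases "i = 1")
      case True
      have "low_half (cover_base x $ 1) \<longleftrightarrow> (if cover_sheet x then \<not> 3 / 4 \<le> x $ 1 else \<not> 1 / 4 \<le> x $ 1)"
        if "x \<in> unit_cube" for x
      proof -
        have "cover_base x $ 1 = 2 * x $ 1 - of_bool (cover_sheet x)"
          using frac_double[OF that] by (simp add: cover_base_def)
        moreover have "frac (cover_base x $ 1) = cover_base x $ 1"
          using cover_base_in_unit_cube[OF that] by (simp add: unit_cube_def frac_eq)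
        ultimately have "low_half (cover_base x $ 1) \<longleftrightarrow> 2 * x $ 1 - of_bool (cover_sheet x) < 1 / 2"
          by (simp only: low_half_def)
        then show ?thesis by (auto simp: cover_sheet_def)
      qed
      then show ?thesis using x y sheet le' True by simp
    next
      case False
      then show ?thesis
        using le'(2)[of i] bx[of i] by'[of i] by (simp add: low_half_def cover_base_def frac_eq not_le[symmetric])
    qed
    then have "octant_type (cover_base x) = octant_type (cover_base y)" by (rule octant_type_cong)
    moreover have "(cover_map l x - x) $ i = (if i = 1 then (of_bool (cover_sheet x \<noteq> moves l (octant_type (cover_base x))) - of_bool (cover_sheet x)) / 2 else 0)"
      if "x \<in> unit_cube" for x i
      using False that frac_double[OF that] by (simp add: cover_map_def cover_point_def cover_base_def[of x] field_simps)
    ultimately show ?thesis using x y sheet by (simp add: vec_eq_iff)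
  qed
qed

theorem Rec_torsion_group:
  "infinite (generate Rec (range cover_map)) \<and> torsion_set Rec (generate Rec (range cover_map))"
proof -
  interpret group "Rec :: (real ^ 3 \<Rightarrow> real ^ 3) monoid" by (rule group_Rec)
  have carr [simp]: "carrier Rec = Rec_set" and mult: "(\<otimes>\<^bsub>Rec\<^esub>) = (\<circ>)" and one: "\<one>\<^bsub>Rec\<^esub> = id"
    by (simp_all add: Rec_def fun_eq_iff)
  have c: "\<And>l. cover_map l \<in> carrier Rec" by (simp add: cover_map_in_Rec_set)
  have wp: "word_prod Rec cover_map w x = foldr cover_map w x" for w x
    by (induction w) (simp_all add: mult one)
  have gen: "generate Rec (range cover_map) = range (word_prod Rec cover_map)"
    by (rule generate_involutions[OF c]) (simp add: mult one fun_eq_iff cover_map_involution)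
  have "infinite (generate Rec (range cover_map))"
  proof
    assume "finite (generate Rec (range cover_map))"
    then have fin: "finite ((\<lambda>h. h (cover_track 0 0)) ` generate Rec (range cover_map))" by (rule finite_imageI)
    have "inj (\<lambda>k. cover_track 0 (2 * int k))" by (rule injI) (rule cover_track_even_inject)
    then have "infinite (range (\<lambda>k. cover_track 0 (2 * int k)))" by (rule range_inj_infinite)
    moreover have "range (\<lambda>k. cover_track 0 (2 * int k)) \<subseteq> (\<lambda>h. h (cover_track 0 0)) ` generate Rec (range cover_map)"
    proof
      fix y assume "y \<in> range (\<lambda>k. cover_track 0 (2 * int k))"
      then obtain k where y: "y = cover_track 0 (2 * int k)" by blast
      obtain w where "walk (rot_type 0) w 0 = int (2 * k)"
        using walk_reaches[of "rot_type 0" "2 * k"] octant_type_lt_3 unfolding rot_type_def by metis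
      then have "y = word_prod Rec cover_map w (cover_track 0 0)" by (simp add: wp foldr_cover_map_track y)
      then show "y \<in> (\<lambda>h. h (cover_track 0 0)) ` generate Rec (range cover_map)" unfolding gen by blast
    qed
    ultimately show False using fin finite_subset by blast
  qed
  moreover have "torsion_set Rec (generate Rec (range cover_map))"
    unfolding torsion_set_def gen
  proof
    fix h assume "h \<in> range (word_prod Rec cover_map)"
    then obtain w where h: "h = word_prod Rec cover_map w" by blast
    obtain N where N: "N > 0" "\<And>y k. (walk (rot_type y) w ^^ N) k = k"
      using rot_walk_torsion by metis
    define W where "W = concat (replicate N w)"
    have "foldr cover_map W x = x" for x
    proof (cases "x \<in> unit_cube")
      case True
      obtain y k where x: "x = cover_track y k" using cover_track_base[OF True] by blast
      show ?thesis unfolding x foldr_cover_map_track W_def walk_funpow[symmetric] N(2) ..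
    next
      case False
      then show ?thesis by (induction W) (simp_all add: cover_map_def)
    qed
    then have "word_prod Rec cover_map W = \<one>\<^bsub>Rec\<^esub>" by (simp add: fun_eq_iff wp one)
    then have "h [^]\<^bsub>Rec\<^esub> N = \<one>\<^bsub>Rec\<^esub>" using word_prod_pow[of cover_map w N, OF c] by (simp add: h W_def)
    then show "\<exists>n::nat. 0 < n \<and> h [^]\<^bsub>Rec\<^esub> n = \<one>\<^bsub>Rec\<^esub>" using N(1) by blast
  qed
  ultimately show ?thesis ..
qed

theorem mainTheorem11:
  shows "group (RecB :: (real ^ 3 \<Rightarrow> real ^ 3) monoid) \<and>
    (\<exists>(a::real ^ 3 \<Rightarrow> real ^ 3) b c. a \<in> carrier RecB \<and> b \<in> carrier RecB \<and> c \<in> carrier RecB \<and>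
       a \<noteq> b \<and> a \<noteq> c \<and> b \<noteq> c \<and>
       group.ord RecB a = 2 \<and> group.ord RecB b = 2 \<and> group.ord RecB c = 2 \<and>
       infinite (generate RecB {a, b, c}) \<and> torsion_set RecB (generate RecB {a, b, c}))
  \<and> group (Rec :: (real ^ 3 \<Rightarrow> real ^ 3) monoid) \<and>
    (\<exists>S :: (real ^ 3 \<Rightarrow> real ^ 3) set. finite S \<and> S \<subseteq> carrier Rec \<and>
       infinite (generate Rec S) \<and> torsion_set Rec (generate Rec S))"
proof (intro conjI)
  obtain g :: "letter \<Rightarrow> real ^ 3 \<Rightarrow> real ^ 3" where g: "\<And>l. g l \<in> carrier RecB" "inj g"
    "\<And>l. group.ord RecB (g l) = 2" "infinite (generate RecB (range g))" "torsion_set RecB (generate RecB (range g))"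
    by (rule RecB_torsion_group, rule that)
  have "range g = {g GA, g GB, g GC}" by (simp add: UNIV_letter)
  moreover have "g GA \<noteq> g GB" "g GA \<noteq> g GC" "g GB \<noteq> g GC" using g(2) by (auto dest: injD)
  ultimately show "\<exists>(a::real ^ 3 \<Rightarrow> real ^ 3) b c. a \<in> carrier RecB \<and> b \<in> carrier RecB \<and> c \<in> carrier RecB \<and>
       a \<noteq> b \<and> a \<noteq> c \<and> b \<noteq> c \<and>
       group.ord RecB a = 2 \<and> group.ord RecB b = 2 \<and> group.ord RecB c = 2 \<and>
       infinite (generate RecB {a, b, c}) \<and> torsion_set RecB (generate RecB {a, b, c})"
    using g by (intro exI[of _ "g GA"] exI[of _ "g GB"] exI[of _ "g GC"]) simp
  have "finite (range cover_map)" by (simp add: UNIV_letter)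
  moreover have "range cover_map \<subseteq> carrier Rec" by (auto simp: Rec_def cover_map_in_Rec_set)
  ultimately show "\<exists>S :: (real ^ 3 \<Rightarrow> real ^ 3) set. finite S \<and> S \<subseteq> carrier Rec \<and>
       infinite (generate Rec S) \<and> torsion_set Rec (generate Rec S)"
    using Rec_torsion_group by blast
qed (rule group_RecB, rule group_Rec)

end
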